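(* Let $k\subset L$ be a finite algebraic extension of fields of prime characteristic $p$ such that $L^p\cap k=k^p$ and $k\subset L$ is not separable. Let $x$ be an indeterminate and consider $R=k+xL[[x]]$ (the subring of $L[[x]]$ consisting of power series with constant term in $k$). Then: (1) $R$ is an $F$-injective local complete $F$-stable $1$-dimensional ring. (2) $R\otimes_k k^{1/p}$ is not reduced, hence not $F$-injective.
   Context: For a Noetherian local ring $(A,\mathfrak n)$ of prime characteristic $p$, the Frobenius $r\mapsto r^p$ acts on $A$ and its localizations, hence on the Čech complex of a system of parameters, and so induces a natural Frobenius action $F$ (an additive map with $F(rm)=r^pF(m)$) on each local cohomology module $H^i_{\mathfrak n}(A)$. $A$ is $F$-injective if $F$ is injective on $H^i_{\mathfrak n}(A)$ for all $i$. For an Artinian $A$-module $M$ with Frobenius action $F$ and socle $S=\{x\in M:\mathfrak n x=0\}$, put $F^e(S)=\{F^e(m):m\in S\}$. $M$ is $F$-unstable if there exists $N>0$ with $S\cap F^e(S)=0$ for all $e\ge N$ (the zero module is $F$-unstable), and $F$-stable otherwise. The ring $A$ is $F$-unstable if $H^i_{\mathfrak n}(A)$ is $F$-unstable for every $i$, and $F$-stable otherwise. $L^p=\{a^p: a\in L\}$, $k^p=\{a^p:a\in k\}$, and $k^{1/p}$ is the field of $p$-th roots of elements of $k$ in an algebraic closure of $k$. *)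

theory Defs
  imports
    "HOL-Computational_Algebra.Computational_Algebra"
    "HOL-Algebra.Algebraic_Closure_Type"
    "HOL-Algebra.Free_Abelian_Groups"
    "HOL-Algebra.Ideal_Product"
    "HOL-Algebra.Ring_Divisibility"
    "HOL-Algebra.Embedded_Algebras"
    "HOL-Algebra.Module"
    "HOL-Library.Extended_Nat"
begin

section \<open>Separable extensions\<close>

text \<open>The big field is the whole type \<open>'l\<close>, the small field a subset \<open>K\<close> of it.\<close>

definition minimal_polynomial :: "'l::field set \<Rightarrow> 'l \<Rightarrow> 'l poly \<Rightarrow> bool" where
  "minimal_polynomial K a P \<longleftrightarrow>
     (\<forall>i. coeff P i \<in> K) \<and> lead_coeff P = 1 \<and> poly P a = 0 \<and>
     (\<forall>Q. (\<forall>i. coeff Q i \<in> K) \<and> Q \<noteq> 0 \<and> poly Q a = 0 \<longrightarrow> degree P \<le> degree Q)"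

text \<open>Over the algebraic closure, \<^const>\<open>rsquarefree\<close> says that all roots are simple.\<close>

definition separable_extension :: "'l::field set \<Rightarrow> bool" where
  "separable_extension K \<longleftrightarrow>
     (\<forall>a. \<exists>P. minimal_polynomial K a P \<and> rsquarefree (map_poly to_ac P))"


section \<open>Local rings\<close>

definition noetherian_local_ring :: "('a, 'm) ring_scheme \<Rightarrow> bool" where
  "noetherian_local_ring A \<longleftrightarrow> cring A \<and> noetherian_ring A \<and> (\<exists>!I. maximalideal I A)"

definition max_ideal :: "('a, 'm) ring_scheme \<Rightarrow> 'a set" where
  "max_ideal A = (THE I. maximalideal I A)"

definition reduced_ring :: "('a, 'm) ring_scheme \<Rightarrow> bool" where
  "reduced_ring A \<longleftrightarrow>
     (\<forall>a\<in>carrier A. \<forall>n::nat. a [^]\<^bsub>A\<^esub> n = \<zero>\<^bsub>A\<^esub> \<longrightarrow> a = \<zero>\<^bsub>A\<^esub>)"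

definition krull_dim :: "('a, 'm) ring_scheme \<Rightarrow> enat" where
  "krull_dim A = Sup {enat n | n. \<exists>P :: nat \<Rightarrow> 'a set.
     (\<forall>i\<le>n. primeideal (P i) A) \<and> (\<forall>i<n. P i \<subset> P (Suc i))}"

text \<open>Powers of the maximal ideal are taken in the semiring \<^const>\<open>ideals_set\<close> of all ideals,
  whose multiplication is the product of ideals.\<close>

definition max_ideal_power :: "('a, 'm) ring_scheme \<Rightarrow> nat \<Rightarrow> 'a set" where
  "max_ideal_power A n = max_ideal A [^]\<^bsub>ideals_set A\<^esub> n"

definition complete_local :: "('a, 'm) ring_scheme \<Rightarrow> bool" where
  "complete_local A \<longleftrightarrow>
     (\<Inter>n. max_ideal_power A n) = {\<zero>\<^bsub>A\<^esub>} \<and>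
     (\<forall>f :: nat \<Rightarrow> 'a. range f \<subseteq> carrier A \<and>
          (\<forall>n. \<exists>N. \<forall>i\<ge>N. \<forall>j\<ge>N. f i \<ominus>\<^bsub>A\<^esub> f j \<in> max_ideal_power A n) \<longrightarrow>
        (\<exists>a\<in>carrier A. \<forall>n. \<exists>N. \<forall>i\<ge>N. f i \<ominus>\<^bsub>A\<^esub> a \<in> max_ideal_power A n))"

text \<open>A system of parameters: \<open>dim A\<close> many elements of the maximal ideal generating an ideal whose
  radical is the maximal ideal.\<close>

definition system_of_parameters :: "('a, 'm) ring_scheme \<Rightarrow> 'a list \<Rightarrow> bool" where
  "system_of_parameters A xs \<longleftrightarrow>
     enat (length xs) = krull_dim A \<and> set xs \<subseteq> max_ideal A \<and>
     (\<forall>a\<in>max_ideal A. \<exists>n::nat. a [^]\<^bsub>A\<^esub> n \<in> Idl\<^bsub>A\<^esub> (set xs))"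


section \<open>Localization\<close>

text \<open>The fraction \<open>a / s\<close> as an equivalence class of pairs, for a multiplicative set \<open>M\<close>.\<close>

definition fraction :: "('a, 'm) ring_scheme \<Rightarrow> 'a set \<Rightarrow> 'a \<Rightarrow> 'a \<Rightarrow> ('a \<times> 'a) set" where
  "fraction A M a s = {(b, t). b \<in> carrier A \<and> t \<in> M \<and>
     (\<exists>u\<in>M. u \<otimes>\<^bsub>A\<^esub> (t \<otimes>\<^bsub>A\<^esub> a \<ominus>\<^bsub>A\<^esub> s \<otimes>\<^bsub>A\<^esub> b) = \<zero>\<^bsub>A\<^esub>)}"

definition localization :: "('a, 'm) ring_scheme \<Rightarrow> 'a set \<Rightarrow> ('a \<times> 'a) set ring" where
  "localization A M = \<lparr>
     carrier = {fraction A M a s | a s. a \<in> carrier A \<and> s \<in> M},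
     monoid.mult = (\<lambda>U V. \<Union>(a, s)\<in>U. \<Union>(b, t)\<in>V. fraction A M (a \<otimes>\<^bsub>A\<^esub> b) (s \<otimes>\<^bsub>A\<^esub> t)),
     one = fraction A M \<one>\<^bsub>A\<^esub> \<one>\<^bsub>A\<^esub>,
     ring.zero = fraction A M \<zero>\<^bsub>A\<^esub> \<one>\<^bsub>A\<^esub>,
     add = (\<lambda>U V. \<Union>(a, s)\<in>U. \<Union>(b, t)\<in>V.
              fraction A M (a \<otimes>\<^bsub>A\<^esub> t \<oplus>\<^bsub>A\<^esub> b \<otimes>\<^bsub>A\<^esub> s) (s \<otimes>\<^bsub>A\<^esub> t)) \<rparr>"


section \<open>The Cech complex and its Frobenius\<close>

text \<open>For \<open>S\<close> a set of positions in the list \<open>xs\<close>, the localization of \<open>A\<close> at the product of the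
  \<open>xs ! j\<close> with \<open>j \<in> S\<close> is obtained by inverting all monomials in these elements. The submonoid
  generated by them is used instead of the powers of the product, so that the restriction maps are
  simply \<open>a / s \<mapsto> a / s\<close>.\<close>

definition cech_denoms :: "('a, 'm) ring_scheme \<Rightarrow> 'a list \<Rightarrow> nat set \<Rightarrow> 'a set" where
  "cech_denoms A xs S = {finprod A (\<lambda>j. (xs ! j) [^]\<^bsub>A\<^esub> e j) S | e :: nat \<Rightarrow> nat. True}"

definition cech_loc :: "('a, 'm) ring_scheme \<Rightarrow> 'a list \<Rightarrow> nat set \<Rightarrow> ('a \<times> 'a) set ring" where
  "cech_loc A xs S = localization A (cech_denoms A xs S)"

definition cech_index :: "'a list \<Rightarrow> nat \<Rightarrow> nat set set" where
  "cech_index xs i = {S. S \<subseteq> {..<length xs} \<and> card S = i}"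

definition cech_module ::
  "('a, 'm) ring_scheme \<Rightarrow> 'a list \<Rightarrow> nat \<Rightarrow> ('a, nat set \<Rightarrow> ('a \<times> 'a) set) module" where
  "cech_module A xs i = \<lparr>
     carrier = (\<Pi>\<^sub>E S\<in>cech_index xs i. carrier (cech_loc A xs S)),
     monoid.mult = (\<lambda>\<phi> \<psi>. \<lambda>S\<in>cech_index xs i. \<phi> S \<otimes>\<^bsub>cech_loc A xs S\<^esub> \<psi> S),
     one = (\<lambda>S\<in>cech_index xs i. \<one>\<^bsub>cech_loc A xs S\<^esub>),
     ring.zero = (\<lambda>S\<in>cech_index xs i. \<zero>\<^bsub>cech_loc A xs S\<^esub>),
     add = (\<lambda>\<phi> \<psi>. \<lambda>S\<in>cech_index xs i. \<phi> S \<oplus>\<^bsub>cech_loc A xs S\<^esub> \<psi> S),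
     module.smult = (\<lambda>r \<phi>. \<lambda>S\<in>cech_index xs i.
                fraction A (cech_denoms A xs S) r \<one>\<^bsub>A\<^esub> \<otimes>\<^bsub>cech_loc A xs S\<^esub> \<phi> S) \<rparr>"

text \<open>The canonical map into the localization indexed by \<open>S\<close>, from one indexed by a subset of \<open>S\<close>.\<close>

definition cech_restrict ::
  "('a, 'm) ring_scheme \<Rightarrow> 'a list \<Rightarrow> nat set \<Rightarrow> ('a \<times> 'a) set \<Rightarrow> ('a \<times> 'a) set" where
  "cech_restrict A xs S U = (\<Union>(a, s)\<in>U. fraction A (cech_denoms A xs S) a s)"

definition cech_diff ::
  "('a, 'm) ring_scheme \<Rightarrow> 'a list \<Rightarrow> nat \<Rightarrow>
     (nat set \<Rightarrow> ('a \<times> 'a) set) \<Rightarrow> (nat set \<Rightarrow> ('a \<times> 'a) set)" where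
  "cech_diff A xs i \<phi> = (\<lambda>S\<in>cech_index xs (Suc i).
     finsum (cech_loc A xs S)
       (\<lambda>j. if even (card {l \<in> S. l < j})
            then cech_restrict A xs S (\<phi> (S - {j}))
            else \<ominus>\<^bsub>cech_loc A xs S\<^esub> cech_restrict A xs S (\<phi> (S - {j}))) S)"

definition cech_cocycles ::
  "('a, 'm) ring_scheme \<Rightarrow> 'a list \<Rightarrow> nat \<Rightarrow> (nat set \<Rightarrow> ('a \<times> 'a) set) set" where
  "cech_cocycles A xs i =
     {\<phi> \<in> carrier (cech_module A xs i). cech_diff A xs i \<phi> = \<zero>\<^bsub>cech_module A xs (Suc i)\<^esub>}"

definition cech_coboundaries ::
  "('a, 'm) ring_scheme \<Rightarrow> 'a list \<Rightarrow> nat \<Rightarrow> (nat set \<Rightarrow> ('a \<times> 'a) set) set" where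
  "cech_coboundaries A xs i =
     (case i of 0 \<Rightarrow> {\<zero>\<^bsub>cech_module A xs 0\<^esub>}
      | Suc j \<Rightarrow> cech_diff A xs j ` carrier (cech_module A xs j))"

text \<open>Cohomology as an \<open>A\<close>-module of cosets. The type \<^typ>\<open>('a, 'b) module\<close> has fields for a ring
  multiplication and a one, which a module does not have; they are left unspecified.\<close>

definition cech_cohomology ::
  "('a, 'm) ring_scheme \<Rightarrow> 'a list \<Rightarrow> nat \<Rightarrow> ('a, (nat set \<Rightarrow> ('a \<times> 'a) set) set) module" where
  "cech_cohomology A xs i = \<lparr>
     carrier = (\<lambda>\<phi>. cech_coboundaries A xs i +>\<^bsub>cech_module A xs i\<^esub> \<phi>) ` cech_cocycles A xs i,
     monoid.mult = undefined,
     one = undefined,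
     ring.zero = cech_coboundaries A xs i,
     add = (\<lambda>U V. U <+>\<^bsub>cech_module A xs i\<^esub> V),
     module.smult = (\<lambda>r U. \<Union>\<phi>\<in>U. cech_coboundaries A xs i +>\<^bsub>cech_module A xs i\<^esub>
                            (r \<odot>\<^bsub>cech_module A xs i\<^esub> \<phi>)) \<rparr>"

definition cech_frobenius ::
  "nat \<Rightarrow> ('a, 'm) ring_scheme \<Rightarrow> 'a list \<Rightarrow> nat \<Rightarrow>
     (nat set \<Rightarrow> ('a \<times> 'a) set) \<Rightarrow> (nat set \<Rightarrow> ('a \<times> 'a) set)" where
  "cech_frobenius p A xs i \<phi> = (\<lambda>S\<in>cech_index xs i. \<phi> S [^]\<^bsub>cech_loc A xs S\<^esub> p)"

definition cohomology_frobenius ::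
  "nat \<Rightarrow> ('a, 'm) ring_scheme \<Rightarrow> 'a list \<Rightarrow> nat \<Rightarrow>
     (nat set \<Rightarrow> ('a \<times> 'a) set) set \<Rightarrow> (nat set \<Rightarrow> ('a \<times> 'a) set) set" where
  "cohomology_frobenius p A xs i U =
     (\<Union>\<phi>\<in>U. cech_coboundaries A xs i +>\<^bsub>cech_module A xs i\<^esub> cech_frobenius p A xs i \<phi>)"


section \<open>Local cohomology, F-injectivity and F-stability\<close>

text \<open>The chosen system of parameters is immaterial: the cohomology is independent of it up to
  isomorphisms of modules that commute with the Frobenius actions. The notions below are meant
  for Noetherian local rings of prime characteristic \<open>p\<close>.\<close>

definition some_parameters :: "('a, 'm) ring_scheme \<Rightarrow> 'a list" where
  "some_parameters A = (SOME xs. system_of_parameters A xs)"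

definition local_cohomology ::
  "('a, 'm) ring_scheme \<Rightarrow> nat \<Rightarrow> ('a, (nat set \<Rightarrow> ('a \<times> 'a) set) set) module" where
  "local_cohomology A i = cech_cohomology A (some_parameters A) i"

definition local_cohomology_frobenius ::
  "nat \<Rightarrow> ('a, 'm) ring_scheme \<Rightarrow> nat \<Rightarrow>
     (nat set \<Rightarrow> ('a \<times> 'a) set) set \<Rightarrow> (nat set \<Rightarrow> ('a \<times> 'a) set) set" where
  "local_cohomology_frobenius p A i = cohomology_frobenius p A (some_parameters A) i"

definition F_injective :: "nat \<Rightarrow> ('a, 'm) ring_scheme \<Rightarrow> bool" where
  "F_injective p A \<longleftrightarrow>
     (\<forall>i. inj_on (local_cohomology_frobenius p A i) (carrier (local_cohomology A i)))"

definition socle :: "('a, 'm) ring_scheme \<Rightarrow> ('a, 'b, 'n) module_scheme \<Rightarrow> 'b set" where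
  "socle A M = {x \<in> carrier M. \<forall>r\<in>max_ideal A. r \<odot>\<^bsub>M\<^esub> x = \<zero>\<^bsub>M\<^esub>}"

definition F_unstable_module ::
  "('a, 'm) ring_scheme \<Rightarrow> ('a, 'b, 'n) module_scheme \<Rightarrow> ('b \<Rightarrow> 'b) \<Rightarrow> bool" where
  "F_unstable_module A M F \<longleftrightarrow>
     (\<exists>N>0. \<forall>e\<ge>N. socle A M \<inter> (F ^^ e) ` socle A M = {\<zero>\<^bsub>M\<^esub>})"

definition F_unstable :: "nat \<Rightarrow> ('a, 'm) ring_scheme \<Rightarrow> bool" where
  "F_unstable p A \<longleftrightarrow>
     (\<forall>i. F_unstable_module A (local_cohomology A i) (local_cohomology_frobenius p A i))"

abbreviation F_stable :: "nat \<Rightarrow> ('a, 'm) ring_scheme \<Rightarrow> bool" where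
  "F_stable p A \<equiv> \<not> F_unstable p A"


section \<open>Tensor products of algebras\<close>

text \<open>The integral monoid ring of the multiplicative monoid \<open>A \<times> B\<close>.\<close>

definition free_tensor_ring ::
  "('a, 'm) ring_scheme \<Rightarrow> ('b, 'n) ring_scheme \<Rightarrow> ('a \<times> 'b \<Rightarrow>\<^sub>0 int) ring" where
  "free_tensor_ring A B = \<lparr>
     carrier = carrier (free_Abelian_group (carrier A \<times> carrier B)),
     monoid.mult = (\<lambda>c d. \<Sum>(a, b)\<in>Poly_Mapping.keys c. \<Sum>(a', b')\<in>Poly_Mapping.keys d.
        Poly_Mapping.single (a \<otimes>\<^bsub>A\<^esub> a', b \<otimes>\<^bsub>B\<^esub> b')
          (Poly_Mapping.lookup c (a, b) * Poly_Mapping.lookup d (a', b'))),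
     one = Poly_Mapping.single (\<one>\<^bsub>A\<^esub>, \<one>\<^bsub>B\<^esub>) 1,
     ring.zero = 0,
     add = (+) \<rparr>"

text \<open>\<open>A\<close> and \<open>B\<close> are algebras over \<open>K\<close> through the structure maps \<open>f\<close> and \<open>g\<close>. The relations below
  are stable under multiplication by basis elements, so the ideal they generate
  is already the additive subgroup they generate.\<close>

definition tensor_relations ::
  "'k set \<Rightarrow> ('k \<Rightarrow> 'a) \<Rightarrow> ('a, 'm) ring_scheme \<Rightarrow> ('k \<Rightarrow> 'b) \<Rightarrow> ('b, 'n) ring_scheme \<Rightarrow>
     ('a \<times> 'b \<Rightarrow>\<^sub>0 int) set" where
  "tensor_relations K f A g B =
     {Poly_Mapping.single (a \<oplus>\<^bsub>A\<^esub> a', b) 1 - Poly_Mapping.single (a, b) 1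
        - Poly_Mapping.single (a', b) 1 | a a' b.
        a \<in> carrier A \<and> a' \<in> carrier A \<and> b \<in> carrier B} \<union>
     {Poly_Mapping.single (a, b \<oplus>\<^bsub>B\<^esub> b') 1 - Poly_Mapping.single (a, b) 1
        - Poly_Mapping.single (a, b') 1 | a b b'.
        a \<in> carrier A \<and> b \<in> carrier B \<and> b' \<in> carrier B} \<union>
     {Poly_Mapping.single (f c \<otimes>\<^bsub>A\<^esub> a, b) 1 - Poly_Mapping.single (a, g c \<otimes>\<^bsub>B\<^esub> b) 1 | c a b.
        c \<in> K \<and> a \<in> carrier A \<and> b \<in> carrier B}"

definition tensor_ring ::
  "'k set \<Rightarrow> ('k \<Rightarrow> 'a) \<Rightarrow> ('a, 'm) ring_scheme \<Rightarrow> ('k \<Rightarrow> 'b) \<Rightarrow> ('b, 'n) ring_scheme \<Rightarrow>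
     ('a \<times> 'b \<Rightarrow>\<^sub>0 int) set ring" where
  "tensor_ring K f A g B =
     free_tensor_ring A B Quot (Idl\<^bsub>free_tensor_ring A B\<^esub> (tensor_relations K f A g B))"


section \<open>The rings of the proposition\<close>

definition constant_term_ring :: "'l::field set \<Rightarrow> 'l fps ring" where
  "constant_term_ring K =
     ring_of_type_algebra \<lparr>carrier := {fps_const a + fps_X * h | a h. a \<in> K}\<rparr>"

text \<open>The \<open>p\<close>-th roots are taken in the algebraic closure of the big field, which is also an algebraic
  closure of \<open>K\<close> whenever the extension is algebraic.\<close>

definition pth_root_field :: "nat \<Rightarrow> 'l::field set \<Rightarrow> 'l alg_closure ring" where
  "pth_root_field p K = ring_of_type_algebra \<lparr>carrier := {b. b ^ p \<in> to_ac ` K}\<rparr>"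

definition base_changed_ring ::
  "nat \<Rightarrow> 'l::field set \<Rightarrow> ('l fps \<times> 'l alg_closure \<Rightarrow>\<^sub>0 int) set ring" where
  "base_changed_ring p K =
     tensor_ring K fps_const (constant_term_ring K) to_ac (pth_root_field p K)"

end

(* Write R = K + x L[[x]]. For any parameter y, the only nonzero local cohomology module of R is
   R_y / R = L((x)) / R with the Frobenius induced by f -> f^p. If f^p lies in R then f is a power
   series whose constant term has its p-th power in K, so f lies in R by the hypothesis on p-th
   powers; hence R is F-injective. The socle L / K is stable under Frobenius and every power of
   Frobenius is injective on it, so R is F-stable as soon as K differs from L.

   Both R and R (x) K^(1/p) are rings T generated by R and a field B with b^q in K for all b in B
   (q = 1 and q = p). Every t in T has t^q in R, so T has only two primes, the nilpotents and
   the unique maximal ideal, and the q-th power decides which elements are units. T is finite over the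
   subring D generated by K[[x]] and B, and every nonzero element of D is a power of x times a
   unit; this makes T Noetherian, although B need not be finite over K.

   If P(X) = Q(X^p) is an inseparable minimal polynomial over K of an element a of L, the sum z of the
   a^i x (x) q_i^(1/p) satisfies z^p = Q(a^p) x^p = 0, while 1, a, ..., a^(deg Q) are linearly
   independent. A linear functional separating the last power from the others shows that z / y^(2p)
   does not come from T, so it gives a nonzero class in T_y / T that is killed by Frobenius. *)

theory Submission
  imports Defs
begin


section \<open>Commutative rings\<close>

text \<open>Equalities in a tensor product are easy to prove, inequalities are not. Every
  nonvanishing statement about T is therefore read off from additive maps: a K-linear map from R to
  the algebraic closure extends to T (\<open>functional\<close>), and the coefficient maps of power
  series, composed with a functional on L where needed, suffice. Nothing multiplicative is known
  about such an extension, so the residue map is never treated as a ring homomorphism; q-th powers,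
  which land in the image of R, do that work. R is not closed under division by x, because the
  constant term of f/x may lie outside K. This costs an extra power of x in several places: a
  nonunit of T needs exponent 2q, not q, before x divides it inside T. It also forces the factor x
  in z, as the powers of a need not lie in R. The parameters behind local cohomology are an
  unspecified choice, so the argument cannot use x itself. Of y only y^q = r is controlled, a series
  of some positive order k; z has order 1, and 2k > 1 is what makes z / y^(2q) non-integral.\<close>

lemma ring_of_type_algebra_simps [simp]:
  "carrier (ring_of_type_algebra :: 'a::ring_1 ring) = UNIV"
  "x \<otimes>\<^bsub>ring_of_type_algebra\<^esub> y = x * (y :: 'a)"
  "x \<oplus>\<^bsub>ring_of_type_algebra\<^esub> y = x + (y :: 'a)"
  "\<one>\<^bsub>ring_of_type_algebra\<^esub> = (1 :: 'a)"
  "\<zero>\<^bsub>ring_of_type_algebra\<^esub> = (0 :: 'a)"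
  by (simp_all add: ring_of_type_algebra_def)

lemma (in cring) binomial_expansion:
  assumes a: "a \<in> carrier R" and b: "b \<in> carrier R"
  shows "(a \<oplus> b) [^] n = (\<Oplus>k\<in>{..n}. add_pow R (n choose k) (a [^] k \<otimes> b [^] (n - k)))"
proof (induction n)
  case 0
  then show ?case using a b by simp
next
  case (Suc n)
  let ?t = "\<lambda>(n::nat) (k::nat). a [^] k \<otimes> b [^] (n - k)"
  have t: "?t m k \<in> carrier R" for m k using a b by simp
  have sa: "(\<Oplus>k\<in>{..n}. add_pow R (n choose k) (?t n k)) \<otimes> a = (\<Oplus>k\<in>{..n}. add_pow R (n choose k) (?t (Suc n) (Suc k)))"
    using a b by (subst finsum_ldistr)
      (auto intro!: finsum_cong' simp: add_pow_ldistr add_pow_rdistr m_ac)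
  have sb: "(\<Oplus>k\<in>{..n}. add_pow R (n choose k) (?t n k)) \<otimes> b = (\<Oplus>k\<in>{..n}. add_pow R (n choose k) (?t (Suc n) k))"
    using a b by (subst finsum_ldistr)
      (auto intro!: finsum_cong' simp: add_pow_ldistr add_pow_rdistr m_ac Suc_diff_le)
  have f0: "{..Suc n} = insert 0 (Suc ` {..n})"
    by (simp add: atMost_Suc_eq_insert_0)
  have split: "(\<Oplus>k\<in>{..Suc n}. h k) = h 0 \<oplus> (\<Oplus>k\<in>{..n}. h (Suc k))"
    if h: "\<And>k. h k \<in> carrier R" for h :: "nat \<Rightarrow> 'a"
    unfolding f0 using h
    by (subst finsum_insert) (auto simp: finsum_reindex)
  \<comment> \<open>Widening the range to \<open>{..Suc n}\<close> changes nothing, since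
    \<open>n choose Suc n\<close> is 0; splitting off index 0 then aligns this sum with
    \<open>sa\<close> for Pascal's rule.\<close>
  have z: "(\<Oplus>k\<in>{..n}. add_pow R (n choose k) (?t (Suc n) k))
      = ?t (Suc n) 0 \<oplus> (\<Oplus>k\<in>{..n}. add_pow R (n choose (Suc k)) (?t (Suc n) (Suc k)))"
  proof -
    have "(\<Oplus>k\<in>{..Suc n}. add_pow R (n choose k) (?t (Suc n) k))
      = add_pow R (n choose (Suc n)) (?t (Suc n) (Suc n)) \<oplus> (\<Oplus>k\<in>{..n}. add_pow R (n choose k) (?t (Suc n) k))"
      using t by (subst finsum_Suc) auto
    moreover have "(\<Oplus>k\<in>{..n}. add_pow R (n choose k) (?t (Suc n) k)) \<in> carrier R"
      using t by (intro finsum_closed) auto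
    ultimately have "(\<Oplus>k\<in>{..n}. add_pow R (n choose k) (?t (Suc n) k)) =
        (\<Oplus>k\<in>{..Suc n}. add_pow R (n choose k) (?t (Suc n) k))"
      using a b by (simp add: binomial_eq_0)
    also have "\<dots> = add_pow R (n choose 0) (?t (Suc n) 0) \<oplus>
        (\<Oplus>k\<in>{..n}. add_pow R (n choose (Suc k)) (?t (Suc n) (Suc k)))"
      using t by (intro split) simp
    finally show ?thesis using a b by simp
  qed
  have "(a \<oplus> b) [^] Suc n = (\<Oplus>k\<in>{..n}. add_pow R (n choose k) (?t (Suc n) (Suc k))) \<oplus>
     (\<Oplus>k\<in>{..n}. add_pow R (n choose k) (?t (Suc n) k))"
    using a b t by (simp only: nat_pow_Suc Suc.IH r_distr finsum_closed add.nat_pow_closed Pi_I sa sb)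
  also have "\<dots> = ?t (Suc n) 0 \<oplus> ((\<Oplus>k\<in>{..n}. add_pow R (n choose k) (?t (Suc n) (Suc k))) \<oplus>
      (\<Oplus>k\<in>{..n}. add_pow R (n choose (Suc k)) (?t (Suc n) (Suc k))))"
    unfolding z by (intro a_lcomm finsum_closed Pi_I add.nat_pow_closed t)
  also have "\<dots> = ?t (Suc n) 0 \<oplus> (\<Oplus>k\<in>{..n}. add_pow R (Suc n choose (Suc k)) (?t (Suc n) (Suc k)))"
  proof -
    have "(\<Oplus>k\<in>{..n}. add_pow R (n choose k) (?t (Suc n) (Suc k)) \<oplus> add_pow R (n choose (Suc k)) (?t (Suc n) (Suc k)))
      = (\<Oplus>k\<in>{..n}. add_pow R (Suc n choose (Suc k)) (?t (Suc n) (Suc k)))"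
      by (intro finsum_cong' refl Pi_I add.nat_pow_closed t) (simp only: add.nat_pow_mult[OF t] binomial_Suc_Suc)
    then show ?thesis by (subst finsum_addf [symmetric]) (simp_all only: Pi_I add.nat_pow_closed t)
  qed
  also have "\<dots> = (\<Oplus>k\<in>{..Suc n}. add_pow R (Suc n choose k) (?t (Suc n) k))"
    using t a b by (subst split) auto
  finally show ?case .
qed

text \<open>The inner binomial coefficients are divisible by p, and p kills every element once it
  kills 1. The intended ring is the tensor product, which is given by a carrier, so its
  characteristic is expressed by p times one.\<close>

lemma (in cring) freshmans_dream_cring:
  assumes p: "prime p" and char: "add_pow R p \<one> = \<zero>" and a: "a \<in> carrier R" and b: "b \<in> carrier R"
  shows "(a \<oplus> b) [^] p = a [^] p \<oplus> b [^] (p :: nat)"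
proof -
  have p1: "p > 1" using p by (rule prime_gt_1_nat)
  have z: "add_pow R p c = \<zero>" if "c \<in> carrier R" for c
    using that char add_pow_ldistr[of \<one> c p] by simp
  let ?h = "\<lambda>k. add_pow R (p choose k) (a [^] k \<otimes> b [^] (p - k))"
  have h0: "?h k = \<zero>" if "0 < k" "k < p" for k
  proof -
    have "p dvd (p choose k)"
      using that p by (intro dvd_choose_prime) auto
    then obtain m where "p choose k = p * m" ..
    then show ?thesis using a b z
      by (simp add: add.nat_pow_pow[symmetric])
  qed
  have "(\<Oplus>k\<in>{..p}. ?h k) = (\<Oplus>k\<in>{0, p}. ?h k)"
    using a b h0 by (intro add.finprod_mono_neutral_cong_right) auto
  also have "\<dots> = b [^] p \<oplus> a [^] p"
    using a b p1 by simp
  finally show ?thesis using a b by (simp add: binomial_expansion a_comm)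
qed

text \<open>Along a longer strict chain the first three members would be three distinct primes, yet
  only two are available.\<close>

lemma krull_dim_eq_1:
  assumes "primeideal N R" "primeideal M R" "N \<subset> M"
    and two: "\<And>P. primeideal P R \<Longrightarrow> P = N \<or> P = M"
  shows "krull_dim R = 1"
proof -
  define D where "D = {n. \<exists>P :: nat \<Rightarrow> 'a set. (\<forall>i\<le>n. primeideal (P i) R) \<and> (\<forall>i<n. P i \<subset> P (Suc i))}"
  have "1 \<in> D"
    unfolding D_def using assms(1-3) by (auto intro!: exI[of _ "\<lambda>i. if i = 0 then N else M"])
  moreover have "n \<le> 1" if "n \<in> D" for n
  proof (rule ccontr)
    assume n: "\<not> n \<le> 1"
    obtain P where P: "\<forall>i\<le>n. primeideal (P i) R" "\<forall>i<n. P i \<subset> P (Suc i)"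
      using \<open>n \<in> D\<close> by (auto simp: D_def)
    have chain: "P 0 \<subset> P 1" "P 1 \<subset> P (Suc 1)"
      and "primeideal (P 0) R" "primeideal (P 1) R" "primeideal (P (Suc 1)) R"
      using P(2)[rule_format, of 0] P(2)[rule_format, of 1]
        P(1)[rule_format, of 0] P(1)[rule_format, of 1] P(1)[rule_format, of "Suc 1"] n by simp_all
    from this(3-5)[THEN two] chain
    show False using assms(3) by (elim disjE) simp_all
  qed
  moreover have "krull_dim R = Sup (enat ` D)"
    unfolding krull_dim_def D_def by (rule arg_cong[of _ _ Sup]) blast
  ultimately show ?thesis
    by (intro antisym) (auto intro!: Sup_least Sup_upper2[of "enat 1"] simp: one_enat_def)
qed

text \<open>Peel off the coordinates with respect to the generators one at a time.\<close>

lemma (in cring) noetherian_if_finite_over_chain_ring: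
  assumes D: "D \<subseteq> carrier R" "\<zero> \<in> D"
    and D_add: "\<And>a b. a \<in> D \<Longrightarrow> b \<in> D \<Longrightarrow> a \<oplus> b \<in> D"
    and D_mult: "\<And>a b. a \<in> D \<Longrightarrow> b \<in> D \<Longrightarrow> a \<otimes> b \<in> D"
    and D_minus: "\<And>a. a \<in> D \<Longrightarrow> \<ominus> a \<in> D"
    and chain: "\<And>A. A \<subseteq> D \<Longrightarrow> A \<noteq> {} \<Longrightarrow> \<exists>g\<in>A. \<forall>y\<in>A. \<exists>q\<in>D. y = q \<otimes> g"
    and e: "\<And>i. i < n \<Longrightarrow> e i \<in> carrier R"
    and span: "\<And>t. t \<in> carrier R \<Longrightarrow> \<exists>c\<in>{..<n} \<rightarrow> D. t = (\<Oplus>i\<in>{..<n::nat}. c i \<otimes> e i)"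
  shows "noetherian_ring R"
proof (rule noetherian_ringI)
  fix I assume I: "ideal I R"
  interpret I: ideal I R by fact
  define W where "W k = {t. \<exists>c\<in>{..<k} \<rightarrow> D. t = (\<Oplus>i\<in>{..<k}. c i \<otimes> e i)}" for k
  have ce: "(\<lambda>i. c i \<otimes> e i) \<in> {..<k} \<rightarrow> carrier R" if "c \<in> {..<k} \<rightarrow> D" "k \<le> n" for c k
    using that D e by (auto intro!: m_closed)
  have W_carr: "W k \<subseteq> carrier R" if "k \<le> n" for k
    using ce that by (auto simp: W_def intro!: finsum_closed)
  have W0: "\<zero> \<in> W k" if "k \<le> n" for k
    unfolding W_def using that D(2) e
    by (auto intro!: bexI[of _ "\<lambda>_. \<zero>"] sym[OF add.finprod_one_eqI])
  have W_sub: "x \<ominus> q \<otimes> y \<in> W k" if k: "k \<le> n" and x: "x \<in> W k" and y: "y \<in> W k" and q: "q \<in> D" for x y q k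
  proof -
    from x y obtain c d where c: "c \<in> {..<k} \<rightarrow> D" "x = (\<Oplus>i\<in>{..<k}. c i \<otimes> e i)"
      and d: "d \<in> {..<k} \<rightarrow> D" "y = (\<Oplus>i\<in>{..<k}. d i \<otimes> e i)" by (auto simp: W_def)
    have qR: "q \<in> carrier R" using q D by auto
    have "\<ominus> (q \<otimes> y) = (\<Oplus>i\<in>{..<k}. \<ominus> q \<otimes> (d i \<otimes> e i))"
      using d ce[OF d(1) k] qR finsum_closed[OF ce[OF d(1) k]]
      by (subst finsum_rdistr[symmetric]) (auto simp: l_minus)
    then have "x \<ominus> q \<otimes> y = (\<Oplus>i\<in>{..<k}. c i \<otimes> e i \<oplus> \<ominus> q \<otimes> (d i \<otimes> e i))"
      using ce[OF c(1) k] ce[OF d(1) k] qR unfolding minus_eq c(2)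
      by (subst finsum_addf) auto
    also have "\<dots> = (\<Oplus>i\<in>{..<k}. (c i \<oplus> \<ominus> (q \<otimes> d i)) \<otimes> e i)"
    proof (rule finsum_cong')
      fix i assume i: "i \<in> {..<k}"
      have "c i \<in> carrier R" "d i \<in> carrier R" "e i \<in> carrier R"
        using i c d D k e by auto
      then show "c i \<otimes> e i \<oplus> \<ominus> q \<otimes> (d i \<otimes> e i) = (c i \<oplus> \<ominus> (q \<otimes> d i)) \<otimes> e i"
        using qR by algebra
    next
      show "(\<lambda>i. (c i \<oplus> \<ominus> (q \<otimes> d i)) \<otimes> e i) \<in> {..<k} \<rightarrow> carrier R"
        using c d D k e qR by (auto simp: subset_eq Pi_iff)
    qed simp
    finally show ?thesis
      unfolding W_def using c d D_add D_minus D_mult q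
      by (auto intro!: bexI[of _ "\<lambda>i. c i \<oplus> \<ominus> (q \<otimes> d i)"] simp: Pi_iff)
  qed
  have "\<exists>G. finite G \<and> G \<subseteq> I \<and> W k \<inter> I \<subseteq> Idl G" if "k \<le> n" for k
    using that
  proof (induction k)
    case 0
    have "W 0 = {\<zero>}" by (auto simp: W_def)
    then show ?case
      using additive_subgroup.zero_closed[OF ideal.axioms(1)[OF genideal_ideal[of "{}"]]] by (intro exI[of _ "{}"]) auto
  next
    case (Suc k)
    then obtain G where G: "finite G" "G \<subseteq> I" "W k \<inter> I \<subseteq> Idl G" by auto
    have k: "k \<le> n" "k < n" using Suc.prems by auto
    have W_Suc: "\<exists>c\<in>D. \<exists>w\<in>W k. t = c \<otimes> e k \<oplus> w" if "t \<in> W (Suc k)" for t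
    proof -
      from that obtain c where c: "c \<in> {..<Suc k} \<rightarrow> D" "t = (\<Oplus>i\<in>{..<Suc k}. c i \<otimes> e i)"
        by (auto simp: W_def)
      have "t = c k \<otimes> e k \<oplus> (\<Oplus>i\<in>{..<k}. c i \<otimes> e i)"
        unfolding c(2) lessThan_Suc using ce[OF c(1) Suc.prems] by (subst finsum_insert) auto
      moreover have "(\<Oplus>i\<in>{..<k}. c i \<otimes> e i) \<in> W k" using c(1) by (auto simp: W_def Pi_iff)
      ultimately show ?thesis using c(1) by blast
    qed
    \<comment> \<open>The \<open>e k\<close>-coefficients of members of I, taken modulo
      \<open>W k\<close>. One of them, g, divides all others, so a single element h of I with
      coefficient g removes this coordinate from every member of I in
      \<open>W (Suc k)\<close>.\<close>
    define A where "A = {c \<in> D. \<exists>w\<in>W k. c \<otimes> e k \<oplus> w \<in> I}"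
    have "\<zero> \<in> A" unfolding A_def using D(2) W0[OF k(1)] e[OF k(2)] by (auto intro!: bexI[of _ \<zero>])
    then obtain g where g: "g \<in> A" and gX: "\<forall>y\<in>A. \<exists>q\<in>D. y = q \<otimes> g"
      using chain[of A] by (auto simp: A_def)
    from g obtain w where w: "w \<in> W k" and h: "g \<otimes> e k \<oplus> w \<in> I" and gD: "g \<in> D"
      by (auto simp: A_def)
    define h where "h = g \<otimes> e k \<oplus> w"
    have hI: "h \<in> I" and GI: "insert h G \<subseteq> I" and GR: "insert h G \<subseteq> carrier R"
      using h G I.a_subset by (auto simp: h_def)
    interpret J: ideal "Idl (insert h G)" R by (rule genideal_ideal[OF GR])
    have hJ: "h \<in> Idl (insert h G)" using genideal_self[OF GR] by auto
    have GJ: "Idl G \<subseteq> Idl (insert h G)"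
      using genideal_self[OF GR] by (intro genideal_minimal[OF J.ideal_axioms]) auto
    have "t \<in> Idl (insert h G)" if "t \<in> W (Suc k)" "t \<in> I" for t
    proof -
      from W_Suc[OF that(1)] obtain c v where c: "c \<in> D" and v: "v \<in> W k" and t: "t = c \<otimes> e k \<oplus> v"
        by auto
      have "c \<in> A" using c v t that by (auto simp: A_def)
      then obtain q where q: "q \<in> D" and cq: "c = q \<otimes> g" using gX by auto
      have carr: "q \<in> carrier R" "g \<in> carrier R" "v \<in> carrier R" "w \<in> carrier R" "e k \<in> carrier R"
        using q gD D v w W_carr[OF k(1)] e[OF k(2)] by auto
      have tq: "t \<ominus> q \<otimes> h = v \<ominus> q \<otimes> w"
        unfolding t h_def cq using carr by algebra
      have "v \<ominus> q \<otimes> w \<in> I"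
        unfolding tq[symmetric] using that hI carr I.I_l_closed
        by (auto simp: minus_eq intro!: I.a_closed I.a_inv_closed)
      then have "v \<ominus> q \<otimes> w \<in> Idl (insert h G)" using W_sub[OF k(1) v w q] G(3) GJ by auto
      then have "(t \<ominus> q \<otimes> h) \<oplus> q \<otimes> h \<in> Idl (insert h G)"
        unfolding tq using hJ carr J.I_l_closed by (auto intro!: J.a_closed)
      moreover have "(t \<ominus> q \<otimes> h) \<oplus> q \<otimes> h = t"
        unfolding t h_def using carr cq by algebra
      ultimately show ?thesis by simp
    qed
    then show ?case using G(1) GI by (intro exI[of _ "insert h G"]) auto
  qed
  from this[OF order_refl] obtain G where G: "finite G" "G \<subseteq> I" "W n \<inter> I \<subseteq> Idl G" by auto
  have "W n = carrier R" using W_carr[of n] span by (auto simp: W_def)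
  then have "I \<subseteq> Idl G" using G(3) I.a_subset by auto
  moreover have "Idl G \<subseteq> I" using G(2) by (intro genideal_minimal I)
  ultimately show "\<exists>A\<subseteq>carrier R. finite A \<and> I = Idl A" using G I.a_subset by auto
qed


section \<open>Localization\<close>

locale mult_set = cring +
  fixes M :: "'a set"
  assumes M_carrier: "M \<subseteq> carrier R" and one_M: "\<one> \<in> M"
    and M_mult: "s \<in> M \<Longrightarrow> t \<in> M \<Longrightarrow> s \<otimes> t \<in> M"
begin

abbreviation "fr \<equiv> fraction R M"
abbreviation "L \<equiv> localization R M"

lemma M_closed [simp]: "s \<in> M \<Longrightarrow> s \<in> carrier R"
  using M_carrier by auto

lemma mem_fraction:
  assumes "a \<in> carrier R" "s \<in> M"
  shows "(b, t) \<in> fr a s \<longleftrightarrow>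
    b \<in> carrier R \<and> t \<in> M \<and> (\<exists>u\<in>M. u \<otimes> (t \<otimes> a) = u \<otimes> (s \<otimes> b))"
proof -
  have "u \<otimes> (t \<otimes> a \<ominus> s \<otimes> b) = \<zero> \<longleftrightarrow> u \<otimes> (t \<otimes> a) = u \<otimes> (s \<otimes> b)"
    if "u \<in> M" "b \<in> carrier R" "t \<in> M" for u
  proof -
    have "u \<otimes> (t \<otimes> a \<ominus> s \<otimes> b) = u \<otimes> (t \<otimes> a) \<ominus> u \<otimes> (s \<otimes> b)"
      using that assms by (simp add: minus_eq r_distr r_minus)
    then show ?thesis using that assms by (simp add: r_right_minus_eq)
  qed
  then show ?thesis by (auto simp: fraction_def)
qed

text \<open>With zero divisors each equality of fractions carries its own witness; the product of
  both witnesses with the middle denominator t witnesses the composite.\<close>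

lemma fraction_trans:
  assumes "a \<in> carrier R" "b \<in> carrier R" "c \<in> carrier R" "s \<in> M" "t \<in> M" "r \<in> M" "u \<in> M" "v \<in> M"
    and "u \<otimes> (t \<otimes> a) = u \<otimes> (s \<otimes> b)" "v \<otimes> (r \<otimes> b) = v \<otimes> (t \<otimes> c)"
  shows "(u \<otimes> v \<otimes> t) \<otimes> (r \<otimes> a) = (u \<otimes> v \<otimes> t) \<otimes> (s \<otimes> c)"
proof -
  have "(u \<otimes> v \<otimes> t) \<otimes> (r \<otimes> a) = (v \<otimes> r) \<otimes> (u \<otimes> (t \<otimes> a))" using assms(1-8) by (simp add: m_ac)
  also have "\<dots> = (u \<otimes> s) \<otimes> (v \<otimes> (r \<otimes> b))" unfolding assms(9) using assms(1-8) by (simp add: m_ac)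
  also have "\<dots> = (u \<otimes> v \<otimes> t) \<otimes> (s \<otimes> c)" unfolding assms(10) using assms(1-8) by (simp add: m_ac)
  finally show ?thesis .
qed

lemma fraction_eq_iff:
  assumes "a \<in> carrier R" "s \<in> M" "b \<in> carrier R" "t \<in> M"
  shows "fr a s = fr b t \<longleftrightarrow> (\<exists>u\<in>M. u \<otimes> (t \<otimes> a) = u \<otimes> (s \<otimes> b))"
proof
  assume "fr a s = fr b t"
  moreover have "(b, t) \<in> fr b t" using assms one_M by (auto simp: mem_fraction)
  ultimately have "(b, t) \<in> fr a s" by simp
  then show "\<exists>u\<in>M. u \<otimes> (t \<otimes> a) = u \<otimes> (s \<otimes> b)" using assms by (simp add: mem_fraction)
next
  have sub: "fr a s \<subseteq> fr b t" if "a \<in> carrier R" "s \<in> M" "b \<in> carrier R" "t \<in> M"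
     "\<exists>u\<in>M. u \<otimes> (t \<otimes> a) = u \<otimes> (s \<otimes> b)" for a s b t
    using that
  proof (clarify)
    fix c r u assume carr: "a \<in> carrier R" "s \<in> M" "b \<in> carrier R" "t \<in> M"
      and u: "u \<in> M" "u \<otimes> (t \<otimes> a) = u \<otimes> (s \<otimes> b)" and "(c, r) \<in> fr a s"
    then obtain v where v: "c \<in> carrier R" "r \<in> M" "v \<in> M" "v \<otimes> (r \<otimes> a) = v \<otimes> (s \<otimes> c)"
      by (auto simp: mem_fraction)
    have "(u \<otimes> v \<otimes> s) \<otimes> (r \<otimes> b) = (u \<otimes> v \<otimes> s) \<otimes> (t \<otimes> c)"
      using fraction_trans[of b a c t s r u v] carr u v by auto
    then show "(c, r) \<in> fr b t"
      using carr u v M_mult by (auto simp: mem_fraction intro!: bexI[of _ "u \<otimes> v \<otimes> s"])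
  qed
  assume "\<exists>u\<in>M. u \<otimes> (t \<otimes> a) = u \<otimes> (s \<otimes> b)"
  then show "fr a s = fr b t"
    using sub[of a s b t] sub[of b t a s] assms by (metis subset_antisym)
qed

lemma fraction_self: "a \<in> carrier R \<Longrightarrow> s \<in> M \<Longrightarrow> (a, s) \<in> fr a s"
  using one_M by (auto simp: mem_fraction)

text \<open>The ring operations of \<open>localization\<close> are unions over all representatives.
  Such a union collapses to one term as soon as the term depends only on the class, which makes the
  definitions computable.\<close>

lemma UN_fraction:
  assumes "a \<in> carrier R" "s \<in> M"
    and "\<And>b t. b \<in> carrier R \<Longrightarrow> t \<in> M \<Longrightarrow> fr b t = fr a s \<Longrightarrow> f b t = f a s"
  shows "(\<Union>(b, t)\<in>fr a s. f b t) = f a s"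
proof -
  have "f b t = f a s" if "(b, t) \<in> fr a s" for b t
  proof (rule assms(3))
    show "b \<in> carrier R" "t \<in> M" using that assms(1,2) by (auto simp: mem_fraction)
    then show "fr b t = fr a s"
      using that assms(1,2) by (subst eq_commute) (simp add: mem_fraction fraction_eq_iff)
  qed
  then show ?thesis using fraction_self[OF assms(1,2)] by blast
qed

lemma carrier_localization:
  "U \<in> carrier L \<longleftrightarrow> (\<exists>a\<in>carrier R. \<exists>s\<in>M. U = fr a s)"
  by (auto simp: localization_def)

lemma fraction_mult_eq:
  assumes "a \<in> carrier R" "s \<in> M" "a' \<in> carrier R" "s' \<in> M" "fr a s = fr a' s'"
    and "b \<in> carrier R" "t \<in> M" "b' \<in> carrier R" "t' \<in> M" "fr b t = fr b' t'"
  shows "fr (a \<otimes> b) (s \<otimes> t) = fr (a' \<otimes> b') (s' \<otimes> t')"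
proof -
  obtain u v where u: "u \<in> M" "u \<otimes> (s' \<otimes> a) = u \<otimes> (s \<otimes> a')" and v: "v \<in> M" "v \<otimes> (t' \<otimes> b) = v \<otimes> (t \<otimes> b')"
    using assms by (auto simp: fraction_eq_iff)
  have "(u \<otimes> v) \<otimes> (s' \<otimes> t' \<otimes> (a \<otimes> b)) = (u \<otimes> (s' \<otimes> a)) \<otimes> (v \<otimes> (t' \<otimes> b))"
    using assms u(1) v(1) by (simp add: m_ac)
  also have "\<dots> = (u \<otimes> v) \<otimes> (s \<otimes> t \<otimes> (a' \<otimes> b'))"
    unfolding u v using assms u(1) v(1) by (simp add: m_ac)
  finally show ?thesis
    using assms u v M_mult by (auto simp: fraction_eq_iff)
qed

lemma fraction_add_eq:
  assumes "a \<in> carrier R" "s \<in> M" "a' \<in> carrier R" "s' \<in> M" "fr a s = fr a' s'"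
    and "b \<in> carrier R" "t \<in> M" "b' \<in> carrier R" "t' \<in> M" "fr b t = fr b' t'"
  shows "fr (a \<otimes> t \<oplus> b \<otimes> s) (s \<otimes> t) = fr (a' \<otimes> t' \<oplus> b' \<otimes> s') (s' \<otimes> t')"
proof -
  obtain u v where u: "u \<in> M" "u \<otimes> (s' \<otimes> a) = u \<otimes> (s \<otimes> a')" and v: "v \<in> M" "v \<otimes> (t' \<otimes> b) = v \<otimes> (t \<otimes> b')"
    using assms by (auto simp: fraction_eq_iff)
  have "(u \<otimes> v) \<otimes> (s' \<otimes> t' \<otimes> (a \<otimes> t \<oplus> b \<otimes> s)) =
      (u \<otimes> (s' \<otimes> a)) \<otimes> (v \<otimes> t' \<otimes> t) \<oplus> (v \<otimes> (t' \<otimes> b)) \<otimes> (u \<otimes> s' \<otimes> s)"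
    using assms u(1) v(1) by (simp add: m_ac r_distr)
  also have "\<dots> = (u \<otimes> v) \<otimes> (s \<otimes> t \<otimes> (a' \<otimes> t' \<oplus> b' \<otimes> s'))"
    unfolding u v using assms u(1) v(1) by (simp add: m_ac r_distr)
  finally show ?thesis
    using assms u(1) v(1) M_mult by (auto simp: fraction_eq_iff)
qed

lemma fraction_mult:
  assumes "a \<in> carrier R" "s \<in> M" "b \<in> carrier R" "t \<in> M"
  shows "fr a s \<otimes>\<^bsub>L\<^esub> fr b t = fr (a \<otimes> b) (s \<otimes> t)"
proof -
  have "(\<Union>(b', t')\<in>fr b t. fr (a' \<otimes> b') (s' \<otimes> t')) = fr (a' \<otimes> b) (s' \<otimes> t)"
    if "a' \<in> carrier R" "s' \<in> M" for a' s'
  proof (rule UN_fraction[where f = "\<lambda>b' t'. fr (a' \<otimes> b') (s' \<otimes> t')"])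
    show "b \<in> carrier R" "t \<in> M" by fact+
  next
    fix b' t' assume "b' \<in> carrier R" "t' \<in> M" "fr b' t' = fr b t"
    then show "fr (a' \<otimes> b') (s' \<otimes> t') = fr (a' \<otimes> b) (s' \<otimes> t)"
      using assms that by (intro fraction_mult_eq[OF _ _ _ _ refl])
  qed
  then show ?thesis
    unfolding localization_def using assms
    by (simp, subst UN_fraction) (simp | rule fraction_mult_eq)+
qed

lemma fraction_add:
  assumes "a \<in> carrier R" "s \<in> M" "b \<in> carrier R" "t \<in> M"
  shows "fr a s \<oplus>\<^bsub>L\<^esub> fr b t = fr (a \<otimes> t \<oplus> b \<otimes> s) (s \<otimes> t)"
proof -
  have "(\<Union>(b', t')\<in>fr b t. fr (a' \<otimes> t' \<oplus> b' \<otimes> s') (s' \<otimes> t')) = fr (a' \<otimes> t \<oplus> b \<otimes> s') (s' \<otimes> t)"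
    if "a' \<in> carrier R" "s' \<in> M" for a' s'
  proof (rule UN_fraction[where f = "\<lambda>b' t'. fr (a' \<otimes> t' \<oplus> b' \<otimes> s') (s' \<otimes> t')"])
    show "b \<in> carrier R" "t \<in> M" by fact+
  next
    fix b' t' assume "b' \<in> carrier R" "t' \<in> M" "fr b' t' = fr b t"
    then show "fr (a' \<otimes> t' \<oplus> b' \<otimes> s') (s' \<otimes> t') = fr (a' \<otimes> t \<oplus> b \<otimes> s') (s' \<otimes> t)"
      using assms that by (intro fraction_add_eq[OF _ _ _ _ refl])
  qed
  then show ?thesis
    unfolding localization_def using assms
    by (simp, subst UN_fraction) (simp | rule fraction_add_eq)+
qed

lemma localization_zero: "\<zero>\<^bsub>L\<^esub> = fr \<zero> \<one>" and localization_one: "\<one>\<^bsub>L\<^esub> = fr \<one> \<one>"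
  by (simp_all add: localization_def)

lemma fraction_zero: "s \<in> M \<Longrightarrow> fr \<zero> s = \<zero>\<^bsub>L\<^esub>"
  using one_M by (auto simp: localization_zero fraction_eq_iff)

lemma fraction_eqI:
  assumes "a \<in> carrier R" "s \<in> M" "b \<in> carrier R" "t \<in> M" "t \<otimes> a = s \<otimes> b"
  shows "fr a s = fr b t"
  using assms one_M by (auto simp: fraction_eq_iff)

lemma cring_localization: "cring L"
proof (rule cringI)
  show "abelian_group L"
  proof (rule abelian_groupI)
    fix U V W assume "U \<in> carrier L" "V \<in> carrier L" "W \<in> carrier L"
    then obtain a s b t c r where U: "U = fr a s" "a \<in> carrier R" "s \<in> M"
      and V: "V = fr b t" "b \<in> carrier R" "t \<in> M" and W: "W = fr c r" "c \<in> carrier R" "r \<in> M"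
      by (auto simp: carrier_localization)
    show "U \<oplus>\<^bsub>L\<^esub> V \<in> carrier L"
      using U V M_mult by (auto simp: fraction_add carrier_localization intro!: exI[of _ "a \<otimes> t \<oplus> b \<otimes> s"] bexI)
    show "U \<oplus>\<^bsub>L\<^esub> V = V \<oplus>\<^bsub>L\<^esub> U"
      using U V by (simp add: fraction_add a_comm m_comm)
    show "\<zero>\<^bsub>L\<^esub> \<oplus>\<^bsub>L\<^esub> U = U"
      using U one_M by (simp add: fraction_add localization_zero)
    show "U \<oplus>\<^bsub>L\<^esub> V \<oplus>\<^bsub>L\<^esub> W = U \<oplus>\<^bsub>L\<^esub> (V \<oplus>\<^bsub>L\<^esub> W)"
      using U V W M_mult by (simp add: fraction_add m_ac a_ac l_distr r_distr)
    have "fr (\<ominus> a) s \<oplus>\<^bsub>L\<^esub> U = \<zero>\<^bsub>L\<^esub>"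
      using U M_mult by (simp add: fraction_add l_distr[symmetric] l_neg fraction_zero)
    then show "\<exists>Y\<in>carrier L. Y \<oplus>\<^bsub>L\<^esub> U = \<zero>\<^bsub>L\<^esub>"
      using U by (auto simp: carrier_localization intro!: exI[of _ "fr (\<ominus> a) s"] bexI)
  next
    show "\<zero>\<^bsub>L\<^esub> \<in> carrier L" using one_M by (auto simp: carrier_localization localization_zero)
  qed
  show "comm_monoid L"
  proof (rule comm_monoidI)
    fix U V W assume "U \<in> carrier L" "V \<in> carrier L" "W \<in> carrier L"
    then obtain a s b t c r where U: "U = fr a s" "a \<in> carrier R" "s \<in> M"
      and V: "V = fr b t" "b \<in> carrier R" "t \<in> M" and W: "W = fr c r" "c \<in> carrier R" "r \<in> M"
      by (auto simp: carrier_localization)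
    show "U \<otimes>\<^bsub>L\<^esub> V \<in> carrier L"
      using U V M_mult by (auto simp: fraction_mult carrier_localization intro!: exI[of _ "a \<otimes> b"] bexI)
    show "U \<otimes>\<^bsub>L\<^esub> V = V \<otimes>\<^bsub>L\<^esub> U"
      using U V by (simp add: fraction_mult m_comm)
    show "\<one>\<^bsub>L\<^esub> \<otimes>\<^bsub>L\<^esub> U = U"
      using U one_M by (simp add: fraction_mult localization_one)
    show "U \<otimes>\<^bsub>L\<^esub> V \<otimes>\<^bsub>L\<^esub> W = U \<otimes>\<^bsub>L\<^esub> (V \<otimes>\<^bsub>L\<^esub> W)"
      using U V W M_mult by (simp add: fraction_mult m_ac)
  next
    show "\<one>\<^bsub>L\<^esub> \<in> carrier L" using one_M by (auto simp: carrier_localization localization_one)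
  qed
  fix U V W assume "U \<in> carrier L" "V \<in> carrier L" "W \<in> carrier L"
  then obtain a s b t c r where U: "U = fr a s" "a \<in> carrier R" "s \<in> M"
    and V: "V = fr b t" "b \<in> carrier R" "t \<in> M" and W: "W = fr c r" "c \<in> carrier R" "r \<in> M"
    by (auto simp: carrier_localization)
  \<comment> \<open>The denominators of the two sides differ by the factor r, so equality is that of
    fractions, not of pairs.\<close>
  show "(U \<oplus>\<^bsub>L\<^esub> V) \<otimes>\<^bsub>L\<^esub> W = U \<otimes>\<^bsub>L\<^esub> W \<oplus>\<^bsub>L\<^esub> V \<otimes>\<^bsub>L\<^esub> W"
    using U V W M_mult by (simp add: fraction_mult fraction_add)
      (rule fraction_eqI, auto simp: m_ac l_distr r_distr)
qed

lemma fraction_closed: "a \<in> carrier R \<Longrightarrow> s \<in> M \<Longrightarrow> fr a s \<in> carrier L"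
  by (auto simp: carrier_localization)

lemma fraction_uminus:
  assumes "a \<in> carrier R" "s \<in> M"
  shows "\<ominus>\<^bsub>L\<^esub> fr a s = fr (\<ominus> a) s"
proof -
  interpret L: cring L by (rule cring_localization)
  have "fr (\<ominus> a) s \<oplus>\<^bsub>L\<^esub> fr a s = \<zero>\<^bsub>L\<^esub>"
    using assms M_mult by (simp add: fraction_add l_distr[symmetric] l_neg fraction_zero)
  then show ?thesis using assms by (intro L.minus_equality fraction_closed) auto
qed

lemma M_pow: "s \<in> M \<Longrightarrow> s [^] (n::nat) \<in> M"
  by (induction n) (auto simp: one_M M_mult)

lemma fraction_pow:
  assumes "a \<in> carrier R" "s \<in> M"
  shows "fr a s [^]\<^bsub>L\<^esub> (n::nat) = fr (a [^] n) (s [^] n)"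
  by (induction n) (use assms M_pow in \<open>auto simp: localization_one fraction_mult\<close>)

end


section \<open>The Cech complex of one element\<close>

locale cech_single = cring +
  fixes y :: 'a
  assumes y_closed [simp]: "y \<in> carrier R"
begin

definition "M = {y [^] n | n :: nat. True}"

sublocale mult_set R M
  by unfold_locales (auto simp: M_def nat_pow_mult intro: exI[of _ "0 :: nat"])

interpretation L: cring L by (rule cring_localization)

lemma denoms_empty: "cech_denoms R [y] {} = {\<one>}"
  by (simp add: cech_denoms_def)

lemma denoms_single: "cech_denoms R [y] {0} = M"
proof -
  have "finprod R (\<lambda>j. ([y] ! j) [^] e j) {0} = y [^] e 0" for e :: "nat \<Rightarrow> nat"
    by simp
  then show ?thesis
    unfolding cech_denoms_def M_def by (auto intro: exI[of _ "\<lambda>_. n" for n])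
qed

lemma cech_loc_single: "cech_loc R [y] {0} = L"
  by (simp add: cech_loc_def denoms_single)

lemma index_0: "cech_index [y] 0 = {{}}"
  by (auto simp: cech_index_def dest: finite_subset)

lemma index_1: "cech_index [y] (Suc 0) = {{0}}"
  by (auto simp: cech_index_def card_1_singleton_iff)

lemma index_ge_2: "cech_index [y] (Suc (Suc i)) = {}"
proof -
  have "card S \<noteq> Suc (Suc i)" if "S \<subseteq> {..<length [y]}" for S
    using card_mono[OF _ that] by simp
  then show ?thesis unfolding cech_index_def by blast
qed

lemma inj_on_frobenius_trivial:
  assumes "cech_cocycles R [y] i \<subseteq> {\<phi>}"
  shows "inj_on (cohomology_frobenius p R [y] i) (carrier (cech_cohomology R [y] i))"
proof -
  have "carrier (cech_cohomology R [y] i) \<subseteq> {cech_coboundaries R [y] i +>\<^bsub>cech_module R [y] i\<^esub> \<phi>}"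
    using assms by (auto simp: cech_cohomology_def)
  then show ?thesis by (rule inj_on_subset[rotated]) simp
qed

lemma inj_on_frobenius_ge_2:
  "inj_on (cohomology_frobenius p R [y] (Suc (Suc i))) (carrier (cech_cohomology R [y] (Suc (Suc i))))"
  by (rule inj_on_frobenius_trivial[of _ "\<lambda>_. undefined"])
    (auto simp: cech_cocycles_def cech_module_def index_ge_2)

text \<open>With only 1 inverted every class is a singleton, so cochains of degree 0 are just
  elements of R.\<close>

lemma fraction_trivial_denoms:
  assumes "a \<in> carrier R" shows "fraction R {\<one>} a \<one> = {(a, \<one>)}"
proof -
  interpret N: mult_set R "{\<one>}" by unfold_locales auto
  show ?thesis using assms by (auto simp: N.mem_fraction)
qed

lemma cech_diff_0:
  assumes "\<phi> \<in> carrier (cech_module R [y] 0)"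
  shows "\<exists>a\<in>carrier R. \<phi> = (\<lambda>S\<in>{{}}. {(a, \<one>)}) \<and> cech_diff R [y] 0 \<phi> = (\<lambda>S\<in>{{0}}. fr a \<one>)"
proof -
  have \<phi>: "\<phi> \<in> {{}} \<rightarrow>\<^sub>E carrier (localization R {\<one>})"
    using assms by (simp add: cech_module_def index_0 cech_loc_def denoms_empty PiE_iff)
  then obtain a where a: "a \<in> carrier R" "\<phi> {} = fraction R {\<one>} a \<one>"
    by (auto simp: localization_def PiE_iff)
  have 1: "\<phi> = (\<lambda>S\<in>{{}}. {(a, \<one>)})"
    using \<phi> a by (auto simp: fun_eq_iff fraction_trivial_denoms PiE_def extensional_def)
  have "cech_diff R [y] 0 \<phi> = (\<lambda>S\<in>{{0}}. finsum L
       (\<lambda>j. if even (card {l \<in> {0}. l < j}) then cech_restrict R [y] {0} (\<phi> ({0} - {j}))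
            else \<ominus>\<^bsub>L\<^esub> cech_restrict R [y] {0} (\<phi> ({0} - {j}))) {0})"
    by (rule ext) (simp add: cech_diff_def index_1 cech_loc_single cong: if_cong)
  \<comment> \<open>Only the index 0 contributes, and nothing in \<open>{0}\<close> lies below it,
    so its sign is positive.\<close>
  also have "\<dots> = (\<lambda>S\<in>{{0}}. cech_restrict R [y] {0} (\<phi> {}))"
  proof -
    have "cech_restrict R [y] {0} (\<phi> {}) \<in> carrier L"
      using a one_M by (simp add: cech_restrict_def denoms_single fraction_trivial_denoms fraction_closed)
    then have "finsum L (\<lambda>j. if even (card {l \<in> {0}. l < j}) then cech_restrict R [y] {0} (\<phi> ({0} - {j}))
            else \<ominus>\<^bsub>L\<^esub> cech_restrict R [y] {0} (\<phi> ({0} - {j}))) {0::nat} = cech_restrict R [y] {0} (\<phi> {})"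
      by (subst L.add.finprod_singleton_swap[of 0 "{0}", symmetric]) auto
    then show ?thesis by simp
  qed
  also have "\<dots> = (\<lambda>S\<in>{{0}}. fr a \<one>)"
    using a by (simp add: cech_restrict_def denoms_single fraction_trivial_denoms)
  finally show ?thesis using 1 a(1) by blast
qed

lemma constant_cochain:
  assumes "a \<in> carrier R" shows "(\<lambda>S\<in>{{}}. {(a, \<one>)}) \<in> carrier (cech_module R [y] 0)"
  using assms
  by (auto simp: cech_module_def index_0 cech_loc_def denoms_empty localization_def
      fraction_trivial_denoms[symmetric] intro!: exI[of _ a])

text \<open>A cocycle of degree 0 is an element that dies after inverting y, hence is killed by a
  power of y; so there is only the zero cocycle.\<close>

lemma inj_on_frobenius_0:
  assumes nzd: "\<And>a n. a \<in> carrier R \<Longrightarrow> y [^] (n::nat) \<otimes> a = \<zero> \<Longrightarrow> a = \<zero>"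
  shows "inj_on (cohomology_frobenius p R [y] 0) (carrier (cech_cohomology R [y] 0))"
proof (rule inj_on_frobenius_trivial[of _ "\<lambda>S\<in>{{}}. {(\<zero>, \<one>)}"], rule subsetI)
  fix \<phi> assume "\<phi> \<in> cech_cocycles R [y] 0"
  then have \<phi>: "\<phi> \<in> carrier (cech_module R [y] 0)" and d: "cech_diff R [y] 0 \<phi> = (\<lambda>S\<in>{{0}}. \<zero>\<^bsub>L\<^esub>)"
    by (auto simp: cech_cocycles_def cech_module_def index_1 cech_loc_single fun_eq_iff)
  from cech_diff_0[OF \<phi>] obtain a where a: "a \<in> carrier R" "\<phi> = (\<lambda>S\<in>{{}}. {(a, \<one>)})"
    and "cech_diff R [y] 0 \<phi> = (\<lambda>S\<in>{{0}}. fr a \<one>)" by auto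
  with d have "fr a \<one> = fr \<zero> \<one>" by (metis localization_zero restrict_apply singletonI)
  then have "\<exists>u\<in>M. u \<otimes> (\<one> \<otimes> a) = u \<otimes> (\<one> \<otimes> \<zero>)"
    using a one_M by (subst (asm) fraction_eq_iff) auto
  then have "a = \<zero>" using a nzd by (auto simp: M_def)
  then show "\<phi> \<in> {\<lambda>S\<in>{{}}. {(\<zero>, \<one>)}}" using a by simp
qed

section \<open>The first cohomology as the quotient of the localization by the ring\<close>

definition emb :: "('a \<times> 'a) set \<Rightarrow> nat set \<Rightarrow> ('a \<times> 'a) set" where
  "emb U = (\<lambda>S\<in>{{0}}. U)"

definition integral :: "('a \<times> 'a) set set" where
  "integral = (\<lambda>a. fr a \<one>) ` carrier R"

text \<open>The coset of U modulo the image of R, packed by \<open>emb\<close> as a set of degree-1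
  cochains so that it coincides with the coset of the Cech construction.\<close>

definition cls :: "('a \<times> 'a) set \<Rightarrow> (nat set \<Rightarrow> ('a \<times> 'a) set) set" where
  "cls U = (\<lambda>V. emb (V \<oplus>\<^bsub>L\<^esub> U)) ` integral"

lemma emb_eq_iff: "emb U = emb V \<longleftrightarrow> U = V"
  by (auto simp: emb_def fun_eq_iff)

lemma module_1:
  "carrier (cech_module R [y] (Suc 0)) = emb ` carrier L"
  "\<zero>\<^bsub>cech_module R [y] (Suc 0)\<^esub> = emb \<zero>\<^bsub>L\<^esub>"
  "emb U \<oplus>\<^bsub>cech_module R [y] (Suc 0)\<^esub> emb V = emb (U \<oplus>\<^bsub>L\<^esub> V)"
  "r \<odot>\<^bsub>cech_module R [y] (Suc 0)\<^esub> emb U = emb (fr r \<one> \<otimes>\<^bsub>L\<^esub> U)"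
  "cech_frobenius p R [y] (Suc 0) (emb U) = emb (U [^]\<^bsub>L\<^esub> p)"
proof -
  show "carrier (cech_module R [y] (Suc 0)) = emb ` carrier L"
  proof
    show "emb ` carrier L \<subseteq> carrier (cech_module R [y] (Suc 0))"
      by (simp add: image_subset_iff cech_module_def index_1 cech_loc_single emb_def PiE_iff)
    show "carrier (cech_module R [y] (Suc 0)) \<subseteq> emb ` carrier L"
    proof
      fix \<phi> assume "\<phi> \<in> carrier (cech_module R [y] (Suc 0))"
      then have "\<phi> \<in> {{0}} \<rightarrow>\<^sub>E carrier L"
        by (simp add: cech_module_def index_1 cech_loc_single PiE_iff)
      then have "\<phi> {0} \<in> carrier L" "\<phi> = emb (\<phi> {0})"
        by (auto simp: emb_def fun_eq_iff PiE_def extensional_def)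
      then show "\<phi> \<in> emb ` carrier L" by auto
    qed
  qed
qed (simp_all add: cech_module_def index_1 cech_loc_single emb_def fun_eq_iff denoms_single cech_frobenius_def)

lemma integral_closed: "V \<in> integral \<Longrightarrow> V \<in> carrier L"
  using one_M by (auto simp: integral_def fraction_closed)

lemma integral_add: "V \<in> integral \<Longrightarrow> W \<in> integral \<Longrightarrow> V \<oplus>\<^bsub>L\<^esub> W \<in> integral"
  using one_M by (auto simp: integral_def fraction_add)

lemma integral_zero: "\<zero>\<^bsub>L\<^esub> \<in> integral"
  by (auto simp: integral_def localization_zero)

lemma integral_minus: "V \<in> integral \<Longrightarrow> \<ominus>\<^bsub>L\<^esub> V \<in> integral"
  using one_M by (auto simp: integral_def fraction_uminus)

lemma coboundaries_1: "cech_coboundaries R [y] (Suc 0) = emb ` integral"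
proof -
  have "cech_coboundaries R [y] (Suc 0) = cech_diff R [y] 0 ` carrier (cech_module R [y] 0)"
    by (simp add: cech_coboundaries_def)
  also have "\<dots> = emb ` integral"
  proof
    show "cech_diff R [y] 0 ` carrier (cech_module R [y] 0) \<subseteq> emb ` integral"
      using cech_diff_0 by (fastforce simp: emb_def integral_def)
    show "emb ` integral \<subseteq> cech_diff R [y] 0 ` carrier (cech_module R [y] 0)"
    proof (clarsimp simp: integral_def)
      fix a assume a: "a \<in> carrier R"
      obtain b where b: "(\<lambda>S\<in>{{}::nat set}. {(a, \<one>)}) = (\<lambda>S\<in>{{}}. {(b, \<one>)})"
        "cech_diff R [y] 0 (\<lambda>S\<in>{{}}. {(a, \<one>)}) = (\<lambda>S\<in>{{0}}. fr b \<one>)"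
        using cech_diff_0[OF constant_cochain[OF a]] by auto
      have "a = b" using fun_cong[OF b(1), of "{}"] by simp
      then have "emb (fr a \<one>) = cech_diff R [y] 0 (\<lambda>S\<in>{{}}. {(a, \<one>)})"
        using b(2) by (simp add: emb_def)
      then show "emb (fr a \<one>) \<in> cech_diff R [y] 0 ` carrier (cech_module R [y] 0)"
        using constant_cochain[OF a] by auto
    qed
  qed
  finally show ?thesis .
qed

lemma coset_1: "cech_coboundaries R [y] (Suc 0) +>\<^bsub>cech_module R [y] (Suc 0)\<^esub> emb U = cls U"
  unfolding coboundaries_1 a_r_coset_def' cls_def by (auto simp: module_1)

lemma cohomology_1:
  "carrier (cech_cohomology R [y] (Suc 0)) = cls ` carrier L"
  "\<zero>\<^bsub>cech_cohomology R [y] (Suc 0)\<^esub> = cls \<zero>\<^bsub>L\<^esub>"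
proof -
  have "cech_cocycles R [y] (Suc 0) = emb ` carrier L"
    unfolding cech_cocycles_def module_1
    by (auto simp: cech_diff_def cech_module_def index_ge_2)
  then show "carrier (cech_cohomology R [y] (Suc 0)) = cls ` carrier L"
    by (simp add: cech_cohomology_def image_image coset_1)
  show "\<zero>\<^bsub>cech_cohomology R [y] (Suc 0)\<^esub> = cls \<zero>\<^bsub>L\<^esub>"
    using integral_closed by (auto simp: cech_cohomology_def coboundaries_1 cls_def)
qed

lemma cls_eq_iff:
  assumes U: "U \<in> carrier L" and V: "V \<in> carrier L"
  shows "cls U = cls V \<longleftrightarrow> U \<ominus>\<^bsub>L\<^esub> V \<in> integral"
proof
  assume "cls U = cls V"
  moreover have "emb U \<in> cls U"
    using U integral_zero by (auto simp: cls_def intro!: image_eqI[of _ _ "\<zero>\<^bsub>L\<^esub>"])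
  ultimately obtain W where W: "W \<in> integral" "U = W \<oplus>\<^bsub>L\<^esub> V"
    by (auto simp: cls_def emb_eq_iff)
  then have "U \<ominus>\<^bsub>L\<^esub> V = W" using V integral_closed[OF W(1)] by (simp add: L.add.m_assoc L.minus_eq L.r_neg)
  then show "U \<ominus>\<^bsub>L\<^esub> V \<in> integral" using W by simp
next
  have sub: "cls U \<subseteq> cls V" if U: "U \<in> carrier L" and V: "V \<in> carrier L" and "U \<ominus>\<^bsub>L\<^esub> V \<in> integral" for U V
  proof (clarsimp simp: cls_def)
    fix W assume W: "W \<in> integral"
    have "W \<oplus>\<^bsub>L\<^esub> U = (W \<oplus>\<^bsub>L\<^esub> (U \<ominus>\<^bsub>L\<^esub> V)) \<oplus>\<^bsub>L\<^esub> V"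
      using U V integral_closed[OF W] by (simp add: L.add.m_assoc L.minus_eq L.l_neg)
    then show "emb (W \<oplus>\<^bsub>L\<^esub> U) \<in> (\<lambda>W. emb (W \<oplus>\<^bsub>L\<^esub> V)) ` integral"
      using integral_add[OF W that(3)] by auto
  qed
  assume *: "U \<ominus>\<^bsub>L\<^esub> V \<in> integral"
  have "V \<ominus>\<^bsub>L\<^esub> U = \<ominus>\<^bsub>L\<^esub> (U \<ominus>\<^bsub>L\<^esub> V)"
    using U V by (simp add: L.minus_eq L.minus_add L.add.m_comm)
  then show "cls U = cls V" using sub[OF U V] sub[OF V U] * integral_minus by auto
qed

lemma cls_zero_iff: "U \<in> carrier L \<Longrightarrow> cls U = cls \<zero>\<^bsub>L\<^esub> \<longleftrightarrow> U \<in> integral"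
  by (simp add: cls_eq_iff L.minus_eq)

text \<open>Scalar multiplication on cohomology is a union over all members of a class; each member
  contributes the same class because \<open>integral\<close> absorbs multiplication by elements of
  R.\<close>

lemma smult_1:
  assumes r: "r \<in> carrier R" and U: "U \<in> carrier L"
  shows "r \<odot>\<^bsub>cech_cohomology R [y] (Suc 0)\<^esub> cls U = cls (fr r \<one> \<otimes>\<^bsub>L\<^esub> U)"
proof -
  have fr: "fr r \<one> \<in> carrier L" using r one_M by (simp add: fraction_closed)
  have "cls (fr r \<one> \<otimes>\<^bsub>L\<^esub> (V \<oplus>\<^bsub>L\<^esub> U)) = cls (fr r \<one> \<otimes>\<^bsub>L\<^esub> U)" if V: "V \<in> integral" for V
  proof -
    have "fr r \<one> \<otimes>\<^bsub>L\<^esub> (V \<oplus>\<^bsub>L\<^esub> U) \<ominus>\<^bsub>L\<^esub> fr r \<one> \<otimes>\<^bsub>L\<^esub> U = fr r \<one> \<otimes>\<^bsub>L\<^esub> V"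
      using fr U integral_closed[OF V] by (simp add: L.r_distr L.minus_eq L.add.m_assoc L.r_neg)
    also have "\<dots> \<in> integral"
      using V r one_M by (auto simp: integral_def fraction_mult)
    finally show ?thesis
      using fr U integral_closed[OF V] by (simp add: cls_eq_iff)
  qed
  moreover have "r \<odot>\<^bsub>cech_cohomology R [y] (Suc 0)\<^esub> cls U =
      (\<Union>V\<in>integral. cls (fr r \<one> \<otimes>\<^bsub>L\<^esub> (V \<oplus>\<^bsub>L\<^esub> U)))"
    by (simp add: cech_cohomology_def cls_def[of U] module_1 coset_1)
  ultimately show ?thesis using integral_zero by auto
qed

end

text \<open>Additivity of the p-th power stands in for characteristic p. It passes to the
  localization, where it makes Frobenius well defined on cosets.\<close>

locale cech_single_frobenius = cech_single +
  fixes p :: nat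
  assumes pow_add: "a \<in> carrier R \<Longrightarrow> b \<in> carrier R \<Longrightarrow> (a \<oplus> b) [^] p = a [^] p \<oplus> b [^] p"
    and p_pos: "p > 0"
begin

interpretation L: cring L by (rule cring_localization)

lemma L_pow_add:
  assumes "U \<in> carrier L" "V \<in> carrier L"
  shows "(U \<oplus>\<^bsub>L\<^esub> V) [^]\<^bsub>L\<^esub> p = U [^]\<^bsub>L\<^esub> p \<oplus>\<^bsub>L\<^esub> V [^]\<^bsub>L\<^esub> p"
proof -
  from assms obtain a s b t where "a \<in> carrier R" "s \<in> M" "U = fr a s" "b \<in> carrier R" "t \<in> M" "V = fr b t"
    by (auto simp: carrier_localization)
  then show ?thesis using M_mult M_pow
    by (simp add: fraction_add fraction_pow pow_add nat_pow_distrib)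
qed

lemma integral_pow: "V \<in> integral \<Longrightarrow> V [^]\<^bsub>L\<^esub> n \<in> integral" for n :: nat
  using one_M by (auto simp: integral_def fraction_pow)

lemma frobenius_1:
  assumes U: "U \<in> carrier L"
  shows "cohomology_frobenius p R [y] (Suc 0) (cls U) = cls (U [^]\<^bsub>L\<^esub> p)"
proof -
  have "cls ((V \<oplus>\<^bsub>L\<^esub> U) [^]\<^bsub>L\<^esub> p) = cls (U [^]\<^bsub>L\<^esub> p)" if V: "V \<in> integral" for V
  proof -
    have "(V \<oplus>\<^bsub>L\<^esub> U) [^]\<^bsub>L\<^esub> p \<ominus>\<^bsub>L\<^esub> U [^]\<^bsub>L\<^esub> p = V [^]\<^bsub>L\<^esub> p"
      using U integral_closed[OF V] by (simp add: L_pow_add L.minus_eq L.add.m_assoc L.r_neg)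
    then show ?thesis
      using U integral_closed[OF V] integral_pow[OF V] by (simp add: cls_eq_iff)
  qed
  moreover have "cohomology_frobenius p R [y] (Suc 0) (cls U) =
      (\<Union>V\<in>integral. cls ((V \<oplus>\<^bsub>L\<^esub> U) [^]\<^bsub>L\<^esub> p))"
    by (simp add: cohomology_frobenius_def cls_def[of U] module_1 coset_1)
  ultimately show ?thesis using integral_zero by auto
qed

text \<open>Frobenius is additive on the quotient, so injectivity only concerns its kernel. Both the
  positive and the negative result on F-injectivity go through this form.\<close>

lemma inj_on_frobenius_1_iff:
  "inj_on (cohomology_frobenius p R [y] (Suc 0)) (carrier (cech_cohomology R [y] (Suc 0))) \<longleftrightarrow>
     (\<forall>U\<in>carrier L. U [^]\<^bsub>L\<^esub> p \<in> integral \<longrightarrow> U \<in> integral)"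
proof
  assume inj: "inj_on (cohomology_frobenius p R [y] (Suc 0)) (carrier (cech_cohomology R [y] (Suc 0)))"
  show "\<forall>U\<in>carrier L. U [^]\<^bsub>L\<^esub> p \<in> integral \<longrightarrow> U \<in> integral"
  proof (intro ballI impI)
    fix U assume U: "U \<in> carrier L" "U [^]\<^bsub>L\<^esub> p \<in> integral"
    have "\<zero>\<^bsub>L\<^esub> [^]\<^bsub>L\<^esub> p = \<zero>\<^bsub>L\<^esub>" using p_pos by (simp add: L.nat_pow_zero)
    then have "cohomology_frobenius p R [y] (Suc 0) (cls U) = cohomology_frobenius p R [y] (Suc 0) (cls \<zero>\<^bsub>L\<^esub>)"
      using U by (simp add: frobenius_1 cls_zero_iff)
    then have "cls U = cls \<zero>\<^bsub>L\<^esub>"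
      using inj U(1) by (auto simp: cohomology_1 dest: inj_onD)
    then show "U \<in> integral" using U by (simp add: cls_zero_iff)
  qed
next
  assume *: "\<forall>U\<in>carrier L. U [^]\<^bsub>L\<^esub> p \<in> integral \<longrightarrow> U \<in> integral"
  show "inj_on (cohomology_frobenius p R [y] (Suc 0)) (carrier (cech_cohomology R [y] (Suc 0)))"
  proof (rule inj_onI, clarsimp simp: cohomology_1)
    fix U V assume U: "U \<in> carrier L" and V: "V \<in> carrier L"
      and "cohomology_frobenius p R [y] (Suc 0) (cls U) = cohomology_frobenius p R [y] (Suc 0) (cls V)"
    then have i: "U [^]\<^bsub>L\<^esub> p \<ominus>\<^bsub>L\<^esub> V [^]\<^bsub>L\<^esub> p \<in> integral"
      by (simp add: frobenius_1 cls_eq_iff)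
    have "(U \<ominus>\<^bsub>L\<^esub> V) [^]\<^bsub>L\<^esub> p \<oplus>\<^bsub>L\<^esub> V [^]\<^bsub>L\<^esub> p = U [^]\<^bsub>L\<^esub> p"
      using L_pow_add[of "U \<ominus>\<^bsub>L\<^esub> V" V] U V by (simp add: L.minus_eq L.add.m_assoc L.l_neg)
    then have "(U \<ominus>\<^bsub>L\<^esub> V) [^]\<^bsub>L\<^esub> p = U [^]\<^bsub>L\<^esub> p \<ominus>\<^bsub>L\<^esub> V [^]\<^bsub>L\<^esub> p"
      using U V by (metis L.add.inv_solve_right L.minus_closed L.minus_eq L.nat_pow_closed)
    with i * U V show "cls U = cls V" by (simp add: cls_eq_iff)
  qed
qed

lemma funpow_frobenius_1:
  assumes U: "U \<in> carrier L"
  shows "(cohomology_frobenius p R [y] (Suc 0) ^^ e) (cls U) = cls (U [^]\<^bsub>L\<^esub> (p ^ e))"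
  by (induction e) (use U in \<open>auto simp: frobenius_1 L.nat_pow_pow mult.commute\<close>)

end


section \<open>Subfields and their constant term rings\<close>

locale field_subset =
  fixes K :: "'l::field set"
  assumes K: "subfield K (ring_of_type_algebra :: 'l ring)"
begin

lemma K_0 [simp]: "0 \<in> K" and K_1 [simp]: "1 \<in> K"
  and K_add [intro]: "a \<in> K \<Longrightarrow> b \<in> K \<Longrightarrow> a + b \<in> K"
  and K_mult [intro]: "a \<in> K \<Longrightarrow> b \<in> K \<Longrightarrow> a * b \<in> K"
  and K_uminus [intro]: "a \<in> K \<Longrightarrow> - a \<in> K"
  and K_inverse [intro]: "a \<in> K \<Longrightarrow> inverse a \<in> K"
proof -
  interpret F: field "ring_of_type_algebra :: 'l ring" by (rule field_from_type_algebra)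
  note sr = subfieldE(1)[OF K]
  show "0 \<in> K" "1 \<in> K" using subringE(2,3)[OF sr] by simp_all
  show "a \<in> K \<Longrightarrow> b \<in> K \<Longrightarrow> a + b \<in> K" "a \<in> K \<Longrightarrow> b \<in> K \<Longrightarrow> a * b \<in> K"
    using subringE(6,7)[OF sr] by simp_all
  show "- a \<in> K" if "a \<in> K"
  proof -
    have "\<ominus>\<^bsub>ring_of_type_algebra\<^esub> a = - a" by (rule F.minus_equality) simp_all
    then show ?thesis using subringE(5)[OF sr that] by simp
  qed
  show "inverse a \<in> K" if "a \<in> K"
  proof (cases "a = 0")
    case True
    then show ?thesis using subringE(2)[OF sr] by simp
  next
    case False
    have "a \<in> Units (ring_of_type_algebra :: 'l ring)" using False F.field_Units by simp
    then have "inv\<^bsub>ring_of_type_algebra\<^esub> a = inverse a"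
      using False by (intro F.comm_inv_char) simp_all
    then show ?thesis using F.subfield_m_inv(1)[OF K, of a] that False by simp
  qed
qed

lemma K_diff [intro]: "a \<in> K \<Longrightarrow> b \<in> K \<Longrightarrow> a - b \<in> K"
  using K_add[of a "- b"] by auto

lemma K_divide [intro]: "a \<in> K \<Longrightarrow> b \<in> K \<Longrightarrow> a / b \<in> K"
  by (auto simp: divide_inverse)

lemma K_power [intro]: "a \<in> K \<Longrightarrow> a ^ n \<in> K"
  by (induction n) auto

lemma K_sum [intro]: "(\<And>i. i \<in> I \<Longrightarrow> f i \<in> K) \<Longrightarrow> sum f I \<in> K"
  by (induction I rule: infinite_finite_induct) auto

definition "CT = {f :: 'l fps. f $ 0 \<in> K}"

text \<open>This is K[[x]], a discrete valuation ring over which \<open>CT\<close> is finite when L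
  is finite over K.\<close>

definition "PS = {f :: 'l fps. \<forall>n. f $ n \<in> K}"

text \<open>\<open>CT_inverse\<close> covers nonunits too: the constant term of
  \<open>inverse f\<close> is \<open>inverse (f $ 0)\<close>, and \<open>inverse 0\<close> is
  0.\<close>

lemma CT_0 [simp]: "0 \<in> CT" and CT_1 [simp]: "1 \<in> CT"
  and CT_add [intro]: "f \<in> CT \<Longrightarrow> g \<in> CT \<Longrightarrow> f + g \<in> CT"
  and CT_mult [intro]: "f \<in> CT \<Longrightarrow> g \<in> CT \<Longrightarrow> f * g \<in> CT"
  and CT_uminus [intro]: "f \<in> CT \<Longrightarrow> - f \<in> CT"
  and CT_diff [intro]: "f \<in> CT \<Longrightarrow> g \<in> CT \<Longrightarrow> f - g \<in> CT"
  and CT_X [simp]: "fps_X \<in> CT" and CT_X_mult [simp]: "fps_X * h \<in> CT" "h * fps_X \<in> CT"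
  and CT_const [intro]: "a \<in> K \<Longrightarrow> fps_const a \<in> CT"
  and CT_inverse [intro]: "f \<in> CT \<Longrightarrow> inverse f \<in> CT"
  by (auto simp: CT_def)

lemma CT_power [intro]: "f \<in> CT \<Longrightarrow> f ^ n \<in> CT"
  by (induction n) auto

lemma PS_0 [simp]: "0 \<in> PS" and PS_1 [simp]: "1 \<in> PS"
  and PS_add [intro]: "f \<in> PS \<Longrightarrow> g \<in> PS \<Longrightarrow> f + g \<in> PS"
  and PS_mult [intro]: "f \<in> PS \<Longrightarrow> g \<in> PS \<Longrightarrow> f * g \<in> PS"
  and PS_X [simp]: "fps_X \<in> PS"
  and PS_const [intro]: "a \<in> K \<Longrightarrow> fps_const a \<in> PS"
  and PS_CT: "f \<in> PS \<Longrightarrow> f \<in> CT"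
  and PS_shift [intro]: "f \<in> PS \<Longrightarrow> fps_shift n f \<in> PS"
  by (auto simp: PS_def CT_def fps_mult_nth fps_X_nth fps_one_nth)

lemma PS_power [intro]: "f \<in> PS \<Longrightarrow> f ^ n \<in> PS"
  by (induction n) auto

text \<open>The convolution identity for \<open>inverse f * f\<close> expresses each coefficient of
  the inverse through earlier ones, after division by \<open>f $ 0\<close>.\<close>

lemma PS_inverse [intro]:
  assumes f: "f \<in> PS" and f0: "f $ 0 \<noteq> 0"
  shows "inverse f \<in> PS"
proof -
  have "inverse f $ n \<in> K" for n
  proof (induction n rule: less_induct)
    case (less n)
    show ?case
    proof (cases "n = 0")
      case False
      have "(\<Sum>i=0..n. inverse f $ i * f $ (n - i)) = 0"
        using inverse_mult_eq_1[OF f0] False by (metis fps_mult_nth fps_one_nth)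
      then have "inverse f $ n * f $ 0 = - (\<Sum>i=0..<n. inverse f $ i * f $ (n - i))"
        using False by (simp add: sum.last_plus add.commute eq_neg_iff_add_eq_0 flip: atLeastLessThanSuc_atLeastAtMost)
      moreover have "(\<Sum>i=0..<n. inverse f $ i * f $ (n - i)) \<in> K"
        using less f by (intro K_sum K_mult) (auto simp: PS_def)
      ultimately have "inverse f $ n * f $ 0 \<in> K" by auto
      then have "inverse f $ n * f $ 0 / f $ 0 \<in> K" using f by (intro K_divide) (auto simp: PS_def)
      then show ?thesis using f0 by simp
    qed (use f in \<open>auto simp: PS_def\<close>)
  qed
  then show ?thesis by (simp add: PS_def)
qed

lemma carrier_CT: "carrier (constant_term_ring K) = CT"
proof -
  have "f = fps_const (f $ 0) + fps_X * fps_shift 1 f" for f :: "'l fps"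
    by (rule fps_ext) (auto simp: fps_X_mult_nth)
  then show ?thesis by (force simp: constant_term_ring_def CT_def)
qed

end

lemma constant_term_ring_simps [simp]:
  "f \<otimes>\<^bsub>constant_term_ring K\<^esub> g = f * g" "f \<oplus>\<^bsub>constant_term_ring K\<^esub> g = f + g"
  "\<one>\<^bsub>constant_term_ring K\<^esub> = 1" "\<zero>\<^bsub>constant_term_ring K\<^esub> = 0"
  by (simp_all add: constant_term_ring_def ring_of_type_algebra_def)


section \<open>Base change of the constant term ring\<close>

text \<open>Two rings instantiate this: R itself with B a copy of K and q = 1, and the tensor
  product with B = K^(1/p) and q = p. The assumption \<open>functional\<close> is the part of the
  universal property of a tensor product that is used: K-linear maps on R extend by scalars from B,
  and this is how elements of T are shown to be nonzero.\<close>

locale constant_term_base_change = field_subset K + T: cring T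
  for K :: "'l::field set" and T :: "('t, 'm) ring_scheme" (structure) +
  fixes B :: "'l alg_closure set" and q :: nat
    and \<rho> :: "'l fps \<Rightarrow> 't" and \<sigma> :: "'l alg_closure \<Rightarrow> 't"
  assumes finite_extension: "\<exists>n (u :: nat \<Rightarrow> 'l). \<forall>v. \<exists>c. (\<forall>i<n. c i \<in> K) \<and> v = (\<Sum>i<n. c i * u i)"
    and B: "subfield B (ring_of_type_algebra :: 'l alg_closure ring)"
    and K_B: "to_ac ` K \<subseteq> B"
    and B_power: "b \<in> B \<Longrightarrow> b ^ q \<in> to_ac ` K"
    and q_pos: "q > 0"
    and ac_power_add: "(b + b') ^ q = b ^ q + (b' ^ q :: 'l alg_closure)"
    and T_power_add: "x \<in> carrier T \<Longrightarrow> y \<in> carrier T \<Longrightarrow> (x \<oplus> y) [^] q = x [^] q \<oplus> y [^] q"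
    and \<rho>_closed: "r \<in> CT \<Longrightarrow> \<rho> r \<in> carrier T"
    and \<rho>_add: "r \<in> CT \<Longrightarrow> s \<in> CT \<Longrightarrow> \<rho> (r + s) = \<rho> r \<oplus> \<rho> s"
    and \<rho>_mult: "r \<in> CT \<Longrightarrow> s \<in> CT \<Longrightarrow> \<rho> (r * s) = \<rho> r \<otimes> \<rho> s"
    and \<rho>_1: "\<rho> 1 = \<one>"
    and \<sigma>_closed: "b \<in> B \<Longrightarrow> \<sigma> b \<in> carrier T"
    and \<sigma>_add: "b \<in> B \<Longrightarrow> b' \<in> B \<Longrightarrow> \<sigma> (b + b') = \<sigma> b \<oplus> \<sigma> b'"
    and \<sigma>_mult: "b \<in> B \<Longrightarrow> b' \<in> B \<Longrightarrow> \<sigma> (b * b') = \<sigma> b \<otimes> \<sigma> b'"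
    and \<sigma>_1: "\<sigma> 1 = \<one>"
    and \<rho>_const: "c \<in> K \<Longrightarrow> \<rho> (fps_const c) = \<sigma> (to_ac c)"
    and generated: "carrier T = generate (add_monoid T) {\<rho> r \<otimes> \<sigma> b | r b. r \<in> CT \<and> b \<in> B}"
    and functional: "(\<And>r s. r \<in> CT \<Longrightarrow> s \<in> CT \<Longrightarrow> \<phi> (r + s) = \<phi> r + \<phi> s) \<Longrightarrow>
      (\<And>c r. c \<in> K \<Longrightarrow> r \<in> CT \<Longrightarrow> \<phi> (fps_const c * r) = to_ac c * \<phi> r) \<Longrightarrow>
      \<exists>\<Phi> :: 't \<Rightarrow> 'l alg_closure. (\<forall>r\<in>CT. \<forall>b\<in>B. \<Phi> (\<rho> r \<otimes> \<sigma> b) = \<phi> r * b) \<and>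
        (\<forall>x\<in>carrier T. \<forall>y\<in>carrier T. \<Phi> (x \<oplus> y) = \<Phi> x + \<Phi> y)"
begin

interpretation B: field_subset B by (rule field_subset.intro[OF B])

lemma to_ac_B: "c \<in> K \<Longrightarrow> to_ac c \<in> B"
  using K_B by auto

lemma \<rho>_0: "\<rho> 0 = \<zero>"
  using \<rho>_add[of 0 0] \<rho>_closed[of 0] by (simp add: T.add.l_cancel_one)

lemma \<sigma>_0: "\<sigma> 0 = \<zero>"
  using \<sigma>_add[of 0 0] \<sigma>_closed[of 0] by (simp add: T.add.l_cancel_one)

lemma \<sigma>_uminus: "b \<in> B \<Longrightarrow> \<sigma> (- b) = \<ominus> \<sigma> b"
  using \<sigma>_add[of "- b" b] B.K_uminus[of b]
  by (intro T.minus_equality[symmetric]) (auto simp: \<sigma>_0 \<sigma>_closed)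

lemma \<rho>_power: "r \<in> CT \<Longrightarrow> \<rho> (r ^ n) = \<rho> r [^] n"
  by (induction n) (auto simp: \<rho>_1 \<rho>_mult CT_power \<rho>_closed T.m_comm)

lemma \<sigma>_power: "b \<in> B \<Longrightarrow> \<sigma> (b ^ n) = \<sigma> b [^] n"
  by (induction n) (auto simp: \<sigma>_1 \<sigma>_mult B.K_power \<sigma>_closed T.m_comm)

lemma CT_sum: "(\<And>i. i \<in> I \<Longrightarrow> f i \<in> CT) \<Longrightarrow> sum f I \<in> CT"
  by (induction I rule: infinite_finite_induct) auto

lemma \<rho>_sum:
  assumes "finite I" "\<And>i. i \<in> I \<Longrightarrow> f i \<in> CT"
  shows "\<rho> (\<Sum>i\<in>I. f i) = (\<Oplus>i\<in>I. \<rho> (f i))"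
  using assms
proof (induction I rule: finite_induct)
  case (insert i I)
  then have "\<rho> (sum f (insert i I)) = \<rho> (f i) \<oplus> \<rho> (sum f I)"
    using CT_sum[of I f] by (simp add: \<rho>_add)
  then show ?case
    using insert by (subst T.finsum_insert) (auto simp: \<rho>_closed)
qed (simp add: \<rho>_0)

lemma \<sigma>_sum:
  assumes "finite I" "\<And>i. i \<in> I \<Longrightarrow> f i \<in> B"
  shows "\<sigma> (\<Sum>i\<in>I. f i) = (\<Oplus>i\<in>I. \<sigma> (f i))"
  using assms
proof (induction I rule: finite_induct)
  case (insert i I)
  then have "\<sigma> (sum f (insert i I)) = \<sigma> (f i) \<oplus> \<sigma> (sum f I)"
    using B.K_sum[of I f] by (simp add: \<sigma>_add)
  then show ?case
    using insert by (subst T.finsum_insert) (auto simp: \<sigma>_closed)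
qed (simp add: \<sigma>_0)

definition span :: "'l fps set \<Rightarrow> 't set" where
  "span A = generate (add_monoid T) {\<rho> r \<otimes> \<sigma> b | r b. r \<in> A \<and> b \<in> B}"

lemma span_CT: "span CT = carrier T"
  unfolding span_def by (rule generated[symmetric])

lemma span_closed: "A \<subseteq> CT \<Longrightarrow> span A \<subseteq> carrier T"
  unfolding span_def by (rule T.add.generate_incl[simplified]) (auto simp: \<rho>_closed \<sigma>_closed)

lemma span_incl: "r \<in> A \<Longrightarrow> b \<in> B \<Longrightarrow> \<rho> r \<otimes> \<sigma> b \<in> span A"
  unfolding span_def by (rule generate.incl) auto

lemma span_0: "\<zero> \<in> span A"
  unfolding span_def using generate.one[of "add_monoid T"] by simp

lemma span_add: "x \<in> span A \<Longrightarrow> y \<in> span A \<Longrightarrow> x \<oplus> y \<in> span A"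
  unfolding span_def using generate.eng[of _ "add_monoid T"] by simp

text \<open>Additive inverses of generators get no case of their own, since the sign of a pure
  tensor moves into its scalar.\<close>

lemma span_induct [consumes 2, case_names zero pure add]:
  assumes t: "t \<in> span A" and A: "A \<subseteq> CT"
    and "P \<zero>" and pure: "\<And>r b. r \<in> A \<Longrightarrow> b \<in> B \<Longrightarrow> P (\<rho> r \<otimes> \<sigma> b)"
    and add: "\<And>x y. x \<in> span A \<Longrightarrow> y \<in> span A \<Longrightarrow> P x \<Longrightarrow> P y \<Longrightarrow> P (x \<oplus> y)"
  shows "P t"
  using t[unfolded span_def]
proof (induction t rule: generate.induct)
  case (inv h)
  then obtain r b where h: "h = \<rho> r \<otimes> \<sigma> b" "r \<in> A" "b \<in> B" by auto
  then have "\<ominus> h = \<rho> r \<otimes> \<sigma> (- b)"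
    using A by (simp add: \<sigma>_uminus subset_eq T.r_minus \<rho>_closed \<sigma>_closed)
  then show ?case using pure[of r "- b"] h B.K_uminus by (simp add: a_inv_def)
next
  case (eng x y)
  then show ?case using add unfolding span_def by simp
qed (use assms in auto)

lemma span_uminus:
  assumes "t \<in> span A" "A \<subseteq> CT"
  shows "\<ominus> t \<in> span A"
  using assms
proof (induction rule: span_induct)
  case (pure r b)
  then have "\<ominus> (\<rho> r \<otimes> \<sigma> b) = \<rho> r \<otimes> \<sigma> (- b)"
    using assms(2) by (simp add: \<sigma>_uminus subset_eq T.r_minus \<rho>_closed \<sigma>_closed)
  then show ?case using span_incl[of r A "- b"] pure B.K_uminus by simp
next
  case (add x y)
  moreover from this have "x \<in> carrier T" "y \<in> carrier T" using span_closed[OF assms(2)] by blast+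
  ultimately show ?case using span_add[of "\<ominus> x" A "\<ominus> y"] by (simp add: T.minus_add)
qed (auto simp: span_0)

lemma span_mult:
  assumes "x \<in> span A" "y \<in> span A" "A \<subseteq> CT"
    and mult: "\<And>r s. r \<in> A \<Longrightarrow> s \<in> A \<Longrightarrow> r * s \<in> A"
  shows "x \<otimes> y \<in> span A"
  using assms(1,3)
proof (induction rule: span_induct)
  case zero
  then show ?case using assms(2) span_closed[OF assms(3)] by (auto simp: span_0)
next
  case (pure r b)
  show ?case using assms(2,3)
  proof (induction rule: span_induct)
    case zero
    then show ?case using pure assms(3) by (auto simp: span_0 \<rho>_closed \<sigma>_closed)
  next
    case (pure s c)
    have "(\<rho> r \<otimes> \<sigma> b) \<otimes> (\<rho> s \<otimes> \<sigma> c) = \<rho> (r * s) \<otimes> \<sigma> (b * c)"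
      using pure \<open>r \<in> A\<close> \<open>b \<in> B\<close> assms(3) by (simp add: subset_eq \<rho>_mult \<sigma>_mult \<rho>_closed \<sigma>_closed T.m_ac)
    then show ?case using pure \<open>r \<in> A\<close> \<open>b \<in> B\<close> mult by (auto intro!: span_incl)
  next
    case (add x y)
    then show ?case using span_closed[OF assms(3)] pure assms(3)
      by (auto simp: T.r_distr subset_eq \<rho>_closed \<sigma>_closed intro!: span_add)
  qed
next
  case (add x z)
  then show ?case using span_closed[OF assms(3)] assms(2)
    by (auto simp: T.l_distr subset_eq intro!: span_add)
qed

section \<open>Extended linear functionals and the residue map\<close>

definition ev :: "('l fps \<Rightarrow> 'l alg_closure) \<Rightarrow> 't \<Rightarrow> 'l alg_closure" where
  "ev \<phi> = (SOME \<Phi>. (\<forall>r\<in>CT. \<forall>b\<in>B. \<Phi> (\<rho> r \<otimes> \<sigma> b) = \<phi> r * b) \<and>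
        (\<forall>x\<in>carrier T. \<forall>y\<in>carrier T. \<Phi> (x \<oplus> y) = \<Phi> x + \<Phi> y))"

definition linear_on_CT :: "('l fps \<Rightarrow> 'l alg_closure) \<Rightarrow> bool" where
  "linear_on_CT \<phi> \<longleftrightarrow> (\<forall>r\<in>CT. \<forall>s\<in>CT. \<phi> (r + s) = \<phi> r + \<phi> s) \<and>
     (\<forall>c\<in>K. \<forall>r\<in>CT. \<phi> (fps_const c * r) = to_ac c * \<phi> r)"

lemma ev:
  assumes "linear_on_CT \<phi>"
  shows ev_pure: "r \<in> CT \<Longrightarrow> b \<in> B \<Longrightarrow> ev \<phi> (\<rho> r \<otimes> \<sigma> b) = \<phi> r * b"
    and ev_add: "x \<in> carrier T \<Longrightarrow> y \<in> carrier T \<Longrightarrow> ev \<phi> (x \<oplus> y) = ev \<phi> x + ev \<phi> y"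
  using someI_ex[OF functional[of \<phi>]] assms unfolding ev_def[symmetric] linear_on_CT_def by blast+

lemma ev_\<rho>: "linear_on_CT \<phi> \<Longrightarrow> r \<in> CT \<Longrightarrow> ev \<phi> (\<rho> r) = \<phi> r"
  using ev_pure[of \<phi> r 1] by (simp add: \<sigma>_1 \<rho>_closed)

lemma ev_0: "linear_on_CT \<phi> \<Longrightarrow> ev \<phi> \<zero> = 0"
  using ev_add[of \<phi> \<zero> \<zero>] by (metis T.r_zero T.zero_closed add_cancel_left_right)

lemma linear_nth: "linear_on_CT (\<lambda>r. to_ac (r $ n))"
  by (simp add: linear_on_CT_def)

text \<open>The coefficient maps are K-linear, so their extensions to T recover every coefficient of
  r from \<open>\<rho> r\<close>.\<close>

lemma \<rho>_inj:
  assumes "r \<in> CT" "s \<in> CT" "\<rho> r = \<rho> s"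
  shows "r = s"
proof (rule fps_ext)
  fix n
  show "r $ n = s $ n"
    using ev_\<rho>[OF linear_nth[of n] assms(1)] ev_\<rho>[OF linear_nth[of n] assms(2)] assms(3) by simp
qed

text \<open>Reduction of T to the field B, sending x to 0. As an extended functional it is additive
  by construction; products are controlled through q-th powers in
  \<open>power_in_\<rho>\<close>.\<close>

definition res :: "'t \<Rightarrow> 'l alg_closure" where
  "res = ev (\<lambda>r. to_ac (r $ 0))"

lemma res_\<rho>\<sigma>: "r \<in> CT \<Longrightarrow> b \<in> B \<Longrightarrow> res (\<rho> r \<otimes> \<sigma> b) = to_ac (r $ 0) * b"
  and res_\<rho>: "r \<in> CT \<Longrightarrow> res (\<rho> r) = to_ac (r $ 0)"
  and res_0: "res \<zero> = 0"
  and res_add: "x \<in> carrier T \<Longrightarrow> y \<in> carrier T \<Longrightarrow> res (x \<oplus> y) = res x + res y"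
  unfolding res_def
  using ev_pure[OF linear_nth] ev_\<rho>[OF linear_nth] ev_0[OF linear_nth] ev_add[OF linear_nth] by auto

text \<open>On a pure tensor b^q is a scalar from K and moves into R; sums follow because the q-th
  power is additive. The set A is general so that one argument serves both T and the subring
  generated by K[[x]] and B.\<close>

lemma power_in_\<rho>:
  assumes "t \<in> span A" and A: "A \<subseteq> CT" "0 \<in> A"
    "\<And>r s. r \<in> A \<Longrightarrow> s \<in> A \<Longrightarrow> r + s \<in> A" "\<And>r s. r \<in> A \<Longrightarrow> s \<in> A \<Longrightarrow> r * s \<in> A"
    "\<And>c. c \<in> K \<Longrightarrow> fps_const c \<in> A"
  shows "\<exists>s\<in>A. t [^] q = \<rho> s \<and> to_ac (s $ 0) = res t ^ q"
  using assms(1,2)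
proof (induction rule: span_induct)
  case zero
  then show ?case using A q_pos by (auto simp: \<rho>_0 T.nat_pow_zero res_0 intro!: bexI[of _ 0])
next
  case (pure r b)
  obtain c where c: "c \<in> K" "b ^ q = to_ac c" using B_power[OF pure(2)] by auto
  have rq: "r ^ n \<in> A" if "n > 0" for n
    using that
  proof (induction n)
    case (Suc n)
    then show ?case using pure A(4)[of r "r ^ n"] by (cases "n = 0") auto
  qed simp
  have r: "r \<in> CT" using pure A by auto
  have "(\<rho> r \<otimes> \<sigma> b) [^] q = \<rho> (r ^ q * fps_const c)"
    using r pure c CT_power CT_const
    by (simp add: T.nat_pow_distrib \<rho>_closed \<sigma>_closed \<rho>_mult \<rho>_power \<rho>_const \<sigma>_power flip: c(2))
  moreover have "to_ac ((r ^ q * fps_const c) $ 0) = res (\<rho> r \<otimes> \<sigma> b) ^ q"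
    using r pure c by (simp add: res_\<rho>\<sigma> power_mult_distrib fps_power_zeroth flip: c(2))
  ultimately show ?case using A c rq[OF q_pos] by blast
next
  case (add x y)
  then obtain r s where "r \<in> A" "s \<in> A" "x [^] q = \<rho> r" "y [^] q = \<rho> s"
     "to_ac (r $ 0) = res x ^ q" "to_ac (s $ 0) = res y ^ q" by auto
  moreover have "x \<in> carrier T" "y \<in> carrier T" using add span_closed[OF A(1)] by auto
  ultimately show ?case using A
    by (auto simp: T_power_add res_add ac_power_add \<rho>_add subset_eq intro!: bexI[of _ "r + s"])
qed

lemma power_in_\<rho>_CT:
  assumes "t \<in> carrier T"
  obtains s where "s \<in> CT" "t [^] q = \<rho> s" "to_ac (s $ 0) = res t ^ q"
  using power_in_\<rho>[of t CT] assms by (auto simp: span_CT)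

text \<open>The q-th power of t is a unit of R, so t^(q-1) divided by it inverts t.\<close>

lemma unit_inverse:
  assumes t: "t \<in> carrier T" and s: "s \<in> CT" "t [^] q = \<rho> s" "s $ 0 \<noteq> 0"
  shows "t \<otimes> (t [^] (q - 1) \<otimes> \<rho> (inverse s)) = \<one>"
proof -
  have "t \<otimes> (t [^] (q - 1) \<otimes> \<rho> (inverse s)) = t [^] q \<otimes> \<rho> (inverse s)"
    using t s q_pos T.nat_pow_Suc2[OF t, of "q - 1"] by (simp add: T.m_assoc \<rho>_closed CT_inverse)
  also have "\<dots> = \<rho> (s * inverse s)" using s by (simp add: \<rho>_mult CT_inverse)
  also have "\<dots> = \<one>" using s inverse_mult_eq_1'[of s] by (simp add: \<rho>_1)
  finally show ?thesis .
qed

lemma Units_iff: "t \<in> Units T \<longleftrightarrow> t \<in> carrier T \<and> res t \<noteq> 0"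
proof
  assume t: "t \<in> Units T"
  then obtain t' where t': "t \<in> carrier T" "t' \<in> carrier T" "t \<otimes> t' = \<one>"
    by (auto simp: Units_def)
  obtain s s' where s: "s \<in> CT" "t [^] q = \<rho> s" "to_ac (s $ 0) = res t ^ q" and s': "s' \<in> CT" "t' [^] q = \<rho> s'"
    using power_in_\<rho>_CT t' by metis
  have "\<rho> (s * s') = \<rho> 1"
    using t' s s' by (simp add: \<rho>_mult \<rho>_1 flip: T.nat_pow_distrib s(2) s'(2))
  then have "s * s' = 1" using s(1) s'(1) \<rho>_inj[of "s * s'" 1] by auto
  then have "s $ 0 * s' $ 0 = 1" by (metis fps_mult_nth_0 fps_one_nth)
  then have "s $ 0 \<noteq> 0" by auto
  then show "t \<in> carrier T \<and> res t \<noteq> 0" using t' s q_pos by (auto simp: zero_power)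
next
  assume t: "t \<in> carrier T \<and> res t \<noteq> 0"
  then obtain s where s: "s \<in> CT" "t [^] q = \<rho> s" "to_ac (s $ 0) = res t ^ q"
    using power_in_\<rho>_CT by metis
  then have "s $ 0 \<noteq> 0" using t by auto
  then have "t \<otimes> (t [^] (q - 1) \<otimes> \<rho> (inverse s)) = \<one>"
    using unit_inverse t s by blast
  then show "t \<in> Units T"
    using t s T.m_comm[of t "t [^] (q - 1) \<otimes> \<rho> (inverse s)"]
    by (auto simp: Units_def \<rho>_closed CT_inverse intro!: bexI[of _ "t [^] (q - 1) \<otimes> \<rho> (inverse s)"])
qed

section \<open>The unique maximal ideal\<close>

definition mx :: "'t set" where "mx = {t \<in> carrier T. res t = 0}"

lemma mx_ideal: "ideal mx T"
proof (rule idealI)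
  show "subgroup mx (add_monoid T)"
  proof (rule T.add.subgroupI)
    show "mx \<subseteq> carrier T" "mx \<noteq> {}" by (auto simp: mx_def intro: exI[of _ \<zero>] res_0)
    show "a \<oplus> b \<in> mx" if "a \<in> mx" "b \<in> mx" for a b
      using that by (simp add: mx_def res_add)
    show "\<ominus> a \<in> mx" if "a \<in> mx" for a
      using that res_add[of "\<ominus> a" a] by (simp add: mx_def T.l_neg res_0)
  qed
next
  \<comment> \<open>If a product were a unit, so would be each factor. This yields the ideal
    property without multiplicativity of \<open>res\<close>.\<close>
  have *: "t \<otimes> a \<in> mx" if "a \<in> mx" "t \<in> carrier T" for a t
  proof (rule ccontr)
    assume "t \<otimes> a \<notin> mx"
    then have "t \<otimes> a \<in> Units T" using that by (auto simp: Units_iff mx_def)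
    then obtain z where z: "z \<in> carrier T" "(t \<otimes> a) \<otimes> z = \<one>" by (auto simp: Units_def)
    then have "a \<otimes> (t \<otimes> z) = \<one>" "(t \<otimes> z) \<otimes> a = \<one>" using that by (auto simp: mx_def T.m_ac)
    then have "a \<in> Units T" using that z by (auto simp: Units_def mx_def intro!: bexI[of _ "t \<otimes> z"])
    then show False using that by (simp add: Units_iff mx_def)
  qed
  then show "t \<otimes> a \<in> mx" "a \<otimes> t \<in> mx" if "a \<in> mx" "t \<in> carrier T" for a t
    using that T.m_comm[of a t] by (auto simp: mx_def)
qed (rule T.ring_axioms)

lemma proper_ideal_subset_mx:
  assumes I: "ideal I T" "I \<noteq> carrier T" shows "I \<subseteq> mx"
proof
  fix t assume t: "t \<in> I"
  interpret I: ideal I T by fact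
  have "t \<notin> Units T"
  proof
    assume "t \<in> Units T"
    then obtain z where "z \<in> carrier T" "z \<otimes> t = \<one>" by (auto simp: Units_def)
    then have "\<one> \<in> I" using I.I_l_closed[OF t, of z] by simp
    then show False using I.one_imp_carrier I(2) by auto
  qed
  then show "t \<in> mx" using t I.a_subset by (auto simp: Units_iff mx_def)
qed

lemma one_not_in_mx: "\<one> \<notin> mx"
  using res_\<rho>[of 1] by (simp add: mx_def \<rho>_1)

lemma mx_maximal: "maximalideal mx T"
proof (rule maximalidealI[OF mx_ideal])
  show "carrier T \<noteq> mx" using one_not_in_mx by auto
  show "J = mx \<or> J = carrier T" if "ideal J T" "mx \<subseteq> J" "J \<subseteq> carrier T" for J
    using proper_ideal_subset_mx[OF that(1)] that by auto
qed

lemma ex1_maximal: "\<exists>!I. maximalideal I T"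
proof (rule ex1I[where a = mx], rule mx_maximal)
  fix I assume I: "maximalideal I T"
  then have "I \<subseteq> mx"
    using proper_ideal_subset_mx[of I] by (auto simp: maximalideal_def maximalideal_axioms_def)
  then show "I = mx"
    using maximalideal.I_maximal[OF I mx_ideal] one_not_in_mx mx_maximal
    by (auto simp: mx_def)
qed

lemma max_ideal: "max_ideal T = mx"
  unfolding max_ideal_def using ex1_maximal mx_maximal by (rule the1_equality)

end

context constant_term_base_change
begin

interpretation B: field_subset B by (rule field_subset.intro[OF B])

section \<open>Prime ideals, dimension and parameters\<close>

definition nil :: "'t set" where "nil = {t \<in> carrier T. t [^] q = \<zero>}"

lemma \<rho>X_closed: "\<rho> fps_X \<in> carrier T"
  by (simp add: \<rho>_closed)

lemma \<rho>_eq_0_iff: "r \<in> CT \<Longrightarrow> \<rho> r = \<zero> \<longleftrightarrow> r = 0"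
  using \<rho>_inj[of r 0] by (auto simp: \<rho>_0)

lemma \<rho>X_in_mx: "\<rho> fps_X \<in> mx"
  by (simp add: mx_def \<rho>X_closed res_\<rho>)

lemma \<rho>X_power_nonzero: "\<rho> fps_X [^] (n::nat) \<noteq> \<zero>"
  using \<rho>_eq_0_iff[of "fps_X ^ n"] by (simp add: CT_power flip: \<rho>_power)

lemma zero_power_q: "\<zero> [^] q = \<zero>"
  using q_pos by (simp add: T.nat_pow_zero)

text \<open>The q-th power of t is a series s with zero constant term. Its quotient s/x may leave R,
  but s^2/x again has zero constant term and stays in R; hence the exponent 2q.\<close>

lemma square_in_\<rho>X:
  assumes t: "t \<in> mx"
  shows "\<exists>z\<in>carrier T. t [^] (q * 2) = \<rho> fps_X \<otimes> z"
proof -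
  obtain s where s: "s \<in> CT" "t [^] q = \<rho> s" "to_ac (s $ 0) = res t ^ q"
    using power_in_\<rho>_CT[of t] t unfolding mx_def by blast
  then have "s $ 0 = 0" using t q_pos by (simp add: mx_def zero_power)
  then have X: "s = fps_X * fps_shift 1 s"
    by (intro fps_ext) (auto simp: fps_X_mult_nth)
  have "t [^] (q * 2) = \<rho> s \<otimes> \<rho> s"
    using t T.nat_pow_mult[of t q q] by (simp add: mx_def s(2) mult_2_right)
  also have "\<dots> = \<rho> (fps_X * (fps_X * (fps_shift 1 s * fps_shift 1 s)))"
    using s by (subst X) (subst (2) X, simp add: mult_ac flip: \<rho>_mult)
  also have "\<dots> = \<rho> fps_X \<otimes> \<rho> (fps_X * (fps_shift 1 s * fps_shift 1 s))"
    by (rule \<rho>_mult) auto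
  finally show ?thesis using \<rho>_closed[OF CT_X_mult(1)] by blast
qed

text \<open>After taking out x^k from s, the unit factor u may have its constant term outside K; one
  more factor x brings x/u back into \<open>CT\<close>.\<close>

lemma nonzero_divides_power:
  assumes "s \<in> CT" "s \<noteq> 0"
  shows "\<exists>k. \<exists>z\<in>CT. fps_X ^ Suc k = s * z"
proof -
  obtain k u where u: "s = u * fps_X ^ k" "u $ 0 \<noteq> 0"
    using assms(2) subdegree_decompose[of s] nth_subdegree_nonzero[of s] by (metis fps_shift_nth add_0)
  then have "fps_X ^ Suc k = s * (fps_X * inverse u)"
    using inverse_mult_eq_1'[OF u(2)] by (simp add: mult_ac)
  then show ?thesis using CT_X_mult by blast
qed

text \<open>Membership of x in P decides. If x lies in P, every element of \<open>mx\<close> has a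
  power in P. If not, a member of P with nonzero q-th power would have a multiple equal to a power
  of x, which would force x into P.\<close>

lemma prime_cases:
  assumes P: "primeideal P T"
  shows "P = nil \<or> P = mx"
proof -
  interpret P: primeideal P T by fact
  have pow: "t \<in> P" if "t [^] n \<in> P" "t \<in> carrier T" for t and n :: nat
    using that
  proof (induction n)
    case 0
    then show ?case using P.one_imp_carrier P.I_notcarr by simp
  next
    case (Suc n)
    then show ?case using P.I_prime[of "t [^] n" t] by auto
  qed
  have sub: "P \<subseteq> mx"
    using proper_ideal_subset_mx[OF P.ideal_axioms] P.I_notcarr by auto
  show ?thesis
  proof (cases "\<rho> fps_X \<in> P")
    case True
    have "t \<in> P" if t: "t \<in> mx" for t
    proof -
      obtain z where "z \<in> carrier T" "t [^] (q * 2) = \<rho> fps_X \<otimes> z" using square_in_\<rho>X[OF t] by auto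
      then have "t [^] (q * 2) \<in> P" using True P.I_r_closed by simp
      then show ?thesis using pow t by (auto simp: mx_def)
    qed
    then show ?thesis using sub by auto
  next
    case False
    have "t [^] q = \<zero>" if t: "t \<in> P" for t
    proof (rule ccontr)
      assume n: "t [^] q \<noteq> \<zero>"
      have tc: "t \<in> carrier T" using t P.a_subset by auto
      obtain s where s: "s \<in> CT" "t [^] q = \<rho> s" using power_in_\<rho>_CT[OF tc] by metis
      then have "s \<noteq> 0" using n by (auto simp: \<rho>_0)
      then obtain k z where z: "z \<in> CT" "fps_X ^ Suc k = s * z" using nonzero_divides_power s by metis
      have "t [^] q \<in> P"
        using t tc q_pos P.I_l_closed[OF t, of "t [^] (q - 1)"] T.nat_pow_Suc[of t "q - 1"] by simp
      then have "\<rho> s \<otimes> \<rho> z \<in> P" using s z by (simp add: P.I_r_closed \<rho>_closed)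
      then have "\<rho> (fps_X ^ Suc k) \<in> P"
        using s z(1) by (simp only: z(2) \<rho>_mult)
      then have "\<rho> fps_X [^] Suc k \<in> P" by (simp only: \<rho>_power[OF CT_X])
      then show False using pow \<rho>X_closed False by blast
    qed
    moreover have "t \<in> P" if "t \<in> nil" for t
    proof (rule pow)
      show "t \<in> carrier T" using that by (simp add: nil_def)
      show "t [^] q \<in> P"
        using that additive_subgroup.zero_closed[OF P.is_additive_subgroup] by (simp add: nil_def)
    qed
    ultimately have "P = nil" using P.a_subset unfolding nil_def by blast
    then show ?thesis ..
  qed
qed

text \<open>The q-th power maps T additively and multiplicatively into a copy of the domain
  \<open>CT\<close>, and \<open>nil\<close> is its kernel.\<close>

lemma nil_prime: "primeideal nil T"
proof (rule primeidealI)
  show "ideal nil T"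
  proof (rule idealI)
    show "subgroup nil (add_monoid T)"
    proof (rule T.add.subgroupI)
      show "nil \<subseteq> carrier T" "nil \<noteq> {}" using zero_power_q by (auto simp: nil_def)
      show "a \<oplus> b \<in> nil" if "a \<in> nil" "b \<in> nil" for a b
        using that by (simp add: nil_def T_power_add)
      show "\<ominus> a \<in> nil" if "a \<in> nil" for a
      proof -
        have "(\<ominus> a \<oplus> a) [^] q = (\<ominus> a) [^] q \<oplus> a [^] q"
          using that by (intro T_power_add) (auto simp: nil_def)
        then show ?thesis using that by (simp add: nil_def T.l_neg zero_power_q)
      qed
    qed
    show "x \<otimes> a \<in> nil" "a \<otimes> x \<in> nil" if "a \<in> nil" "x \<in> carrier T" for a x
      using that by (auto simp: nil_def T.nat_pow_distrib)
  qed (rule T.ring_axioms)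
  show "carrier T \<noteq> nil"
  proof
    assume "carrier T = nil"
    then have "\<one> \<in> nil" by auto
    then show False using \<rho>X_power_nonzero[of 0] by (simp add: nil_def)
  qed
  fix a b assume ab: "a \<in> carrier T" "b \<in> carrier T" "a \<otimes> b \<in> nil"
  obtain s where s: "s \<in> CT" "a [^] q = \<rho> s" using power_in_\<rho>_CT[OF ab(1)] by metis
  obtain r where r: "r \<in> CT" "b [^] q = \<rho> r" using power_in_\<rho>_CT[OF ab(2)] by metis
  have "\<rho> (s * r) = \<zero>" using ab s r by (simp add: nil_def T.nat_pow_distrib \<rho>_mult)
  then have "s = 0 \<or> r = 0" using s r \<rho>_eq_0_iff[of "s * r"] by auto
  then show "a \<in> nil \<or> b \<in> nil" using ab s r by (auto simp: nil_def \<rho>_0)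
qed (rule T.cring_axioms)

lemma krull_dim_1: "krull_dim T = 1"
proof (rule krull_dim_eq_1[OF nil_prime])
  show "primeideal mx T" using mx_maximal T.maximalideal_prime by blast
  have "ideal nil T" "nil \<noteq> carrier T"
    using nil_prime by (auto simp: primeideal_def primeideal_axioms_def)
  then have "nil \<subseteq> mx" by (rule proper_ideal_subset_mx)
  moreover have "\<rho> fps_X \<notin> nil" using \<rho>X_power_nonzero[of q] by (auto simp: nil_def)
  ultimately show "nil \<subset> mx" using \<rho>X_in_mx by auto
qed (rule prime_cases)

text \<open>The chosen parameter y is unspecified, but some power of x is a multiple of it. A
  vanishing y^q would therefore make x nilpotent.\<close>

lemma some_parameters:
  obtains y where "some_parameters T = [y]" "y \<in> mx" "y [^] q \<noteq> \<zero>"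
proof -
  have "system_of_parameters T [\<rho> fps_X]"
    unfolding system_of_parameters_def
  proof (intro conjI ballI)
    show "enat (length [\<rho> fps_X]) = krull_dim T" by (simp add: krull_dim_1 one_enat_def)
    show "set [\<rho> fps_X] \<subseteq> max_ideal T" by (simp add: max_ideal \<rho>X_in_mx)
    fix t assume "t \<in> max_ideal T"
    then obtain z where z: "z \<in> carrier T" "t [^] (q * 2) = \<rho> fps_X \<otimes> z"
      using square_in_\<rho>X by (auto simp: max_ideal)
    have "\<rho> fps_X \<otimes> z \<in> Idl {\<rho> fps_X}"
      using z \<rho>X_closed by (intro ideal.I_r_closed[OF T.genideal_ideal] T.genideal_self') auto
    then show "\<exists>n::nat. t [^] n \<in> Idl (set [\<rho> fps_X])" using z by (auto intro!: exI[of _ "q * 2"])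
  qed
  then have sop: "system_of_parameters T (some_parameters T)"
    unfolding some_parameters_def by (rule someI)
  then have "length (some_parameters T) = 1"
    by (simp add: system_of_parameters_def krull_dim_1 one_enat_def)
  then obtain y where y: "some_parameters T = [y]" by (auto simp: length_Suc_conv)
  have ym: "y \<in> mx" using sop by (simp add: y system_of_parameters_def max_ideal)
  then have yc: "y \<in> carrier T" by (simp add: mx_def)
  obtain n :: nat where "\<rho> fps_X [^] n \<in> Idl {y}"
    using sop \<rho>X_in_mx by (auto simp: y system_of_parameters_def max_ideal)
  then obtain z where z: "z \<in> carrier T" "\<rho> fps_X [^] n = z \<otimes> y"
    using T.cgenideal_eq_genideal[OF yc] by (auto simp: cgenideal_def)
  have "y [^] q \<noteq> \<zero>"
  proof
    assume "y [^] q = \<zero>"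
    then have "(\<rho> fps_X [^] n) [^] q = \<zero>" using z yc by (simp add: T.nat_pow_distrib)
    then show False using \<rho>X_power_nonzero \<rho>X_closed by (auto simp: T.nat_pow_pow)
  qed
  then show thesis using that y ym by blast
qed

section \<open>The subring generated by K[[x]] and B, and the Noetherian property\<close>

lemma span_PS_form:
  assumes "d \<in> span PS"
  shows "\<exists>S f. finite S \<and> S \<subseteq> B \<and> (\<forall>b. f b \<in> PS) \<and> (\<forall>b. b \<notin> S \<longrightarrow> f b = 0) \<and>
     d = (\<Oplus>b\<in>S. \<rho> (f b) \<otimes> \<sigma> b)"
proof -
  have "PS \<subseteq> CT" using PS_CT by auto
  with assms show ?thesis
  proof (induction rule: span_induct)
    case zero
    then show ?case by (intro exI[of _ "{}"] exI[of _ "\<lambda>_. 0"]) auto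
  next
    case (pure r b)
    then show ?case
      by (intro exI[of _ "{b}"] exI[of _ "\<lambda>b'. if b' = b then r else 0"])
        (auto simp: \<rho>_closed \<sigma>_closed PS_CT)
  next
    case (add x y)
    obtain S f where S: "finite S" "S \<subseteq> B" "\<And>b. f b \<in> PS" "\<And>b. b \<notin> S \<Longrightarrow> f b = 0"
      "x = (\<Oplus>b\<in>S. \<rho> (f b) \<otimes> \<sigma> b)" using add by metis
    obtain S' f' where S': "finite S'" "S' \<subseteq> B" "\<And>b. f' b \<in> PS" "\<And>b. b \<notin> S' \<Longrightarrow> f' b = 0"
      "y = (\<Oplus>b\<in>S'. \<rho> (f' b) \<otimes> \<sigma> b)" using add by metis
    have c: "\<rho> (f b) \<otimes> \<sigma> b \<in> carrier T" "\<rho> (f' b) \<otimes> \<sigma> b \<in> carrier T" if "b \<in> S \<union> S'" for b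
      using that S S' by (auto intro!: \<rho>_closed \<sigma>_closed PS_CT)
    \<comment> \<open>Coefficients vanish off their index sets, so both sums extend to the union and
      can be added term by term.\<close>
    have x: "x = (\<Oplus>b\<in>S \<union> S'. \<rho> (f b) \<otimes> \<sigma> b)"
      unfolding S(5) using S S' c
      by (intro T.add.finprod_mono_neutral_cong_left) (auto simp: \<rho>_0 \<sigma>_closed subset_eq)
    have y: "y = (\<Oplus>b\<in>S \<union> S'. \<rho> (f' b) \<otimes> \<sigma> b)"
      unfolding S'(5) using S S' c
      by (intro T.add.finprod_mono_neutral_cong_left) (auto simp: \<rho>_0 \<sigma>_closed subset_eq)
    have "x \<oplus> y = (\<Oplus>b\<in>S \<union> S'. \<rho> (f b) \<otimes> \<sigma> b \<oplus> \<rho> (f' b) \<otimes> \<sigma> b)"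
      unfolding x y using c by (intro T.finsum_addf[symmetric]) auto
    also have "\<dots> = (\<Oplus>b\<in>S \<union> S'. \<rho> (f b + f' b) \<otimes> \<sigma> b)"
    proof (rule T.finsum_cong')
      fix b assume "b \<in> S \<union> S'"
      then have "b \<in> B" using S S' by auto
      then show "\<rho> (f b) \<otimes> \<sigma> b \<oplus> \<rho> (f' b) \<otimes> \<sigma> b = \<rho> (f b + f' b) \<otimes> \<sigma> b"
        using S(3)[of b] S'(3)[of b] by (simp add: \<rho>_add PS_CT T.l_distr \<rho>_closed \<sigma>_closed)
    next
      show "(\<lambda>b. \<rho> (f b + f' b) \<otimes> \<sigma> b) \<in> S \<union> S' \<rightarrow> carrier T"
        using S S' by (auto intro!: T.m_closed \<rho>_closed \<sigma>_closed PS_CT PS_add)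
    qed simp
    finally show ?case using S S'
      by (intro exI[of _ "S \<union> S'"] exI[of _ "\<lambda>b. f b + f' b"]) auto
  qed
qed

lemma PS_subset: "PS \<subseteq> CT"
  using PS_CT by auto

text \<open>The q-th power of w is a series over K with nonzero constant term. Its inverse is again
  over K, so inverting w does not leave the subring.\<close>

lemma unit_in_span_PS:
  assumes w: "w \<in> span PS" and "res w \<noteq> 0"
  shows "\<exists>w'\<in>span PS. w \<otimes> w' = \<one>"
proof -
  have wc: "w \<in> carrier T" using w span_closed[OF PS_subset] by auto
  obtain s where s: "s \<in> PS" "w [^] q = \<rho> s" "to_ac (s $ 0) = res w ^ q"
    using power_in_\<rho>[OF w PS_subset] by (metis PS_0 PS_add PS_mult PS_const)
  then have s0: "s $ 0 \<noteq> 0" using assms(2) by auto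
  have one: "\<one> \<in> span PS" using span_incl[of 1 PS 1] by (simp add: \<rho>_1 \<sigma>_1)
  have mult: "x \<otimes> y \<in> span PS" if "x \<in> span PS" "y \<in> span PS" for x y
    using span_mult[OF that PS_subset PS_mult] by simp
  have "w [^] (n::nat) \<in> span PS" for n
    by (induction n) (auto simp: one intro!: mult w)
  moreover have "\<rho> (inverse s) \<in> span PS"
    using span_incl[of "inverse s" PS 1] PS_inverse[OF s(1) s0] by (simp add: \<sigma>_1 \<rho>_closed PS_CT)
  ultimately show ?thesis
    using unit_inverse[OF wc _ s(2) s0] s(1) mult PS_CT by blast
qed

text \<open>If a sum of pure tensors has residue \<open>0\<close> but a unit among its coefficients, then one of the
  scalars is a combination of the others over \<open>K\<close>, and the number of terms drops.\<close>

lemma span_PS_power_unit_aux: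
  assumes "finite S" "S \<subseteq> B" "\<And>b. b \<in> S \<Longrightarrow> f b \<in> PS"
    and "d = (\<Oplus>b\<in>S. \<rho> (f b) \<otimes> \<sigma> b)"
  shows "d = \<zero> \<or> (\<exists>m::nat. \<exists>v\<in>span PS. \<exists>w\<in>span PS. v \<otimes> w = \<one> \<and> d = \<rho> fps_X [^] m \<otimes> v)"
  using assms
proof (induction "card S" arbitrary: S f d rule: less_induct)
  case less
  have fB: "\<rho> (f b) \<otimes> \<sigma> b \<in> carrier T" if "b \<in> S" for b
    using that less.prems(2,3) by (auto intro!: T.m_closed \<rho>_closed \<sigma>_closed PS_CT)
  show ?case
  proof (cases "\<forall>b\<in>S. f b = 0")
    case True
    then have "d = \<zero>" unfolding less.prems(4)
      using less.prems(2) by (intro T.add.finprod_one_eqI) (auto simp: \<rho>_0 \<sigma>_closed)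
    then show ?thesis ..
  next
    case False
    define Z where "Z = {b \<in> S. f b \<noteq> 0}"
    have Z: "finite Z" "Z \<noteq> {}" using less.prems(1) False by (auto simp: Z_def)
    \<comment> \<open>Taking out the least order m gives b0 a unit coefficient: either the residue
      of what remains is nonzero, or b0 can be eliminated.\<close>
    define m where "m = Min ((\<lambda>b. subdegree (f b)) ` Z)"
    obtain b0 where b0: "b0 \<in> Z" "m = subdegree (f b0)"
      using Min_in[of "(\<lambda>b. subdegree (f b)) ` Z"] Z unfolding m_def by (metis empty_is_image finite_imageI imageE)
    have mle: "m \<le> subdegree (f b)" if "b \<in> Z" for b
      using that Z by (simp add: m_def)
    define g where "g b = fps_shift m (f b)" for b
    have g: "g b \<in> PS" if "b \<in> S" for b using that less.prems(3) by (auto simp: g_def)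
    have fg: "f b = fps_X ^ m * g b" if "b \<in> S" for b
    proof (cases "b \<in> Z")
      case True
      then show ?thesis using fps_shift_times_fps_X_power[OF mle[OF True]] by (simp add: g_def mult.commute)
    next
      case False
      then show ?thesis using that by (simp add: Z_def g_def)
    qed
    have g0: "g b0 $ 0 \<noteq> 0" and b0S: "b0 \<in> S" using b0 by (auto simp: g_def Z_def)
    have gB: "\<rho> (g b) \<otimes> \<sigma> b \<in> carrier T" "b \<in> B" "g b \<in> CT" if "b \<in> S" for b
      using that less.prems(2) g by (auto intro!: T.m_closed \<rho>_closed \<sigma>_closed PS_CT)
    define w where "w = (\<Oplus>b\<in>S. \<rho> (g b) \<otimes> \<sigma> b)"
    have wc: "w \<in> carrier T" unfolding w_def using gB by (intro T.finsum_closed) auto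
    have Xm: "\<rho> fps_X [^] k \<in> carrier T" for k :: nat using \<rho>X_closed by simp
    have dw: "d = \<rho> fps_X [^] m \<otimes> w"
    proof -
      have "d = (\<Oplus>b\<in>S. \<rho> fps_X [^] m \<otimes> (\<rho> (g b) \<otimes> \<sigma> b))"
        unfolding less.prems(4)
      proof (rule T.finsum_cong')
        fix b assume b: "b \<in> S"
        then have "\<rho> (f b) = \<rho> fps_X [^] m \<otimes> \<rho> (g b)"
          using gB[OF b] CT_X CT_power[OF CT_X, of m] by (simp add: fg \<rho>_mult \<rho>_power)
        then show "\<rho> (f b) \<otimes> \<sigma> b = \<rho> fps_X [^] m \<otimes> (\<rho> (g b) \<otimes> \<sigma> b)"
          using gB[OF b] Xm by (simp add: T.m_assoc \<rho>_closed \<sigma>_closed)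
      qed (use gB Xm in auto)
      then show ?thesis unfolding w_def using gB Xm less.prems(1) by (subst T.finsum_rdistr) auto
    qed
    have wD: "w \<in> span PS"
    proof -
      have "(\<Oplus>b\<in>S'. \<rho> (g b) \<otimes> \<sigma> b) \<in> span PS" if "S' \<subseteq> S" for S'
        using finite_subset[OF that less.prems(1)] that
      proof (induction S' rule: finite_induct)
        case (insert b S')
        then show ?case using gB g
          by (subst T.finsum_insert) (auto intro!: span_add span_incl)
      qed (simp add: span_0)
      then show ?thesis by (simp add: w_def)
    qed
    have res_w: "res w = (\<Sum>b\<in>S. to_ac (g b $ 0) * b)"
    proof -
      have "res (\<Oplus>b\<in>S'. \<rho> (g b) \<otimes> \<sigma> b) = (\<Sum>b\<in>S'. to_ac (g b $ 0) * b)" if "S' \<subseteq> S" for S'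
        using finite_subset[OF that less.prems(1)] that
      proof (induction S' rule: finite_induct)
        case (insert b S')
        have "(\<Oplus>b\<in>S'. \<rho> (g b) \<otimes> \<sigma> b) \<in> carrier T"
          using insert gB by (intro T.finsum_closed) auto
        then show ?case using insert gB
          by (subst T.finsum_insert) (auto simp: res_add res_\<rho>\<sigma>)
      qed (simp add: res_0)
      then show ?thesis by (simp add: w_def)
    qed
    show ?thesis
    proof (cases "res w = 0")
      case False
      then show ?thesis using unit_in_span_PS[OF wD] wD dw by blast
    next
      case True
      define S' where "S' = S - {b0}"
      have S: "S = insert b0 S'" "b0 \<notin> S'" "finite S'" "S' \<subseteq> S" using b0S less.prems(1) by (auto simp: S'_def)
      define k where "k b = - (g b $ 0) / (g b0 $ 0)" for b
      have k: "k b \<in> K" if "b \<in> S" for b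
        using g[OF that] g[OF b0S] by (auto simp: k_def PS_def)
      have "to_ac (g b0 $ 0) * b0 = - (\<Sum>b\<in>S'. to_ac (g b $ 0) * b)"
        using True S unfolding res_w by (simp add: eq_neg_iff_add_eq_0)
      then have "b0 = - (\<Sum>b\<in>S'. to_ac (g b $ 0) * b) / to_ac (g b0 $ 0)"
        using g0 by (simp add: field_simps)
      then have b0_eq: "b0 = (\<Sum>b\<in>S'. to_ac (k b) * b)"
        by (simp add: k_def sum_divide_distrib flip: sum_negf)
      have kb: "to_ac (k b) * b \<in> B" if "b \<in> S'" for b
        using that S k to_ac_B gB(2) by (intro B.K_mult) auto
      \<comment> \<open>The coefficient of b0 is distributed over the remaining scalars; factors
        from K move across the tensor sign.\<close>
      define h where "h b = g b + g b0 * fps_const (k b)" for b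
      have h: "h b \<in> PS" if "b \<in> S'" for b
        using that S g[of b] g[OF b0S] k[of b] by (auto simp: h_def)
      have "\<rho> (g b0) \<otimes> \<sigma> b0 = \<rho> (g b0) \<otimes> (\<Oplus>b\<in>S'. \<sigma> (to_ac (k b) * b))"
        using \<sigma>_sum[of S' "\<lambda>b. to_ac (k b) * b"] S(3) kb by (simp flip: b0_eq)
      also have "\<dots> = (\<Oplus>b\<in>S'. \<rho> (g b0) \<otimes> \<sigma> (to_ac (k b) * b))"
        using S kb gB(3)[OF b0S] by (intro T.finsum_rdistr) (auto intro!: \<rho>_closed \<sigma>_closed)
      also have "\<dots> = (\<Oplus>b\<in>S'. \<rho> (g b0 * fps_const (k b)) \<otimes> \<sigma> b)"
      proof (rule T.finsum_cong')
        fix b assume b: "b \<in> S'"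
        then have "b \<in> S" "k b \<in> K" using S k by auto
        then show "\<rho> (g b0) \<otimes> \<sigma> (to_ac (k b) * b) = \<rho> (g b0 * fps_const (k b)) \<otimes> \<sigma> b"
          using gB[of b] gB(3)[OF b0S]
          by (simp add: \<sigma>_mult to_ac_B \<rho>_mult CT_const \<rho>_const \<rho>_closed \<sigma>_closed T.m_assoc)
      next
        show "(\<lambda>b. \<rho> (g b0 * fps_const (k b)) \<otimes> \<sigma> b) \<in> S' \<rightarrow> carrier T"
          using S k gB gB(3)[OF b0S] by (auto intro!: T.m_closed \<rho>_closed \<sigma>_closed CT_mult CT_const)
      qed simp
      finally have e0: "\<rho> (g b0) \<otimes> \<sigma> b0 = (\<Oplus>b\<in>S'. \<rho> (g b0 * fps_const (k b)) \<otimes> \<sigma> b)" .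
      have "w = \<rho> (g b0) \<otimes> \<sigma> b0 \<oplus> (\<Oplus>b\<in>S'. \<rho> (g b) \<otimes> \<sigma> b)"
        unfolding w_def S(1) using S gB b0S by (intro T.finsum_insert) auto
      also have "\<dots> = (\<Oplus>b\<in>S'. \<rho> (g b0 * fps_const (k b)) \<otimes> \<sigma> b \<oplus> \<rho> (g b) \<otimes> \<sigma> b)"
        unfolding e0 using S gB k gB(3)[OF b0S]
        by (intro T.finsum_addf[symmetric]) (auto intro!: T.m_closed \<rho>_closed \<sigma>_closed CT_mult CT_const)
      also have "\<dots> = (\<Oplus>b\<in>S'. \<rho> (h b) \<otimes> \<sigma> b)"
      proof (rule T.finsum_cong')
        fix b assume b: "b \<in> S'"
        then have "b \<in> S" "k b \<in> K" using S k by auto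
        then show "\<rho> (g b0 * fps_const (k b)) \<otimes> \<sigma> b \<oplus> \<rho> (g b) \<otimes> \<sigma> b = \<rho> (h b) \<otimes> \<sigma> b"
          using gB[of b] gB(3)[OF b0S] CT_mult[OF gB(3)[OF b0S] CT_const[of "k b"]]
          by (simp add: h_def \<rho>_add T.l_distr \<rho>_closed \<sigma>_closed T.a_comm)
      next
        show "(\<lambda>b. \<rho> (h b) \<otimes> \<sigma> b) \<in> S' \<rightarrow> carrier T"
          using S h gB by (auto intro!: T.m_closed \<rho>_closed \<sigma>_closed PS_CT)
      qed simp
      finally have w: "w = (\<Oplus>b\<in>S'. \<rho> (h b) \<otimes> \<sigma> b)" .
      have "w = \<zero> \<or> (\<exists>m::nat. \<exists>v\<in>span PS. \<exists>w'\<in>span PS. v \<otimes> w' = \<one> \<and> w = \<rho> fps_X [^] m \<otimes> v)"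
        by (rule less.hyps[OF _ S(3) _ h w]) (use S less.prems(2) in auto)
      then show ?thesis
      proof
        assume "w = \<zero>"
        then show ?thesis using dw Xm by simp
      next
        assume "\<exists>m::nat. \<exists>v\<in>span PS. \<exists>w'\<in>span PS. v \<otimes> w' = \<one> \<and> w = \<rho> fps_X [^] m \<otimes> v"
        then obtain n v w' where v: "v \<in> span PS" "w' \<in> span PS" "v \<otimes> w' = \<one>" "w = \<rho> fps_X [^] (n::nat) \<otimes> v"
          by blast
        have "v \<in> carrier T" using v span_closed[OF PS_subset] by auto
        then have "d = \<rho> fps_X [^] (m + n) \<otimes> v"
          unfolding dw v(4) using Xm \<rho>X_closed by (simp add: T.m_assoc flip: T.nat_pow_mult)
        then show ?thesis using v by blast
      qed
    qed
  qed
qed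

text \<open>Nonzero members are powers of x times units of the subring, so one with least exponent
  divides all the others.\<close>

lemma span_PS_chain:
  assumes A: "A \<subseteq> span PS" "A \<noteq> {}"
  shows "\<exists>g\<in>A. \<forall>y\<in>A. \<exists>c\<in>span PS. y = c \<otimes> g"
proof (cases "A \<subseteq> {\<zero>}")
  case True
  then have "A = {\<zero>}" using A by auto
  then show ?thesis using span_0 by (auto intro!: bexI[of _ \<zero>])
next
  case False
  have pu: "\<exists>m::nat. \<exists>v\<in>span PS. \<exists>w\<in>span PS. v \<otimes> w = \<one> \<and> d = \<rho> fps_X [^] m \<otimes> v"
    if "d \<in> A" "d \<noteq> \<zero>" for d
  proof -
    have "d \<in> span PS" using that A by auto
    from span_PS_form[OF this] obtain S f where S: "finite S" "S \<subseteq> B" "\<And>b. f b \<in> PS"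
      "d = (\<Oplus>b\<in>S. \<rho> (f b) \<otimes> \<sigma> b)" by blast
    show ?thesis using span_PS_power_unit_aux[OF S(1,2,3,4)] that(2) by blast
  qed
  have cl: "x \<in> carrier T" if "x \<in> span PS" for x using that span_closed[OF PS_subset] by auto
  define Q where "Q m \<longleftrightarrow> (\<exists>d\<in>A. \<exists>v\<in>span PS. \<exists>w\<in>span PS. v \<otimes> w = \<one> \<and> d = \<rho> fps_X [^] m \<otimes> v)" for m :: nat
  have "\<exists>m. Q m" using False pu unfolding Q_def by blast
  then have "Q (LEAST m. Q m)" by (rule LeastI_ex)
  then obtain g v w where g: "g \<in> A" "v \<in> span PS" "w \<in> span PS" "v \<otimes> w = \<one>" "g = \<rho> fps_X [^] (LEAST m. Q m) \<otimes> v"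
    unfolding Q_def by blast
  have "\<exists>c\<in>span PS. y = c \<otimes> g" if y: "y \<in> A" for y
  proof (cases "y = \<zero>")
    case True
    then show ?thesis using span_0 cl g A by (intro bexI[of _ \<zero>]) auto
  next
    case False
    then obtain m v' w' where v': "v' \<in> span PS" "w' \<in> span PS" "v' \<otimes> w' = \<one>" "y = \<rho> fps_X [^] (m::nat) \<otimes> v'"
      using pu[OF y] by blast
    then have "Q m" using y unfolding Q_def by blast
    then have le: "(LEAST m. Q m) \<le> m" by (rule Least_le)
    define n where "n = (LEAST m. Q m)"
    let ?c = "\<rho> fps_X [^] (m - n) \<otimes> (v' \<otimes> w)"
    have Xk: "\<rho> fps_X [^] k \<in> span PS" for k :: nat
      using span_incl[of "fps_X ^ k" PS 1] CT_power[OF CT_X, of k]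
      by (simp add: PS_power \<sigma>_1 \<rho>_closed \<rho>_power)
    have "?c \<in> span PS"
      using g v' Xk by (intro span_mult[OF _ _ PS_subset PS_mult]) auto
    moreover have "?c \<otimes> g = \<rho> fps_X [^] (m - n) \<otimes> \<rho> fps_X [^] n \<otimes> v' \<otimes> (v \<otimes> w)"
      unfolding g(5) n_def[symmetric] using cl g(2,3) v'(1) \<rho>X_closed by (simp add: T.m_ac)
    then have "?c \<otimes> g = y"
      using g(4) v' cl[OF v'(1)] \<rho>X_closed le by (simp add: T.nat_pow_mult n_def)
    ultimately show ?thesis by metis
  qed
  then show ?thesis using g(1) by blast
qed

text \<open>The generators are 1 and the products x u_j, for a spanning family u_j of L over K: the
  constant term of r lies in K already, and the higher coefficients are expanded in the u_j. The u_j
  themselves need not lie in R.\<close>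

lemma finite_over_span_PS:
  "\<exists>n e. (\<forall>i. e i \<in> carrier T) \<and>
    (\<forall>t\<in>carrier T. \<exists>c\<in>{..<n::nat} \<rightarrow> span PS. t = (\<Oplus>i\<in>{..<n}. c i \<otimes> e i))"
proof -
  obtain n u where u: "\<And>v. \<exists>c. (\<forall>i<n. c i \<in> K) \<and> v = (\<Sum>i<(n::nat). c i * u i)"
    using finite_extension by blast
  define e where "e i = (case i of 0 \<Rightarrow> \<one> | Suc j \<Rightarrow> \<rho> (fps_X * fps_const (u j)))" for i
  have e: "e i \<in> carrier T" for i by (auto simp: e_def \<rho>_closed split: nat.split)
  have cl: "x \<in> carrier T" if "x \<in> span PS" for x using that span_closed[OF PS_subset] by auto
  have "\<exists>c\<in>{..<Suc n} \<rightarrow> span PS. t = (\<Oplus>i\<in>{..<Suc n}. c i \<otimes> e i)" if "t \<in> span CT" for t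
    using that subset_refl
  proof (induction rule: span_induct)
    case zero
    then show ?case using e span_0
      by (intro bexI[of _ "\<lambda>_. \<zero>"] sym[OF T.add.finprod_one_eqI]) auto
  next
    case (pure r b)
    obtain c where c: "\<And>v i. i < n \<Longrightarrow> c v i \<in> K" "\<And>v. v = (\<Sum>i<n. c v i * u i)"
      using u by metis
    \<comment> \<open>The i-th coordinates of all coefficients past the constant one; the shift of
      the index accounts for the factor x in the generator.\<close>
    define h where "h i = Abs_fps (\<lambda>k. c (r $ Suc k) i)" for i
    have h: "h i \<in> PS" if "i < n" for i using that c by (simp add: h_def PS_def)
    define k where "k i = (case i of 0 \<Rightarrow> fps_const (r $ 0) | Suc j \<Rightarrow> h j)" for i
    define z where "z i = (case i of 0 \<Rightarrow> 1 | Suc j \<Rightarrow> fps_X * fps_const (u j))" for i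
    have k: "k i \<in> PS" if "i < Suc n" for i
      using that h pure by (auto simp: k_def CT_def split: nat.split)
    have z: "z i \<in> CT" "\<rho> (z i) = e i" for i by (auto simp: z_def e_def \<rho>_1 split: nat.split)
    have "(\<Sum>i<Suc n. k i * z i) = fps_const (r $ 0) + (\<Sum>i<n. h i * (fps_X * fps_const (u i)))"
      by (simp add: sum.lessThan_Suc_shift k_def z_def del: sum.lessThan_Suc)
    also have "\<dots> = r"
    proof (rule fps_ext)
      fix m
      show "(fps_const (r $ 0) + (\<Sum>i<n. h i * (fps_X * fps_const (u i)))) $ m = r $ m"
      proof (cases m)
        case 0
        then show ?thesis by (simp add: fps_sum_nth)
      next
        case (Suc j)
        have "(h i * (fps_X * fps_const (u i))) $ Suc j = c (r $ Suc j) i * u i" for i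
          by (simp add: h_def mult.assoc[symmetric] mult.commute[of _ fps_X] fps_X_mult_nth)
        then show ?thesis using c(2)[of "r $ Suc j"] Suc by (simp add: fps_sum_nth)
      qed
    qed
    finally have r: "r = (\<Sum>i<Suc n. k i * z i)" by simp
    have kz: "k i * z i \<in> CT" if "i < Suc n" for i using k[OF that] z by (auto intro: PS_CT)
    have "\<rho> r = (\<Oplus>i\<in>{..<Suc n}. \<rho> (k i * z i))"
      unfolding r by (rule \<rho>_sum) (use kz in auto)
    then have "\<rho> r \<otimes> \<sigma> b = (\<Oplus>i\<in>{..<Suc n}. \<rho> (k i * z i) \<otimes> \<sigma> b)"
      using kz pure by (simp only:) (subst T.finsum_ldistr, auto intro!: \<rho>_closed \<sigma>_closed)
    also have "\<dots> = (\<Oplus>i\<in>{..<Suc n}. (\<rho> (k i) \<otimes> \<sigma> b) \<otimes> e i)"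
    proof (rule T.finsum_cong')
      fix i assume "i \<in> {..<Suc n}"
      then have "k i \<in> CT" using k PS_CT by auto
      then show "\<rho> (k i * z i) \<otimes> \<sigma> b = (\<rho> (k i) \<otimes> \<sigma> b) \<otimes> e i"
        using z(1)[of i] pure e[of i] by (simp add: \<rho>_mult \<rho>_closed \<sigma>_closed T.m_ac flip: z(2))
    next
      show "(\<lambda>i. \<rho> (k i) \<otimes> \<sigma> b \<otimes> e i) \<in> {..<Suc n} \<rightarrow> carrier T"
        using k e pure by (auto intro!: T.m_closed \<rho>_closed \<sigma>_closed PS_CT)
    qed simp
    finally show ?case using k pure
      by (intro bexI[of _ "\<lambda>i. \<rho> (k i) \<otimes> \<sigma> b"]) (auto intro!: span_incl)
  next
    case (add x y)
    then obtain c d where c: "c \<in> {..<Suc n} \<rightarrow> span PS" "x = (\<Oplus>i\<in>{..<Suc n}. c i \<otimes> e i)"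
      and d: "d \<in> {..<Suc n} \<rightarrow> span PS" "y = (\<Oplus>i\<in>{..<Suc n}. d i \<otimes> e i)" by blast
    have cd: "c i \<in> carrier T" "d i \<in> carrier T" if "i < Suc n" for i
      using that c(1) d(1) cl by (auto simp: Pi_iff)
    have "x \<oplus> y = (\<Oplus>i\<in>{..<Suc n}. c i \<otimes> e i \<oplus> d i \<otimes> e i)"
      unfolding c(2) d(2) using cd e by (intro T.finsum_addf[symmetric]) auto
    also have "\<dots> = (\<Oplus>i\<in>{..<Suc n}. (c i \<oplus> d i) \<otimes> e i)"
      using cd e by (intro T.finsum_cong') (auto simp: T.l_distr)
    finally show ?case using c(1) d(1)
      by (intro bexI[of _ "\<lambda>i. c i \<oplus> d i"]) (auto simp: Pi_iff intro!: span_add)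
  qed
  then show ?thesis using e unfolding span_CT by blast
qed

lemma noetherian: "noetherian_ring T"
proof -
  obtain n e where e: "\<And>i. e i \<in> carrier T"
    "\<And>t. t \<in> carrier T \<Longrightarrow> \<exists>c\<in>{..<n::nat} \<rightarrow> span PS. t = (\<Oplus>i\<in>{..<n}. c i \<otimes> e i)"
    using finite_over_span_PS by blast
  show ?thesis
  proof (rule T.noetherian_if_finite_over_chain_ring[where D = "span PS"])
    show "a \<otimes> b \<in> span PS" if "a \<in> span PS" "b \<in> span PS" for a b
      using span_mult[OF that PS_subset PS_mult] .
    show "\<ominus> a \<in> span PS" if "a \<in> span PS" for a
      using span_uminus[OF that PS_subset] .
  qed (use span_closed[OF PS_subset] span_0 span_add span_PS_chain e in \<open>simp_all\<close>)
qed

lemma noetherian_local: "noetherian_local_ring T"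
  using noetherian ex1_maximal T.cring_axioms by (simp add: noetherian_local_ring_def)

end


section \<open>Tensor products\<close>

lemmas frag_induct = frag_induction[OF subset_UNIV, case_names zero one diff]

lemma frag_extend_pointwise_diff:
  "frag_extend (\<lambda>k. f k - g k) c = frag_extend f c - frag_extend g c"
  by (induction c rule: frag_induct) (auto simp: frag_extend_diff)

text \<open>The additive extension of \<Psi> to formal integer combinations, with values in a ring,
  where \<open>frag_extend\<close> would have values in another free group.\<close>

definition frag_eval :: "('k \<Rightarrow> 'v::comm_ring_1) \<Rightarrow> ('k \<Rightarrow>\<^sub>0 int) \<Rightarrow> 'v" where
  "frag_eval \<Psi> c = (\<Sum>k\<in>Poly_Mapping.keys c. of_int (Poly_Mapping.lookup c k) * \<Psi> k)"

lemma frag_eval_superset: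
  "finite S \<Longrightarrow> Poly_Mapping.keys c \<subseteq> S \<Longrightarrow>
    frag_eval \<Psi> c = (\<Sum>k\<in>S. of_int (Poly_Mapping.lookup c k) * \<Psi> k)"
  unfolding frag_eval_def by (rule sum.mono_neutral_left) (auto simp: in_keys_iff)

lemma frag_eval_diff: "frag_eval \<Psi> (c - d) = frag_eval \<Psi> c - frag_eval \<Psi> d"
proof -
  let ?S = "Poly_Mapping.keys c \<union> Poly_Mapping.keys d"
  have S: "finite ?S" "Poly_Mapping.keys (c - d) \<subseteq> ?S" using keys_diff[of c d] by auto
  show ?thesis
    using S(1) by (simp add: frag_eval_superset[OF S] frag_eval_superset[of ?S c] frag_eval_superset[of ?S d]
      lookup_minus left_diff_distrib sum_subtractf)
qed

lemma frag_eval_0 [simp]: "frag_eval \<Psi> 0 = 0"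
  by (simp add: frag_eval_def)

lemma frag_eval_of [simp]: "frag_eval \<Psi> (frag_of k) = \<Psi> k"
  by (simp add: frag_eval_def)

lemma frag_eval_uminus: "frag_eval \<Psi> (- c) = - frag_eval \<Psi> c"
  using frag_eval_diff[of \<Psi> 0 c] by simp

lemma frag_eval_add: "frag_eval \<Psi> (c + d) = frag_eval \<Psi> c + frag_eval \<Psi> d"
  using frag_eval_diff[of \<Psi> c "- d"] by (simp add: frag_eval_uminus)

locale tensor_algebras = A: cring A + B: cring B
  for A :: "('a, 'm) ring_scheme" and B :: "('b, 'n) ring_scheme" +
  fixes K :: "'k set" and f :: "'k \<Rightarrow> 'a" and g :: "'k \<Rightarrow> 'b"
  assumes f_closed: "c \<in> K \<Longrightarrow> f c \<in> carrier A" and g_closed: "c \<in> K \<Longrightarrow> g c \<in> carrier B"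
begin

abbreviation "F \<equiv> free_tensor_ring A B"

definition op :: "'a \<times> 'b \<Rightarrow> 'a \<times> 'b \<Rightarrow> 'a \<times> 'b" where
  "op k l = (fst k \<otimes>\<^bsub>A\<^esub> fst l, snd k \<otimes>\<^bsub>B\<^esub> snd l)"

abbreviation "S \<equiv> carrier A \<times> carrier B"

lemma carrier_F: "carrier F = {c. Poly_Mapping.keys c \<subseteq> S}"
  by (simp add: free_tensor_ring_def free_Abelian_group_def)

lemma F_simps [simp]: "x \<oplus>\<^bsub>F\<^esub> y = x + y" "\<zero>\<^bsub>F\<^esub> = 0" "\<one>\<^bsub>F\<^esub> = frag_of (\<one>\<^bsub>A\<^esub>, \<one>\<^bsub>B\<^esub>)"
  by (simp_all add: free_tensor_ring_def)

abbreviation F_times (infixl "\<star>" 70) where "c \<star> d \<equiv> c \<otimes>\<^bsub>F\<^esub> d"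

text \<open>The double sum is the biadditive extension of \<open>op\<close>, so the ring laws can be
  checked on basis elements, by induction on each argument.\<close>

lemma F_mult: "c \<star> d = frag_extend (\<lambda>k. frag_extend (\<lambda>l. frag_of (op k l)) d) c"
proof -
  have s: "Poly_Mapping.single k (m * n) = frag_cmul m (frag_cmul n (frag_of k))" for k :: "'a \<times> 'b" and m n
    by (rule poly_mapping_eqI) (simp add: lookup_single when_def)
  show ?thesis
    by (simp add: free_tensor_ring_def frag_extend_def frag_cmul_sum op_def s case_prod_unfold)
qed

lemma F_mult_of [simp]: "frag_of k \<star> frag_of l = frag_of (op k l)"
  by (simp add: F_mult)

lemma F_mult_diff: "(c - c') \<star> d = c \<star> d - c' \<star> d" "c \<star> (d - d') = c \<star> d - c \<star> d'"
  by (simp_all add: F_mult frag_extend_diff frag_extend_pointwise_diff)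

lemma F_mult_0 [simp]: "0 \<star> d = 0" "c \<star> 0 = 0"
  using F_mult_diff(1)[of c c d] F_mult_diff(2)[of c d d] by simp_all

lemma F_mult_minus: "(- c) \<star> d = - (c \<star> d)"
  using F_mult_diff(1)[of 0 c d] by simp

lemma F_mult_add: "(c + c') \<star> d = c \<star> d + c' \<star> d"
  using F_mult_diff(1)[of c "- c'" d] by (simp add: F_mult_minus)

lemma keys_diff_subset: "Poly_Mapping.keys c \<subseteq> S \<Longrightarrow> Poly_Mapping.keys d \<subseteq> S \<Longrightarrow> Poly_Mapping.keys (c - d) \<subseteq> S"
  using keys_diff[of c d] by blast

lemma op_closed: "k \<in> S \<Longrightarrow> l \<in> S \<Longrightarrow> op k l \<in> S"
  by (auto simp: op_def)

lemma F_mult_closed: "c \<in> carrier F \<Longrightarrow> d \<in> carrier F \<Longrightarrow> c \<star> d \<in> carrier F"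
  unfolding carrier_F mem_Collect_eq
proof (induction c rule: frag_induction)
  case (one k)
  from one(2,1) show ?case
  proof (induction d rule: frag_induction)
    case (one l)
    then show ?case using op_closed[of k l] by simp
  qed (simp_all add: F_mult_diff keys_diff_subset)
qed (simp_all add: F_mult_diff keys_diff_subset)

lemma F_mult_comm: "c \<in> carrier F \<Longrightarrow> d \<in> carrier F \<Longrightarrow> c \<star> d = d \<star> c"
  unfolding carrier_F mem_Collect_eq
proof (induction c rule: frag_induction)
  case (one k)
  from one(2,1) show ?case
  proof (induction d rule: frag_induction)
    case (one l)
    then show ?case by (auto simp: op_def A.m_comm B.m_comm)
  qed (simp_all add: F_mult_diff)
qed (simp_all add: F_mult_diff)

lemma F_mult_assoc:
  "c \<in> carrier F \<Longrightarrow> d \<in> carrier F \<Longrightarrow> e \<in> carrier F \<Longrightarrow> (c \<star> d) \<star> e = c \<star> (d \<star> e)"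
  unfolding carrier_F mem_Collect_eq
proof (induction c rule: frag_induction)
  case (one k)
  from one(2,1,3) show ?case
  proof (induction d rule: frag_induction)
    case (one l)
    from one(3,1,2) show ?case
    proof (induction e rule: frag_induction)
      case (one m)
      then show ?case by (auto simp: op_def A.m_assoc B.m_assoc)
    qed (simp_all add: F_mult_diff)
  qed (simp_all add: F_mult_diff)
qed (simp_all add: F_mult_diff)

lemma F_mult_one: "c \<in> carrier F \<Longrightarrow> \<one>\<^bsub>F\<^esub> \<star> c = c"
  unfolding carrier_F mem_Collect_eq
  by (induction c rule: frag_induction) (auto simp: F_mult_diff op_def)

lemma F_cring: "cring F"
proof (rule cringI)
  show "abelian_group F"
  proof (rule abelian_groupI)
    show "\<exists>y\<in>carrier F. y \<oplus>\<^bsub>F\<^esub> x = \<zero>\<^bsub>F\<^esub>" if "x \<in> carrier F" for x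
      using that by (intro bexI[of _ "- x"]) (auto simp: carrier_F)
    show "x \<oplus>\<^bsub>F\<^esub> y \<in> carrier F" if "x \<in> carrier F" "y \<in> carrier F" for x y
      using that Poly_Mapping.keys_add[of x y] by (auto simp: carrier_F)
  qed (auto simp: carrier_F add_ac)
  show "comm_monoid F"
    by (rule comm_monoidI) (use F_mult_closed F_mult_comm F_mult_assoc F_mult_one in \<open>auto simp: carrier_F\<close>)
  show "(x \<oplus>\<^bsub>F\<^esub> y) \<star> z = x \<star> z \<oplus>\<^bsub>F\<^esub> y \<star> z" for x y z
    by (simp add: F_mult_add)
qed

interpretation F: cring F by (rule F_cring)

lemma F_of_closed [simp]: "k \<in> S \<Longrightarrow> frag_of k \<in> carrier F"
  by (auto simp: carrier_F)

lemma F_minus: "c \<in> carrier F \<Longrightarrow> d \<in> carrier F \<Longrightarrow> c \<ominus>\<^bsub>F\<^esub> d = c - d"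
proof -
  assume c: "c \<in> carrier F" and d: "d \<in> carrier F"
  then have "\<ominus>\<^bsub>F\<^esub> d = - d"
    by (intro F.minus_equality) (auto simp: carrier_F)
  then show ?thesis by (simp add: F.minus_eq)
qed

section \<open>Balanced maps and the tensor product as a quotient\<close>

definition balanced :: "('a \<times> 'b \<Rightarrow> 'v::comm_ring_1) \<Rightarrow> bool" where
  "balanced \<Psi> \<longleftrightarrow>
    (\<forall>a\<in>carrier A. \<forall>a'\<in>carrier A. \<forall>b\<in>carrier B. \<Psi> (a \<oplus>\<^bsub>A\<^esub> a', b) = \<Psi> (a, b) + \<Psi> (a', b)) \<and>
    (\<forall>a\<in>carrier A. \<forall>b\<in>carrier B. \<forall>b'\<in>carrier B. \<Psi> (a, b \<oplus>\<^bsub>B\<^esub> b') = \<Psi> (a, b) + \<Psi> (a, b')) \<and>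
    (\<forall>c\<in>K. \<forall>a\<in>carrier A. \<forall>b\<in>carrier B. \<Psi> (f c \<otimes>\<^bsub>A\<^esub> a, b) = \<Psi> (a, g c \<otimes>\<^bsub>B\<^esub> b))"

abbreviation "Rel \<equiv> tensor_relations K f A g B"
abbreviation "I \<equiv> Idl\<^bsub>F\<^esub> Rel"
abbreviation "T \<equiv> tensor_ring K f A g B"

lemma Rel_closed: "Rel \<subseteq> carrier F"
proof -
  have "frag_of (a, b) - frag_of (a', b') - frag_of (a'', b'') \<in> carrier F"
      "frag_of (a, b) - frag_of (a', b') \<in> carrier F"
    if "a \<in> carrier A" "b \<in> carrier B" "a' \<in> carrier A" "b' \<in> carrier B" "a'' \<in> carrier A" "b'' \<in> carrier B"
    for a b a' b' a'' b''
    using that unfolding carrier_F mem_Collect_eq by (intro conjI keys_diff_subset; simp)+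
  then show ?thesis by (auto simp: tensor_relations_def f_closed g_closed)
qed

lemma I_ideal: "ideal I F"
  by (rule F.genideal_ideal[OF Rel_closed])

text \<open>The elements annihilated by every balanced map form an ideal, because translating a
  balanced map by a pure tensor gives a balanced map again.\<close>

lemma balanced_vanishes_on_I:
  fixes \<Psi> :: "'a \<times> 'b \<Rightarrow> 'v::comm_ring_1"
  assumes "balanced \<Psi>" "c \<in> I"
  shows "frag_eval \<Psi> c = 0"
proof -
  define J where "J = {c \<in> carrier F. \<forall>\<Psi> :: 'a \<times> 'b \<Rightarrow> 'v. balanced \<Psi> \<longrightarrow> frag_eval \<Psi> c = 0}"
  have JF: "J \<subseteq> carrier F" by (auto simp: J_def)
  have J_diff: "c - d \<in> J" if "c \<in> J" "d \<in> J" for c d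
    using that keys_diff_subset by (auto simp: J_def carrier_F frag_eval_diff)
  have J0: "0 \<in> J" by (auto simp: J_def carrier_F)
  have J_mult: "x \<star> c \<in> J" if x: "x \<in> carrier F" and c: "c \<in> J" for x c
    using x unfolding carrier_F mem_Collect_eq
  proof (induction x rule: frag_induction)
    case (one k)
    have "frag_eval \<Psi> (frag_of k \<star> c) = 0" if bal: "balanced \<Psi>" for \<Psi> :: "'a \<times> 'b \<Rightarrow> 'v"
    proof -
      have "frag_eval \<Psi> (frag_of k \<star> c) = frag_eval (\<lambda>l. \<Psi> (op k l)) c"
        by (induction c rule: frag_induct) (auto simp: F_mult_diff frag_eval_diff)
      moreover have "balanced (\<lambda>l. \<Psi> (op k l))"
        unfolding balanced_def
      proof (intro conjI ballI)
        obtain a0 b0 where k: "k = (a0, b0)" "a0 \<in> carrier A" "b0 \<in> carrier B" using one by auto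
        fix c a b assume "c \<in> K" "a \<in> carrier A" "b \<in> carrier B"
        moreover from this have "a0 \<otimes>\<^bsub>A\<^esub> (f c \<otimes>\<^bsub>A\<^esub> a) = f c \<otimes>\<^bsub>A\<^esub> (a0 \<otimes>\<^bsub>A\<^esub> a)"
          "b0 \<otimes>\<^bsub>B\<^esub> (g c \<otimes>\<^bsub>B\<^esub> b) = g c \<otimes>\<^bsub>B\<^esub> (b0 \<otimes>\<^bsub>B\<^esub> b)"
          using k f_closed g_closed by (auto intro: A.m_lcomm B.m_lcomm)
        ultimately show "\<Psi> (op k (f c \<otimes>\<^bsub>A\<^esub> a, b)) = \<Psi> (op k (a, g c \<otimes>\<^bsub>B\<^esub> b))"
          using bal k by (simp add: op_def balanced_def)
      qed (use bal one in \<open>auto simp: op_def balanced_def A.r_distr B.r_distr\<close>)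
      ultimately show ?thesis using c by (simp add: J_def)
    qed
    then show ?case using F_mult_closed[of "frag_of k" c] one c JF by (auto simp: J_def)
  qed (auto simp: J0 F_mult_diff J_diff)
  have "ideal J F"
  proof (rule idealI)
    show "subgroup J (add_monoid F)"
    proof (rule F.add.subgroupI)
      show "\<ominus>\<^bsub>F\<^esub> c \<in> J" if "c \<in> J" for c
        using J_diff[OF J0 that] F_minus[of 0 c] that JF J0 by (auto simp: F.minus_eq subset_iff)
      show "c \<oplus>\<^bsub>F\<^esub> d \<in> J" if "c \<in> J" "d \<in> J" for c d
        using J_diff[OF that(1) J_diff[OF J0 that(2)]] by simp
    qed (use JF J0 in auto)
    show "x \<star> c \<in> J" "c \<star> x \<in> J" if "c \<in> J" "x \<in> carrier F" for c x
      using J_mult[OF that(2,1)] F_mult_comm[of c x] that JF by auto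
  qed (rule F.ring_axioms)
  moreover have "Rel \<subseteq> J"
  proof
    fix r assume r: "r \<in> Rel"
    have "frag_eval \<Psi> r = 0" if "balanced \<Psi>" for \<Psi> :: "'a \<times> 'b \<Rightarrow> 'v"
      using r that by (auto simp: tensor_relations_def frag_eval_diff balanced_def)
    then show "r \<in> J" using r Rel_closed by (auto simp: J_def)
  qed
  ultimately have "I \<subseteq> J" by (rule F.genideal_minimal)
  then show ?thesis using assms by (auto simp: J_def)
qed

definition \<pi> :: "('a \<times> 'b \<Rightarrow>\<^sub>0 int) \<Rightarrow> ('a \<times> 'b \<Rightarrow>\<^sub>0 int) set" where
  "\<pi> c = I +>\<^bsub>F\<^esub> c"

definition tl :: "'a \<Rightarrow> ('a \<times> 'b \<Rightarrow>\<^sub>0 int) set" where "tl a = \<pi> (frag_of (a, \<one>\<^bsub>B\<^esub>))"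

definition tr :: "'b \<Rightarrow> ('a \<times> 'b \<Rightarrow>\<^sub>0 int) set" where "tr b = \<pi> (frag_of (\<one>\<^bsub>A\<^esub>, b))"

lemma T_cring: "cring T"
  unfolding tensor_ring_def by (rule ideal.quotient_is_cring[OF I_ideal F_cring])

interpretation T: cring T by (rule T_cring)

lemma \<pi>_hom: "\<pi> \<in> ring_hom F T"
  using ideal.rcos_ring_hom[OF I_ideal] by (simp add: tensor_ring_def \<pi>_def[abs_def])

lemmas \<pi>_closed = ring_hom_closed[OF \<pi>_hom]
  and \<pi>_mult = ring_hom_mult[OF \<pi>_hom]
  and \<pi>_add = ring_hom_add[OF \<pi>_hom, simplified]
  and \<pi>_one = ring_hom_one[OF \<pi>_hom]

lemma carrier_T: "carrier T = \<pi> ` carrier F"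
  by (auto simp: tensor_ring_def FactRing_def A_RCOSETS_defs \<pi>_def a_r_coset_def r_coset_def)

lemma \<pi>_eq_iff: "c \<in> carrier F \<Longrightarrow> d \<in> carrier F \<Longrightarrow> \<pi> c = \<pi> d \<longleftrightarrow> c - d \<in> I"
  using F.quotient_eq_iff_same_a_r_cos[OF I_ideal] by (simp add: \<pi>_def F_minus)

lemma Rel_I: "r \<in> Rel \<Longrightarrow> r \<in> I"
  using F.genideal_self[OF Rel_closed] by auto

lemma \<pi>_of_add_left:
  assumes "a \<in> carrier A" "a' \<in> carrier A" "b \<in> carrier B"
  shows "\<pi> (frag_of (a \<oplus>\<^bsub>A\<^esub> a', b)) = \<pi> (frag_of (a, b)) \<oplus>\<^bsub>T\<^esub> \<pi> (frag_of (a', b))"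
proof -
  have "frag_of (a \<oplus>\<^bsub>A\<^esub> a', b) - (frag_of (a, b) + frag_of (a', b)) \<in> I"
    unfolding diff_diff_eq[symmetric] using assms by (intro Rel_I) (auto simp: tensor_relations_def)
  then have "\<pi> (frag_of (a \<oplus>\<^bsub>A\<^esub> a', b)) = \<pi> (frag_of (a, b) + frag_of (a', b))"
    using assms F.a_closed[of "frag_of (a, b)" "frag_of (a', b)"] by (subst \<pi>_eq_iff) auto
  then show ?thesis using assms by (simp add: \<pi>_add)
qed

lemma \<pi>_of_add_right:
  assumes "a \<in> carrier A" "b \<in> carrier B" "b' \<in> carrier B"
  shows "\<pi> (frag_of (a, b \<oplus>\<^bsub>B\<^esub> b')) = \<pi> (frag_of (a, b)) \<oplus>\<^bsub>T\<^esub> \<pi> (frag_of (a, b'))"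
proof -
  have "frag_of (a, b \<oplus>\<^bsub>B\<^esub> b') - (frag_of (a, b) + frag_of (a, b')) \<in> I"
    unfolding diff_diff_eq[symmetric] using assms by (intro Rel_I) (auto simp: tensor_relations_def)
  then have "\<pi> (frag_of (a, b \<oplus>\<^bsub>B\<^esub> b')) = \<pi> (frag_of (a, b) + frag_of (a, b'))"
    using assms F.a_closed[of "frag_of (a, b)" "frag_of (a, b')"] by (subst \<pi>_eq_iff) auto
  then show ?thesis using assms by (simp add: \<pi>_add)
qed

lemma tl_tr:
  shows tl_closed: "a \<in> carrier A \<Longrightarrow> tl a \<in> carrier T"
    and tr_closed: "b \<in> carrier B \<Longrightarrow> tr b \<in> carrier T"
    and tl_add: "a \<in> carrier A \<Longrightarrow> a' \<in> carrier A \<Longrightarrow> tl (a \<oplus>\<^bsub>A\<^esub> a') = tl a \<oplus>\<^bsub>T\<^esub> tl a'"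
    and tr_add: "b \<in> carrier B \<Longrightarrow> b' \<in> carrier B \<Longrightarrow> tr (b \<oplus>\<^bsub>B\<^esub> b') = tr b \<oplus>\<^bsub>T\<^esub> tr b'"
    and tl_mult: "a \<in> carrier A \<Longrightarrow> a' \<in> carrier A \<Longrightarrow> tl (a \<otimes>\<^bsub>A\<^esub> a') = tl a \<otimes>\<^bsub>T\<^esub> tl a'"
    and tr_mult: "b \<in> carrier B \<Longrightarrow> b' \<in> carrier B \<Longrightarrow> tr (b \<otimes>\<^bsub>B\<^esub> b') = tr b \<otimes>\<^bsub>T\<^esub> tr b'"
    and tl_one: "tl \<one>\<^bsub>A\<^esub> = \<one>\<^bsub>T\<^esub>"
    and tr_one: "tr \<one>\<^bsub>B\<^esub> = \<one>\<^bsub>T\<^esub>"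
    and tl_mult_tr: "a \<in> carrier A \<Longrightarrow> b \<in> carrier B \<Longrightarrow> tl a \<otimes>\<^bsub>T\<^esub> tr b = \<pi> (frag_of (a, b))"
  using \<pi>_one by (simp_all add: tl_def tr_def \<pi>_closed \<pi>_of_add_left \<pi>_of_add_right op_def flip: \<pi>_mult)

lemma tl_eq_tr:
  assumes c: "c \<in> K" shows "tl (f c) = tr (g c)"
proof -
  have "frag_of (f c \<otimes>\<^bsub>A\<^esub> \<one>\<^bsub>A\<^esub>, \<one>\<^bsub>B\<^esub>) - frag_of (\<one>\<^bsub>A\<^esub>, g c \<otimes>\<^bsub>B\<^esub> \<one>\<^bsub>B\<^esub>) \<in> I"
    using c by (intro Rel_I) (auto simp: tensor_relations_def)
  then show ?thesis using c f_closed g_closed by (simp add: tl_def tr_def \<pi>_eq_iff)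
qed

lemma T_generated: "carrier T = generate (add_monoid T) {tl a \<otimes>\<^bsub>T\<^esub> tr b | a b. a \<in> carrier A \<and> b \<in> carrier B}"
  (is "_ = generate _ ?G")
proof
  have G: "?G \<subseteq> carrier (add_monoid T)" by (auto simp: tl_closed tr_closed)
  show "generate (add_monoid T) ?G \<subseteq> carrier T"
    using G by (intro T.add.generate_incl) simp
  have sub: "subgroup (generate (add_monoid T) ?G) (add_monoid T)"
    using G by (intro T.add.generate_is_subgroup) simp
  have "\<pi> c \<in> generate (add_monoid T) ?G" if "Poly_Mapping.keys c \<subseteq> S" for c
  proof -
    have "c \<in> carrier F \<and> \<pi> c \<in> generate (add_monoid T) ?G"
      using that
    proof (induction c rule: frag_induction)
      case zero
      have "\<pi> 0 = \<zero>\<^bsub>T\<^esub>"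
        using \<pi>_add[of 0 0] \<pi>_closed[of 0] by (simp add: carrier_F T.add.l_cancel_one)
      then show ?case using subgroup.one_closed[OF sub] by (simp add: carrier_F)
    next
      case (one k)
      then obtain a b where k: "k = (a, b)" "a \<in> carrier A" "b \<in> carrier B" by auto
      then have "\<pi> (frag_of k) = tl a \<otimes>\<^bsub>T\<^esub> tr b" by (simp add: tl_mult_tr)
      then show ?case using k by (auto intro!: generate.incl)
    next
      case (diff c d)
      have cd: "c - d \<in> carrier F" using diff keys_diff_subset by (auto simp: carrier_F)
      have "\<pi> c = \<pi> (c - d) \<oplus>\<^bsub>T\<^esub> \<pi> d"
        using \<pi>_add[OF cd, of d] diff by simp
      then have "\<pi> (c - d) = \<pi> c \<ominus>\<^bsub>T\<^esub> \<pi> d"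
        using diff cd by (simp add: T.minus_eq T.add.inv_solve_right \<pi>_closed)
      moreover have "\<pi> c \<ominus>\<^bsub>T\<^esub> \<pi> d \<in> generate (add_monoid T) ?G"
        using diff subgroup.m_closed[OF sub] subgroup.m_inv_closed[OF sub]
        by (simp add: T.minus_eq a_inv_def)
      ultimately show ?case using cd by simp
    qed
    then show ?thesis ..
  qed
  then show "carrier T \<subseteq> generate (add_monoid T) ?G" by (auto simp: carrier_T carrier_F)
qed

text \<open>A balanced map vanishes on the defining ideal, so its value does not depend on the
  representative picked by \<open>SOME\<close>.\<close>

lemma balanced_functional:
  fixes \<Psi> :: "'a \<times> 'b \<Rightarrow> 'v::comm_ring_1"
  assumes bal: "balanced \<Psi>"
  shows "\<exists>\<Phi>. (\<forall>a\<in>carrier A. \<forall>b\<in>carrier B. \<Phi> (tl a \<otimes>\<^bsub>T\<^esub> tr b) = \<Psi> (a, b)) \<and>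
     (\<forall>x\<in>carrier T. \<forall>y\<in>carrier T. \<Phi> (x \<oplus>\<^bsub>T\<^esub> y) = \<Phi> x + \<Phi> y)"
proof -
  define \<Phi> where "\<Phi> x = frag_eval \<Psi> (SOME c. c \<in> carrier F \<and> \<pi> c = x)" for x
  have \<Phi>: "\<Phi> (\<pi> c) = frag_eval \<Psi> c" if c: "c \<in> carrier F" for c
  proof -
    define d where "d = (SOME d. d \<in> carrier F \<and> \<pi> d = \<pi> c)"
    have "d \<in> carrier F \<and> \<pi> d = \<pi> c" unfolding d_def by (rule someI[of _ c]) (use c in simp)
    then have "frag_eval \<Psi> (d - c) = 0"
      using c \<pi>_eq_iff[of d c] by (intro balanced_vanishes_on_I[OF bal]) auto
    then show ?thesis by (simp add: \<Phi>_def d_def[symmetric] frag_eval_diff)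
  qed
  show ?thesis
  proof (intro exI[of _ \<Phi>] conjI ballI)
    show "\<Phi> (tl a \<otimes>\<^bsub>T\<^esub> tr b) = \<Psi> (a, b)" if "a \<in> carrier A" "b \<in> carrier B" for a b
      using that by (simp add: tl_mult_tr \<Phi>)
    show "\<Phi> (x \<oplus>\<^bsub>T\<^esub> y) = \<Phi> x + \<Phi> y" if "x \<in> carrier T" "y \<in> carrier T" for x y
    proof -
      obtain c d where "c \<in> carrier F" "x = \<pi> c" "d \<in> carrier F" "y = \<pi> d"
        using \<open>x \<in> carrier T\<close> \<open>y \<in> carrier T\<close> by (auto simp: carrier_T)
      moreover from this have "c + d \<in> carrier F" using F.a_closed[of c d] by simp
      ultimately show ?thesis by (simp add: \<Phi> frag_eval_add flip: \<pi>_add)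
    qed
  qed
qed

end


section \<open>Nilpotents and F-injectivity\<close>

context constant_term_base_change
begin

interpretation B: field_subset B by (rule field_subset.intro[OF B])

lemma ev_finsum:
  assumes lin: "linear_on_CT \<phi>" and "finite I" "\<And>i. i \<in> I \<Longrightarrow> x i \<in> carrier T"
  shows "ev \<phi> (\<Oplus>i\<in>I. x i) = (\<Sum>i\<in>I. ev \<phi> (x i))"
  using assms(2,3)
proof (induction I rule: finite_induct)
  case (insert i I)
  then have "(\<Oplus>i\<in>I. x i) \<in> carrier T" by (intro T.finsum_closed) auto
  then show ?case using insert by (subst T.finsum_insert) (auto simp: ev_add[OF lin])
qed (simp add: ev_0[OF lin])

text \<open>An extended functional is additive, so its vanishing can be checked on pure tensors,
  where r merges with the left factor.\<close>

lemma ev_eq_0: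
  assumes lin: "linear_on_CT \<phi>" and r: "r \<in> CT" and t: "t \<in> carrier T"
    and 0: "\<And>s. s \<in> CT \<Longrightarrow> \<phi> (r * s) = 0"
  shows "ev \<phi> (\<rho> r \<otimes> t) = 0"
  using t[folded span_CT] subset_refl
proof (induction rule: span_induct)
  case zero
  then show ?case using r by (simp add: \<rho>_closed ev_0[OF lin])
next
  case (pure s b)
  then have "\<rho> r \<otimes> (\<rho> s \<otimes> \<sigma> b) = \<rho> (r * s) \<otimes> \<sigma> b"
    using r by (simp add: \<rho>_mult \<rho>_closed \<sigma>_closed T.m_assoc)
  then show ?case using pure r 0 by (simp add: ev_pure[OF lin] CT_mult)
next
  case (add x y)
  then show ?case using r by (simp add: span_CT T.r_distr ev_add[OF lin] \<rho>_closed)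
qed

text \<open>Two facts are combined: since z^q = 0, every fraction z / y^n is killed by Frobenius,
  while z / y^(2q) does not come from T. The second also shows that z is nonzero, so T is not
  reduced.\<close>

lemma nilpotent_obstructs_F_injectivity:
  fixes \<mu> :: "'l \<Rightarrow> 'l" and a :: "nat \<Rightarrow> 'l" and \<beta> :: "nat \<Rightarrow> 'l alg_closure"
  assumes lam_add: "\<And>u v. \<mu> (u + v) = \<mu> u + \<mu> v" and lam_mult: "\<And>c v. c \<in> K \<Longrightarrow> \<mu> (c * v) = c * \<mu> v"
    and \<beta>: "\<And>i. \<beta> i \<in> B" and nz: "(\<Sum>i\<le>m. to_ac (\<mu> (a i)) * \<beta> i) \<noteq> 0"
    and z: "z = (\<Oplus>i\<in>{..m}. \<rho> (fps_const (a i) * fps_X) \<otimes> \<sigma> (\<beta> i))" and zq: "z [^] q = \<zero>"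
  shows "\<not> reduced_ring T" "\<not> F_injective q T"
proof -
  have tm: "\<rho> (fps_const (a i) * fps_X) \<otimes> \<sigma> (\<beta> i) \<in> carrier T" for i
    using \<beta> by (intro T.m_closed \<rho>_closed \<sigma>_closed) auto
  have zc: "z \<in> carrier T" unfolding z using tm by (intro T.finsum_closed) auto
  obtain y where y: "some_parameters T = [y]" "y \<in> mx" "y [^] q \<noteq> \<zero>" by (rule some_parameters)
  have yc: "y \<in> carrier T" using y by (simp add: mx_def)
  interpret C: cech_single_frobenius T y q
    by unfold_locales (use yc T_power_add q_pos in auto)
  obtain r where r: "r \<in> CT" "y [^] q = \<rho> r" "to_ac (r $ 0) = res y ^ q"
    using power_in_\<rho>_CT[OF yc] by metis
  have r0: "r $ 0 = 0" using r(3) y(2) q_pos by (simp add: mx_def zero_power)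
  have "r \<noteq> 0" using r y(3) by (auto simp: \<rho>_0)
  define k where "k = subdegree r"
  define u where "u = fps_shift k r"
  have u: "r = fps_X ^ k * u" "u $ 0 \<noteq> 0"
    using subdegree_decompose[of r] \<open>r \<noteq> 0\<close> by (simp_all add: u_def k_def mult.commute)
  have k: "k > 0" using r0 \<open>r \<noteq> 0\<close> by (auto simp: k_def subdegree_eq_0_iff intro: gr0I)
  have M: "y [^] (n::nat) \<in> C.M" for n by (auto simp: C.M_def)
  \<comment> \<open>Of the order k of y^q only k > 0 is known, while z has order 1 in x. The square
    of y^q has order 2k, which exceeds 1; this fixes the exponent 2q.\<close>
  define U where "U = fraction T C.M z (y [^] (q * 2))"
  have UL: "U \<in> carrier (localization T C.M)" unfolding U_def using zc M by (rule C.fraction_closed)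
  have U: "U \<notin> C.integral"
  proof
    assume "U \<in> C.integral"
    then obtain t where t: "t \<in> carrier T" "U = fraction T C.M t \<one>" by (auto simp: C.integral_def)
    then obtain N :: nat where "y [^] N \<otimes> (\<one> \<otimes> z) = y [^] N \<otimes> (y [^] (q * 2) \<otimes> t)"
      using C.fraction_eq_iff[OF zc M t(1) C.one_M, of "q * 2"] unfolding U_def by (auto simp: C.M_def)
    then have N: "y [^] N \<otimes> z = y [^] N \<otimes> (y [^] (q * 2) \<otimes> t)" using zc by simp
    have qN: "q * N = N * (q - 1) + N" using q_pos by (cases q) auto
    \<comment> \<open>Multiplying by y^(N(q-1)) turns both powers of y into powers of y^q, that is,
      into series to which coefficient functionals apply.\<close>
    have "\<rho> (r ^ N) \<otimes> z = y [^] (q * N) \<otimes> z"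
      using r yc by (simp add: \<rho>_power T.nat_pow_pow flip: r(2))
    also have "\<dots> = y [^] (N * (q - 1)) \<otimes> (y [^] N \<otimes> z)"
      unfolding qN using yc zc by (simp add: T.m_assoc flip: T.nat_pow_mult)
    also have "\<dots> = y [^] (q * N) \<otimes> (y [^] (q * 2) \<otimes> t)"
      unfolding N qN using yc t by (simp add: T.m_assoc flip: T.nat_pow_mult)
    also have "\<dots> = y [^] (q * (N + 2)) \<otimes> t"
      using yc t by (simp only: add_mult_distrib2 T.nat_pow_mult[symmetric] T.m_assoc T.nat_pow_closed)
    also have "\<dots> = \<rho> (r ^ (N + 2)) \<otimes> t"
      using \<rho>_power[OF r(1), of "N + 2"] T.nat_pow_pow[OF yc, of q "N + 2"] by (simp only: r(2))
    finally have eq: "\<rho> (r ^ N) \<otimes> z = \<rho> (r ^ (N + 2)) \<otimes> t" .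
    \<comment> \<open>The factor v cancels the unit part of r^N, so \<phi> looks at the coefficient
      just above order kN. There r^N z shows the a_i, seen through \<mu>, and r^(N+2) t contributes
      nothing.\<close>
    define v where "v = inverse u ^ N"
    define \<phi> where "\<phi> s = to_ac (\<mu> ((v * s) $ (k * N + 1)))" for s
    have "\<mu> 0 = 0" using lam_add[of 0 0] by (metis add_cancel_right_right add_0)
    have vr: "v * (r ^ N * s) = fps_X ^ (k * N) * s" for s
    proof -
      have "v * (r ^ N * s) = (inverse u * u) ^ N * (fps_X ^ (k * N) * s)"
        unfolding v_def power_mult by (subst u(1)) (simp only: power_mult_distrib mult_ac)
      then show ?thesis using inverse_mult_eq_1[OF u(2)] by simp
    qed
    have lin: "linear_on_CT \<phi>"
      unfolding linear_on_CT_def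
    proof (intro conjI ballI)
      show "\<phi> (r + s) = \<phi> r + \<phi> s" for r s by (simp add: \<phi>_def distrib_left lam_add)
      show "\<phi> (fps_const c * s) = to_ac c * \<phi> s" if "c \<in> K" for c s
      proof -
        have "v * (fps_const c * s) = fps_const c * (v * s)" by (simp add: mult_ac)
        then show ?thesis unfolding \<phi>_def by (simp only:) (simp add: that lam_mult)
      qed
    qed
    have "ev \<phi> (\<rho> (r ^ N) \<otimes> z) = (\<Sum>i\<le>m. ev \<phi> (\<rho> (r ^ N * (fps_const (a i) * fps_X)) \<otimes> \<sigma> (\<beta> i)))"
    proof -
      have rN: "r ^ N \<in> CT" using r by auto
      have "\<rho> (r ^ N) \<otimes> z = (\<Oplus>i\<in>{..m}. \<rho> (r ^ N) \<otimes> (\<rho> (fps_const (a i) * fps_X) \<otimes> \<sigma> (\<beta> i)))"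
        unfolding z using tm rN by (intro T.finsum_rdistr) (auto simp: \<rho>_closed)
      also have "\<dots> = (\<Oplus>i\<in>{..m}. \<rho> (r ^ N * (fps_const (a i) * fps_X)) \<otimes> \<sigma> (\<beta> i))"
        using \<beta> rN by (intro T.finsum_cong') (auto simp: \<rho>_mult T.m_assoc \<rho>_closed \<sigma>_closed)
      finally show ?thesis
        using \<beta> rN by (simp only:) (intro ev_finsum[OF lin], auto intro!: T.m_closed \<rho>_closed \<sigma>_closed)
    qed
    also have "\<dots> = (\<Sum>i\<le>m. to_ac (\<mu> (a i)) * \<beta> i)"
    proof (rule sum.cong)
      fix i
      have "ev \<phi> (\<rho> (r ^ N * (fps_const (a i) * fps_X)) \<otimes> \<sigma> (\<beta> i)) = \<phi> (r ^ N * (fps_const (a i) * fps_X)) * \<beta> i"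
        using r \<beta> by (intro ev_pure[OF lin]) auto
      also have "\<phi> (r ^ N * (fps_const (a i) * fps_X)) = to_ac (\<mu> (a i))"
        unfolding \<phi>_def vr by (simp add: fps_X_power_mult_nth)
      finally show "ev \<phi> (\<rho> (r ^ N * (fps_const (a i) * fps_X)) \<otimes> \<sigma> (\<beta> i)) = to_ac (\<mu> (a i)) * \<beta> i" .
    qed simp
    finally have "ev \<phi> (\<rho> (r ^ N) \<otimes> z) \<noteq> 0" using nz by simp
    moreover have "ev \<phi> (\<rho> (r ^ (N + 2)) \<otimes> t) = 0"
    proof (rule ev_eq_0[OF lin _ t(1)])
      show "r ^ (N + 2) \<in> CT" using r by auto
      show "\<phi> (r ^ (N + 2) * s) = 0" for s
      proof -
        have "v * (r ^ (N + 2) * s) = v * (r ^ N * (r ^ 2 * s))" by (simp only: power_add mult_ac)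
        also have "\<dots> = fps_X ^ (k * N + 2 * k) * (u ^ 2 * s)"
          unfolding vr mult.commute[of 2] power_add power_mult
          by (subst u(1)) (simp only: power_mult_distrib mult_ac)
        finally have e: "v * (r ^ (N + 2) * s) = fps_X ^ (k * N + 2 * k) * (u ^ 2 * s)" .
        have "(v * (r ^ (N + 2) * s)) $ (k * N + 1) = 0"
          unfolding e using k by (simp add: fps_X_power_mult_nth)
        then show ?thesis using \<open>\<mu> 0 = 0\<close> by (simp add: \<phi>_def)
      qed
    qed
    ultimately show False using eq by simp
  qed
  show "\<not> reduced_ring T"
  proof
    assume "reduced_ring T"
    then have "z = \<zero>" using zc zq unfolding reduced_ring_def by blast
    then have "U = \<zero>\<^bsub>localization T C.M\<^esub>" unfolding U_def using C.fraction_zero M by simp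
    then show False using U C.integral_zero by simp
  qed
  show "\<not> F_injective q T"
  proof
    assume "F_injective q T"
    then have "inj_on (cohomology_frobenius q T [y] (Suc 0)) (carrier (cech_cohomology T [y] (Suc 0)))"
      unfolding F_injective_def local_cohomology_frobenius_def local_cohomology_def y(1) by blast
    then have "U [^]\<^bsub>localization T C.M\<^esub> q \<in> C.integral \<longrightarrow> U \<in> C.integral"
      using UL unfolding C.inj_on_frobenius_1_iff by blast
    moreover have "U [^]\<^bsub>localization T C.M\<^esub> q \<in> C.integral"
      unfolding U_def using C.fraction_pow[OF zc M] zq C.fraction_zero C.M_pow[OF M] C.integral_zero by simp
    ultimately show False using U by blast
  qed
qed

end

lemma subfield_type_algebraI:
  fixes K :: "'l::field set"
  assumes "0 \<in> K" "1 \<in> K" "\<And>a b. a \<in> K \<Longrightarrow> b \<in> K \<Longrightarrow> a + b \<in> K" "\<And>a b. a \<in> K \<Longrightarrow> b \<in> K \<Longrightarrow> a * b \<in> K"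
    "\<And>a. a \<in> K \<Longrightarrow> - a \<in> K" "\<And>a. a \<in> K \<Longrightarrow> inverse a \<in> K"
  shows "subfield K (ring_of_type_algebra :: 'l ring)"
proof -
  interpret F: field "ring_of_type_algebra :: 'l ring" by (rule field_from_type_algebra)
  have minus: "\<ominus>\<^bsub>ring_of_type_algebra\<^esub> a = - a" for a :: 'l by (rule F.minus_equality) simp_all
  have "subring K (ring_of_type_algebra :: 'l ring)"
    by (rule F.subringI) (use assms in \<open>simp_all add: minus\<close>)
  then show ?thesis
  proof (rule F.subfieldI')
    fix a assume a: "a \<in> K - {\<zero>\<^bsub>ring_of_type_algebra\<^esub>}"
    then have "inv\<^bsub>ring_of_type_algebra\<^esub> a = inverse a"
      by (intro F.comm_inv_char) simp_all
    then show "inv\<^bsub>ring_of_type_algebra\<^esub> a \<in> K" using a assms by simp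
  qed
qed

context field_subset
begin

lemma constant_term_ring_cring: "cring (constant_term_ring K)"
proof -
  interpret F: cring "ring_of_type_algebra :: 'l fps ring" by (rule cring_from_type_algebra)
  have minus: "\<ominus>\<^bsub>ring_of_type_algebra\<^esub> a = - a" for a :: "'l fps" by (rule F.minus_equality) simp_all
  have "subcring CT (ring_of_type_algebra :: 'l fps ring)"
    by (rule F.subcringI', rule F.subringI) (auto simp: minus)
  moreover have "constant_term_ring K = ring_of_type_algebra\<lparr>carrier := CT\<rparr>"
    using carrier_CT by (simp add: constant_term_ring_def)
  ultimately show ?thesis using F.subcring_iff[of CT] by simp
qed

lemma CT_minus: "f \<in> CT \<Longrightarrow> g \<in> CT \<Longrightarrow> f \<ominus>\<^bsub>constant_term_ring K\<^esub> g = f - g"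
proof -
  interpret R: cring "constant_term_ring K" by (rule constant_term_ring_cring)
  assume f: "f \<in> CT" and g: "g \<in> CT"
  then have "\<ominus>\<^bsub>constant_term_ring K\<^esub> g = - g"
    by (intro R.minus_equality) (auto simp: carrier_CT)
  then show ?thesis by (simp add: R.minus_eq)
qed

lemma CT_pow: "f [^]\<^bsub>constant_term_ring K\<^esub> n = f ^ n" for n :: nat
proof -
  interpret R: cring "constant_term_ring K" by (rule constant_term_ring_cring)
  show ?thesis by (induction n) (simp_all add: mult.commute)
qed

end

locale constant_term_setup = field_subset K for K :: "'l::field set" +
  fixes p :: nat
  assumes p: "prime p" and char: "CHAR('l) = p"
    and finite_ext: "\<exists>n (u :: nat \<Rightarrow> 'l). \<forall>v. \<exists>c. (\<forall>i<n. c i \<in> K) \<and> v = (\<Sum>i<n. c i * u i)"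
    and powers: "range (\<lambda>a::'l. a ^ p) \<inter> K = (\<lambda>a. a ^ p) ` K"
begin

abbreviation "R \<equiv> constant_term_ring K"

lemma frobenius_inj: "(a::'l) ^ p = b ^ p \<Longrightarrow> a = b"
proof -
  assume "a ^ p = b ^ p"
  moreover have "((a - b) + b) ^ p = (a - b) ^ p + b ^ p"
    by (rule freshmans_dream) (use p char in simp_all)
  ultimately show ?thesis by simp
qed

text \<open>By \<open>powers\<close>, a p-th power lying in K equals b^p with b in K, and p-th roots
  are unique in characteristic p.\<close>

lemma pth_power_in_K: "a ^ p \<in> K \<Longrightarrow> a \<in> K"
  using powers frobenius_inj by blast

lemma power_p_not_in_K: "a \<notin> K \<Longrightarrow> a ^ (p ^ e) \<notin> K"
proof (induction e)
  case (Suc e)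
  have "a ^ (p ^ Suc e) = (a ^ (p ^ e)) ^ p" by (simp add: mult.commute flip: power_mult)
  then show ?case using Suc pth_power_in_K[of "a ^ (p ^ e)"] by auto
qed simp

lemma char_ac: "CHAR('l alg_closure) = p"
  using char by simp

lemma char_fps: "of_nat p = (0 :: 'l fps)"
proof -
  have "of_nat p = (0::'l)" using char of_nat_CHAR[where ?'a = 'l] by simp
  then show ?thesis by (simp add: fps_of_nat[symmetric])
qed

text \<open>Scalars are stored in the algebraic closure; \<open>of_ac\<close> undoes
  \<open>to_ac\<close> on the copy of K, which is where this map is used.\<close>

definition emb_ac :: "'l alg_closure \<Rightarrow> 'l fps" where
  "emb_ac b = fps_const (of_ac b)"

lemma emb_ac_to_ac [simp]: "emb_ac (to_ac c) = fps_const c"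
  by (simp add: emb_ac_def)

text \<open>R is the base change of itself along the identity of K. With q = 1 every functional is
  its own extension, and the general results give locality, dimension one and the Noetherian
  property for R.\<close>

lemma base_change_self:
  "constant_term_base_change K R (to_ac ` K) 1 (\<lambda>f. f) emb_ac"
proof -
  interpret R: cring "R" by (rule constant_term_ring_cring)
  show ?thesis
  proof (intro constant_term_base_change.intro constant_term_base_change_axioms.intro)
    show "field_subset K" "cring R"
      by (rule field_subset_axioms, rule R.cring_axioms)
    show "subfield (to_ac ` K) (ring_of_type_algebra :: 'l alg_closure ring)"
      by (rule subfield_type_algebraI)
        (auto simp: image_iff simp flip: to_ac_add to_ac_mult to_ac_minus to_ac_inverse intro: bexI[of _ 0] bexI[of _ 1])
    show "emb_ac 1 = \<one>\<^bsub>R\<^esub>"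
      using emb_ac_to_ac[of 1] by (simp del: emb_ac_to_ac)
    have G: "{r \<otimes>\<^bsub>R\<^esub> emb_ac b |r b. r \<in> CT \<and> b \<in> to_ac ` K} = CT" (is "?G = _")
    proof
      show "?G \<subseteq> CT" by (auto intro!: CT_mult CT_const)
      show "CT \<subseteq> ?G"
      proof
        fix r assume "r \<in> CT"
        moreover have "r = r \<otimes>\<^bsub>R\<^esub> emb_ac (to_ac 1)"
          unfolding emb_ac_to_ac by simp
        ultimately show "r \<in> ?G" using K_1 by blast
      qed
    qed
    have "generate (add_monoid R) CT \<subseteq> CT"
      using R.add.generate_incl[of CT] by (simp add: carrier_CT)
    then show "carrier R = generate (add_monoid R)
        {r \<otimes>\<^bsub>R\<^esub> emb_ac b |r b. r \<in> CT \<and> b \<in> to_ac ` K}"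
      unfolding G carrier_CT by (auto intro: generate.incl)
    fix \<phi> :: "'l fps \<Rightarrow> 'l alg_closure"
    assume "\<And>r s. r \<in> CT \<Longrightarrow> s \<in> CT \<Longrightarrow> \<phi> (r + s) = \<phi> r + \<phi> s"
      "\<And>c r. c \<in> K \<Longrightarrow> r \<in> CT \<Longrightarrow> \<phi> (fps_const c * r) = to_ac c * \<phi> r"
    then show "\<exists>\<Phi> :: 'l fps \<Rightarrow> 'l alg_closure.
        (\<forall>r\<in>CT. \<forall>b\<in>to_ac ` K. \<Phi> (r \<otimes>\<^bsub>R\<^esub> emb_ac b) = \<phi> r * b) \<and>
        (\<forall>x\<in>carrier R. \<forall>y\<in>carrier R.
           \<Phi> (x \<oplus>\<^bsub>R\<^esub> y) = \<Phi> x + \<Phi> y)"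
      by (intro exI[of _ \<phi>]) (auto simp: carrier_CT mult.commute)
  qed (use finite_ext in \<open>auto simp: carrier_CT simp flip: to_ac_add to_ac_mult\<close>)
qed

end


section \<open>The two rings\<close>

context constant_term_setup
begin

abbreviation "RB \<equiv> base_changed_ring p K"

definition "Bp = {b :: 'l alg_closure. b ^ p \<in> to_ac ` K}"

lemma p_pos: "p > 0"
  using p by (rule prime_gt_0_nat)

lemma ac_power_add: "(b + b') ^ p = b ^ p + (b' ^ p :: 'l alg_closure)"
  by (rule freshmans_dream) (use p char_ac in simp_all)

lemma ac_power_uminus: "(- b) ^ p = - (b ^ p :: 'l alg_closure)"
  using ac_power_add[of "- b" b] p_pos by (simp add: eq_neg_iff_add_eq_0 zero_power)

lemma Bp_subfield: "subfield Bp (ring_of_type_algebra :: 'l alg_closure ring)"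
proof (rule subfield_type_algebraI)
  show "0 \<in> Bp" "1 \<in> Bp"
    using p_pos by (auto simp: Bp_def image_iff zero_power intro: bexI[of _ 0] bexI[of _ 1])
  fix a b assume "a \<in> Bp" then obtain c where c: "c \<in> K" "a ^ p = to_ac c" by (auto simp: Bp_def)
  show "- a \<in> Bp" "inverse a \<in> Bp"
    using c by (auto simp: Bp_def ac_power_uminus power_inverse simp flip: to_ac_minus to_ac_inverse)
  assume "b \<in> Bp" then obtain d where d: "d \<in> K" "b ^ p = to_ac d" by (auto simp: Bp_def)
  show "a + b \<in> Bp" "a * b \<in> Bp"
    using c d by (auto simp: Bp_def ac_power_add power_mult_distrib simp flip: to_ac_add to_ac_mult)
qed

lemma pth_root_field_simps [simp]:
  "carrier (pth_root_field p K) = Bp" "x \<otimes>\<^bsub>pth_root_field p K\<^esub> y = x * y"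
  "x \<oplus>\<^bsub>pth_root_field p K\<^esub> y = x + y" "\<one>\<^bsub>pth_root_field p K\<^esub> = 1" "\<zero>\<^bsub>pth_root_field p K\<^esub> = 0"
  by (simp_all add: pth_root_field_def Bp_def ring_of_type_algebra_def)

lemma pth_root_field_cring: "cring (pth_root_field p K)"
proof -
  interpret F: cring "ring_of_type_algebra :: 'l alg_closure ring" by (rule cring_from_type_algebra)
  show ?thesis
    using subfieldE(2)[OF Bp_subfield] F.subcring_iff[of Bp] by (simp add: pth_root_field_def Bp_def)
qed

lemma to_ac_Bp: "c \<in> K \<Longrightarrow> to_ac c \<in> Bp"
  by (auto simp: Bp_def simp flip: to_ac_power)

sublocale TA: tensor_algebras R "pth_root_field p K" K fps_const to_ac
  by (intro tensor_algebras.intro tensor_algebras_axioms.intro constant_term_ring_cring pth_root_field_cring)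
    (auto simp: carrier_CT to_ac_Bp)

lemma base_change_tensor:
  "constant_term_base_change K RB Bp p TA.tl TA.tr"
proof -
  interpret T: cring "RB"
    using TA.T_cring by (simp add: base_changed_ring_def)
  note [simp] = base_changed_ring_def carrier_CT
  have tl: "TA.tl r \<in> carrier RB" "TA.tl (r + s) = TA.tl r \<oplus>\<^bsub>RB\<^esub> TA.tl s"
      "TA.tl (r * s) = TA.tl r \<otimes>\<^bsub>RB\<^esub> TA.tl s" if "r \<in> CT" "s \<in> CT" for r s
    using that TA.tl_closed[of r] TA.tl_add[of r s] TA.tl_mult[of r s] by simp_all
  have tr: "TA.tr r \<in> carrier RB" "TA.tr (r + s) = TA.tr r \<oplus>\<^bsub>RB\<^esub> TA.tr s"
      "TA.tr (r * s) = TA.tr r \<otimes>\<^bsub>RB\<^esub> TA.tr s" if "r \<in> Bp" "s \<in> Bp" for r s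
    using that TA.tr_closed[of r] TA.tr_add[of r s] TA.tr_mult[of r s] by simp_all
  have tl1: "TA.tl 1 = \<one>\<^bsub>RB\<^esub>" using TA.tl_one by simp
  have tl0: "TA.tl 0 = \<zero>\<^bsub>RB\<^esub>"
    using tl(2)[of 0 0] tl(1)[of 0 0] by (simp del: base_changed_ring_def add: T.add.l_cancel_one)
  \<comment> \<open>The characteristic is inherited through the left map: p times 1 is the image of
    the series p, which is 0.\<close>
  have nat: "TA.tl (of_nat n) = add_pow RB n \<one>\<^bsub>RB\<^esub>" for n
  proof (induction n)
    case (Suc n)
    have "of_nat n \<in> CT" by (induction n) auto
    then show ?case using tl(2)[of "of_nat n" 1] Suc tl1
      by (simp del: base_changed_ring_def add: add.commute)
  qed (simp del: base_changed_ring_def add: tl0)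
  have charT: "add_pow RB p \<one>\<^bsub>RB\<^esub> = \<zero>\<^bsub>RB\<^esub>"
    using nat[of p] char_fps tl0 by (simp del: base_changed_ring_def)
  show ?thesis
  proof (intro constant_term_base_change.intro constant_term_base_change_axioms.intro)
    show "field_subset K" by (rule field_subset_axioms)
    show "cring RB" by (rule T.cring_axioms)
    show "\<exists>n (u :: nat \<Rightarrow> 'l). \<forall>v. \<exists>c. (\<forall>i<n. c i \<in> K) \<and> v = (\<Sum>i<n. c i * u i)" by (rule finite_ext)
    show "subfield Bp (ring_of_type_algebra :: 'l alg_closure ring)" by (rule Bp_subfield)
    show "to_ac ` K \<subseteq> Bp" using to_ac_Bp by auto
    show "b ^ p \<in> to_ac ` K" if "b \<in> Bp" for b using that by (simp add: Bp_def)
    show "0 < p" by (rule p_pos)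
    show "(b + b') ^ p = b ^ p + (b' ^ p :: 'l alg_closure)" for b b' by (rule ac_power_add)
    show "(x \<oplus>\<^bsub>RB\<^esub> y) [^]\<^bsub>RB\<^esub> p =
       x [^]\<^bsub>RB\<^esub> p \<oplus>\<^bsub>RB\<^esub> y [^]\<^bsub>RB\<^esub> p"
      if "x \<in> carrier RB" "y \<in> carrier RB" for x y
      using that by (intro T.freshmans_dream_cring p charT)
    show "TA.tl 1 = \<one>\<^bsub>RB\<^esub>" by (rule tl1)
    show "TA.tr 1 = \<one>\<^bsub>RB\<^esub>" using TA.tr_one by simp
    show "TA.tl (fps_const c) = TA.tr (to_ac c)" if "c \<in> K" for c using that by (rule TA.tl_eq_tr)
    show "carrier RB = generate (add_monoid RB)
        {TA.tl r \<otimes>\<^bsub>RB\<^esub> TA.tr b |r b. r \<in> CT \<and> b \<in> Bp}"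
      using TA.T_generated by simp
    fix \<phi> :: "'l fps \<Rightarrow> 'l alg_closure"
    assume \<phi>: "\<And>r s. r \<in> CT \<Longrightarrow> s \<in> CT \<Longrightarrow> \<phi> (r + s) = \<phi> r + \<phi> s"
      "\<And>c r. c \<in> K \<Longrightarrow> r \<in> CT \<Longrightarrow> \<phi> (fps_const c * r) = to_ac c * \<phi> r"
    \<comment> \<open>Extension of scalars: this pairing is balanced because \<phi> is additive and
      linear over K.\<close>
    have "TA.balanced (\<lambda>(r, b). \<phi> r * b)"
      unfolding TA.balanced_def using \<phi> by (auto simp: algebra_simps)
    from TA.balanced_functional[OF this]
    show "\<exists>\<Phi> :: _ \<Rightarrow> 'l alg_closure.
        (\<forall>r\<in>CT. \<forall>b\<in>Bp. \<Phi> (TA.tl r \<otimes>\<^bsub>RB\<^esub> TA.tr b) = \<phi> r * b) \<and>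
        (\<forall>x\<in>carrier RB. \<forall>y\<in>carrier RB.
           \<Phi> (x \<oplus>\<^bsub>RB\<^esub> y) = \<Phi> x + \<Phi> y)"
      by simp
  next
    fix r s assume r: "r \<in> CT" and s: "s \<in> CT"
    show "TA.tl r \<in> carrier RB" by (rule tl(1)[OF r r])
    show "TA.tl (r + s) = TA.tl r \<oplus>\<^bsub>RB\<^esub> TA.tl s" by (rule tl(2)[OF r s])
    show "TA.tl (r * s) = TA.tl r \<otimes>\<^bsub>RB\<^esub> TA.tl s" by (rule tl(3)[OF r s])
  next
    fix b b' assume b: "b \<in> Bp" and b': "b' \<in> Bp"
    show "TA.tr b \<in> carrier RB" by (rule tr(1)[OF b b])
    show "TA.tr (b + b') = TA.tr b \<oplus>\<^bsub>RB\<^esub> TA.tr b'" by (rule tr(2)[OF b b'])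
    show "TA.tr (b * b') = TA.tr b \<otimes>\<^bsub>RB\<^esub> TA.tr b'" by (rule tr(3)[OF b b'])
  qed
qed

interpretation S: constant_term_base_change K R "to_ac ` K" 1 "\<lambda>f. f" emb_ac
  by (rule base_change_self)

section \<open>Completeness, F-injectivity and F-stability of the constant term ring\<close>

lemma max_ideal_R: "max_ideal R = {f. f $ 0 = 0}"
proof -
  have "f \<in> CT" if "f $ 0 = 0" for f using that by (simp add: CT_def)
  then show ?thesis unfolding S.max_ideal S.mx_def carrier_CT
    using S.res_\<rho> by auto
qed

lemma max_ideal_power_R:
  "max_ideal_power R n = {f \<in> CT. \<forall>i<n. f $ i = 0}"
proof -
  \<comment> \<open>The closed form x^(n+1) L[[x]] starts with the first power of the maximal ideal,
    as the zeroth power is R and not L[[x]].\<close>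
  have eq: "max_ideal R [^]\<^bsub>ideals_set R\<^esub> Suc n = {f :: 'l fps. \<forall>i\<le>n. f $ i = 0}" for n
  proof (induction n)
    case 0
    have "ideal_prod R CT {f. f $ 0 = 0} = {f. f $ 0 = 0}" (is "?L = ?R")
    proof
      show "?L \<subseteq> ?R"
      proof
        fix f assume "f \<in> ?L" then show "f \<in> ?R" by (induction rule: ideal_prod.induct) auto
      qed
      show "?R \<subseteq> ?L" using ideal_prod.prod[of 1 CT _ _ R] by auto
    qed
    then show ?case
      by (simp add: nat_pow_def ideals_set_def max_ideal_R carrier_CT)
  next
    case (Suc n)
    have "max_ideal R [^]\<^bsub>ideals_set R\<^esub> Suc (Suc n) = ideal_prod R {f. \<forall>i\<le>n. f $ i = 0} {f. f $ 0 = 0}"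
      unfolding Suc[symmetric] max_ideal_R[symmetric] by (simp add: nat_pow_def ideals_set_def)
    also have "\<dots> = {f. \<forall>i\<le>Suc n. f $ i = 0}" (is "?L = ?R")
    proof
      show "?L \<subseteq> ?R"
      proof
        fix f assume "f \<in> ?L" then show "f \<in> ?R"
        proof (induction rule: ideal_prod.induct)
          case (prod f g)
          have "(f * g) $ i = 0" if "i \<le> Suc n" for i
            unfolding fps_mult_nth
          proof (rule sum.neutral, rule ballI)
            fix j assume "j \<in> {0..i}"
            then show "f $ j * g $ (i - j) = 0"
              using prod that by (cases "j \<le> n") (auto simp: not_le Suc_le_eq[symmetric])
          qed
          then show ?case by simp
        qed simp
      qed
      show "?R \<subseteq> ?L"
      proof
        fix f :: "'l fps" assume "f \<in> ?R"
        then have f: "f $ i = 0" if "i \<le> Suc n" for i using that by auto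
        \<comment> \<open>Splitting off x^(n+1) leaves a factor with zero constant term, because f
          vanishes up to index n+1. The two factors lie in m^(n+1) and in m.\<close>
        have "f = fps_X ^ Suc n * fps_shift (Suc n) f"
          by (rule fps_ext) (use f in \<open>auto simp del: power_Suc simp: fps_X_power_mult_nth\<close>)
        moreover have "fps_X ^ Suc n \<in> {f :: 'l fps. \<forall>i\<le>n. f $ i = 0}"
          by (auto simp del: power_Suc simp: fps_X_power_nth)
        moreover have "fps_shift (Suc n) f \<in> {f. f $ 0 = 0}" using f by simp
        ultimately have "fps_X ^ Suc n \<otimes>\<^bsub>R\<^esub> fps_shift (Suc n) f \<in> ?L" "f = fps_X ^ Suc n \<otimes>\<^bsub>R\<^esub> fps_shift (Suc n) f"
          using ideal_prod.prod[of "fps_X ^ Suc n" "{f. \<forall>i\<le>n. f $ i = 0}" "fps_shift (Suc n) f" "{f. f $ 0 = 0}" R]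
          by (simp_all only: constant_term_ring_simps)
        then show "f \<in> ?L" by simp
      qed
    qed
    finally show ?case .
  qed
  show ?thesis
  proof (cases n)
    case 0
    then show ?thesis by (simp add: max_ideal_power_def nat_pow_def ideals_set_def carrier_CT)
  next
    case (Suc m)
    then show ?thesis using eq[of m] by (auto simp: max_ideal_power_def CT_def less_Suc_eq_le)
  qed
qed

lemma complete_R: "complete_local R"
  unfolding complete_local_def
proof (intro conjI allI impI)
  show "(\<Inter>n. max_ideal_power R n) = {\<zero>\<^bsub>R\<^esub>}"
    by (auto simp: max_ideal_power_R fps_eq_iff) (metis lessI)
  fix f :: "nat \<Rightarrow> 'l fps"
  assume *: "range f \<subseteq> carrier R \<and> (\<forall>n. \<exists>N. \<forall>i\<ge>N. \<forall>j\<ge>N. f i \<ominus>\<^bsub>R\<^esub> f j \<in> max_ideal_power R n)"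
  then have f: "f i \<in> CT" for i by (auto simp: carrier_CT)
  have "\<forall>n. \<exists>N. \<forall>i\<ge>N. \<forall>j\<ge>N. \<forall>k<n. f i $ k = f j $ k"
  proof
    fix n
    from * have "\<exists>N. \<forall>i\<ge>N. \<forall>j\<ge>N. f i \<ominus>\<^bsub>R\<^esub> f j \<in> max_ideal_power R n" by (elim conjE allE)
    then obtain N where N: "\<forall>i\<ge>N. \<forall>j\<ge>N. f i \<ominus>\<^bsub>R\<^esub> f j \<in> max_ideal_power R n" ..
    show "\<exists>N. \<forall>i\<ge>N. \<forall>j\<ge>N. \<forall>k<n. f i $ k = f j $ k"
    proof (intro exI[of _ N] allI impI)
      fix i j k assume "N \<le> i" "N \<le> j" and k: "k < n"
      then have "f i \<ominus>\<^bsub>R\<^esub> f j \<in> max_ideal_power R n" using N by (elim allE impE)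
      then show "f i $ k = f j $ k"
        using k by (simp add: max_ideal_power_R CT_minus[OF f f])
    qed
  qed
  then obtain N where N: "\<And>n i j k. i \<ge> N n \<Longrightarrow> j \<ge> N n \<Longrightarrow> k < n \<Longrightarrow> f i $ k = f j $ k"
    by metis
  \<comment> \<open>Coefficient k is constant from \<open>N (Suc k)\<close> on; precision
    \<open>Suc k\<close> is the first that covers index k.\<close>
  define a where "a = Abs_fps (\<lambda>k. f (N (Suc k)) $ k)"
  have a: "a \<in> CT" using f by (simp add: a_def CT_def)
  have "\<exists>M. \<forall>i\<ge>M. f i \<ominus>\<^bsub>R\<^esub> a \<in> max_ideal_power R n" for n
  proof (intro exI allI impI)
    fix i assume i: "i \<ge> N n"
    have "f i $ k = a $ k" if "k < n" for k
    proof -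
      \<comment> \<open>The comparison goes through an index beyond both thresholds, since N need
        not be monotone.\<close>
      define j where "j = max (N n) (N (Suc k))"
      have "f i $ k = f j $ k" using i that by (intro N[of n]) (auto simp: j_def)
      also have "\<dots> = f (N (Suc k)) $ k" by (intro N[of "Suc k"]) (auto simp: j_def)
      finally show ?thesis by (simp add: a_def)
    qed
    then show "f i \<ominus>\<^bsub>R\<^esub> a \<in> max_ideal_power R n"
      using f[of i] a by (simp add: max_ideal_power_R CT_minus CT_diff)
  qed
  then show "\<exists>a\<in>carrier R. \<forall>n. \<exists>N. \<forall>i\<ge>N. f i \<ominus>\<^bsub>R\<^esub> a \<in> max_ideal_power R n"
    using a by (auto simp: carrier_CT)
qed

lemma fps_freshmans_dream: "(f + g) ^ p = f ^ p + (g ^ p :: 'l fps)"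
  by (rule freshmans_dream) (use p char in simp_all)

lemma some_parameters_R:
  obtains y where "some_parameters R = [y]" "y $ 0 = 0" "y \<noteq> 0" "cech_single_frobenius R y p"
proof -
  obtain y where y: "some_parameters R = [y]" "y \<in> S.mx" "y [^]\<^bsub>R\<^esub> (1::nat) \<noteq> \<zero>\<^bsub>R\<^esub>"
    by (rule S.some_parameters)
  have y0: "y $ 0 = 0" using y(2) S.max_ideal max_ideal_R by auto
  have "y \<noteq> 0" using y(3) by (simp only: CT_pow) simp
  moreover have "cech_single_frobenius R y p"
    by (intro cech_single_frobenius.intro cech_single.intro cech_single_axioms.intro
        cech_single_frobenius_axioms.intro constant_term_ring_cring)
      (use y0 p_pos in \<open>auto simp: carrier_CT CT_def CT_pow fps_freshmans_dream\<close>)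
  ultimately show thesis using that y y0 by blast
qed

lemma F_injective_R: "F_injective p R"
proof -
  obtain y where y: "some_parameters R = [y]" "y $ 0 = 0" "y \<noteq> 0" and "cech_single_frobenius R y p"
    by (rule some_parameters_R)
  interpret C: cech_single_frobenius R y p by fact
  have M: "y ^ n \<in> C.M" for n by (auto simp: C.M_def CT_pow)
  have "inj_on (cohomology_frobenius p R [y] 0) (carrier (cech_cohomology R [y] 0))"
    by (rule C.inj_on_frobenius_0) (use y in \<open>auto simp: CT_pow\<close>)
  moreover have "inj_on (cohomology_frobenius p R [y] (Suc 0)) (carrier (cech_cohomology R [y] (Suc 0)))"
    unfolding C.inj_on_frobenius_1_iff
  proof (intro ballI impI)
    fix U assume U: "U \<in> carrier (localization R C.M)" "U [^]\<^bsub>localization R C.M\<^esub> p \<in> C.integral"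
    obtain b s where b: "b \<in> CT" "U = fraction R C.M b s" and "s \<in> C.M"
      using U(1) unfolding C.carrier_localization carrier_CT by blast
    moreover from \<open>s \<in> C.M\<close> obtain e where "s = y ^ e"
      by (auto simp: C.M_def CT_pow)
    ultimately have b: "b \<in> CT" "U = fraction R C.M b (y ^ e)" by simp_all
    obtain a where a: "a \<in> CT" "U [^]\<^bsub>localization R C.M\<^esub> p = fraction R C.M a \<one>\<^bsub>R\<^esub>"
      using U(2) by (auto simp: C.integral_def carrier_CT)
    have "fraction R C.M (b ^ p) ((y ^ e) ^ p) = fraction R C.M a \<one>\<^bsub>R\<^esub>"
      using C.fraction_pow[of b "y ^ e" p] b a M by (simp add: carrier_CT CT_pow)
    moreover have "b ^ p \<in> carrier R" "a \<in> carrier R" "(y ^ e) ^ p \<in> C.M"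
      using a b M[of "e * p"] by (auto simp: carrier_CT CT_power power_mult)
    ultimately obtain w where "w \<in> C.M" "w * (1 * b ^ p) = w * ((y ^ e) ^ p * a)"
      using C.fraction_eq_iff[of "b ^ p" "(y ^ e) ^ p" a "\<one>\<^bsub>R\<^esub>"] C.one_M
      unfolding constant_term_ring_simps by blast
    then have eq: "b ^ p = (y ^ e) ^ p * a" using y by (auto simp: C.M_def CT_pow)
    \<comment> \<open>The division takes place in L[[x]], where comparing orders suffices. Only
      afterwards does the p-th power of the quotient show that its constant term lies in K.\<close>
    have "y ^ e dvd b"
    proof (cases "b = 0")
      case False
      then have "a \<noteq> 0" using eq by auto
      then have "p * subdegree b = p * subdegree (y ^ e) + subdegree a"
        using arg_cong[OF eq, of subdegree] y by (simp add: subdegree_power)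
      then have "p * subdegree (y ^ e) \<le> p * subdegree b" by simp
      then have "subdegree (y ^ e) \<le> subdegree b" using p_pos by simp
      then show ?thesis using y False by (simp add: fps_dvd_iff)
    qed simp
    then obtain c where c: "b = y ^ e * c" by (auto elim: dvdE)
    then have "c ^ p = a" using eq y by (simp add: power_mult_distrib)
    then have "(c $ 0) ^ p \<in> K" using a by (auto simp: CT_def fps_power_zeroth)
    then have cK: "c \<in> CT" using pth_power_in_K by (simp add: CT_def)
    then have "U = fraction R C.M c \<one>\<^bsub>R\<^esub>"
      unfolding b(2) using b(1) M C.one_M c by (intro C.fraction_eqI) (auto simp: carrier_CT)
    then show "U \<in> C.integral" using cK by (auto simp: C.integral_def carrier_CT)
  qed
  ultimately have "inj_on (cohomology_frobenius p R [y] i) (carrier (cech_cohomology R [y] i))" for i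
    using C.inj_on_frobenius_ge_2 by (metis not0_implies_Suc)
  then show ?thesis
    unfolding F_injective_def local_cohomology_frobenius_def local_cohomology_def y(1) by blast
qed

lemma F_stable_R:
  assumes a: "a \<notin> K"
  shows "F_stable p R"
proof
  obtain y where y: "some_parameters R = [y]" "y $ 0 = 0" "y \<noteq> 0" and "cech_single_frobenius R y p"
    by (rule some_parameters_R)
  interpret C: cech_single_frobenius R y p by fact
  let ?L = "localization R C.M"
  interpret L: cring ?L by (rule C.cring_localization)
  have M: "y ^ n \<in> C.M" "y \<in> C.M" for n
    by (auto simp: C.M_def CT_pow intro: exI[of _ 1])
  let ?H = "cech_cohomology R [y] (Suc 0)" and ?F = "cohomology_frobenius p R [y] (Suc 0)"
  \<comment> \<open>The constant a of L, seen in the localization: a itself may lie outside R, but a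
    y does not, because y has zero constant term.\<close>
  define U where "U a = fraction R C.M (fps_const a * y) y" for a
  have ay: "fps_const a * y \<in> carrier R" for a using y by (simp add: carrier_CT CT_def)
  have UL: "U a \<in> carrier ?L" for a unfolding U_def by (rule C.fraction_closed[OF ay M(2)])
  have socle: "C.cls (U a) \<in> socle R ?H" for a
  proof -
    have "r \<odot>\<^bsub>?H\<^esub> C.cls (U a) = \<zero>\<^bsub>?H\<^esub>" if r: "r \<in> max_ideal R" for r
    proof -
      have rc: "r \<in> carrier R" "r * fps_const a \<in> carrier R"
        using r by (auto simp: max_ideal_R carrier_CT CT_def)
      have "fraction R C.M r \<one>\<^bsub>R\<^esub> \<otimes>\<^bsub>?L\<^esub> U a = fraction R C.M (r * (fps_const a * y)) y"
        unfolding U_def using C.fraction_mult[OF rc(1) C.one_M ay M(2)] by simp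
      also have "\<dots> = fraction R C.M (r * fps_const a) \<one>\<^bsub>R\<^esub>"
        using rc ay[of a] M C.one_M by (intro C.fraction_eqI) (auto simp: carrier_CT)
      finally have "fraction R C.M r \<one>\<^bsub>R\<^esub> \<otimes>\<^bsub>?L\<^esub> U a \<in> C.integral"
        using rc by (auto simp: C.integral_def)
      then show ?thesis
        using C.smult_1[OF rc(1) UL] C.cls_zero_iff C.integral_closed by (simp add: C.cohomology_1)
    qed
    then show ?thesis using UL by (auto simp: socle_def C.cohomology_1)
  qed
  have F: "(?F ^^ e) (C.cls (U a)) = C.cls (U (a ^ (p ^ e)))" for e
  proof -
    have "U a [^]\<^bsub>?L\<^esub> (p ^ e) = fraction R C.M ((fps_const a * y) ^ (p ^ e)) (y ^ (p ^ e))"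
      unfolding U_def using C.fraction_pow[OF ay M(2)] by (simp add: CT_pow)
    also have "\<dots> = U (a ^ (p ^ e))"
      unfolding U_def
    proof (rule C.fraction_eqI)
      show "(fps_const a * y) ^ (p ^ e) \<in> carrier R" "fps_const (a ^ (p ^ e)) * y \<in> carrier R"
        using CT_power ay unfolding carrier_CT by blast+
    qed (use M in \<open>simp_all add: power_mult_distrib mult_ac flip: fps_const_power\<close>)
    finally show ?thesis using C.funpow_frobenius_1[OF UL] by simp
  qed
  have nonzero: "C.cls (U b) \<noteq> \<zero>\<^bsub>?H\<^esub>" if b: "b \<notin> K" for b
  proof
    assume "C.cls (U b) = \<zero>\<^bsub>?H\<^esub>"
    then have "U b \<in> C.integral" using C.cls_zero_iff[OF UL] by (simp add: C.cohomology_1)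
    then obtain c where c: "c \<in> CT" "U b = fraction R C.M c \<one>\<^bsub>R\<^esub>"
      by (auto simp: C.integral_def carrier_CT)
    then obtain N where "y ^ N * (1 * (fps_const b * y)) = y ^ N * (y * c)"
      using C.fraction_eq_iff[OF ay M(2) _ C.one_M, of c b] unfolding U_def
      by (auto simp: C.M_def CT_pow carrier_CT)
    then have "fps_const b = c" using y by (simp add: mult.commute)
    then show False using c b by (auto simp: CT_def)
  qed
  assume "F_unstable p R"
  then have "F_unstable_module R ?H ?F"
    unfolding F_unstable_def local_cohomology_frobenius_def local_cohomology_def y(1) by blast
  then obtain N where "\<forall>e\<ge>N. socle R ?H \<inter> (?F ^^ e) ` socle R ?H = {\<zero>\<^bsub>?H\<^esub>}"
    unfolding F_unstable_module_def by auto
  then have "socle R ?H \<inter> (?F ^^ N) ` socle R ?H = {\<zero>\<^bsub>?H\<^esub>}" by simp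
  \<comment> \<open>The N-th Frobenius image of the socle class of a is again a socle class; it is
    nonzero because a^(p^N) stays outside K.\<close>
  moreover have "C.cls (U (a ^ (p ^ N))) \<in> socle R ?H \<inter> (?F ^^ N) ` socle R ?H"
    using socle F[of N] by (metis IntI imageI)
  ultimately show False using nonzero[OF power_p_not_in_K[OF a, of N]] by simp
qed

lemmas noetherian_local_R = S.noetherian_local and krull_dim_R = S.krull_dim_1

end


section \<open>Inseparable extensions\<close>

text \<open>Dimension is defined inductively by line extensions, and each extension appends one
  generator.\<close>

lemma finite_dimension_imp_spanned:
  fixes K :: "'l::field set"
  assumes "ring.finite_dimension (ring_of_type_algebra :: 'l ring) K E"
  shows "\<exists>n (u :: nat \<Rightarrow> 'l). \<forall>v\<in>E. \<exists>c. (\<forall>i<n. c i \<in> K) \<and> v = (\<Sum>i<n. c i * u i)"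
proof -
  interpret F: field "ring_of_type_algebra :: 'l ring" by (rule field_from_type_algebra)
  from assms obtain n where "F.dimension n K E" by (auto simp: F.finite_dimension_def)
  then show ?thesis
  proof (induction rule: F.dimension.induct)
    case (zero_dim K)
    show ?case by (intro exI[of _ 0]) auto
  next
    case (Suc_dim v E n K)
    then obtain m u where u: "\<forall>v\<in>E. \<exists>c. (\<forall>i<m. c i \<in> K) \<and> v = (\<Sum>i<(m::nat). c i * u i)" by blast
    show ?case
    proof (rule exI[of _ "Suc m"], rule exI[of _ "u(m := v)"], rule ballI)
      fix w assume "w \<in> F.line_extension K v E"
      then obtain k e where k: "k \<in> K" "e \<in> E" "w = k * v + e" by (auto simp: F.line_extension_mem_iff)
      then obtain c where c: "\<forall>i<m. c i \<in> K" "e = (\<Sum>i<m. c i * u i)" using u by blast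
      have "w = (\<Sum>i<Suc m. (c(m := k)) i * (u(m := v)) i)"
        using c k by simp
      then show "\<exists>c. (\<forall>i<Suc m. c i \<in> K) \<and> w = (\<Sum>i<Suc m. c i * (u(m := v)) i)"
        using c k by (intro exI[of _ "c(m := k)"]) (auto simp: less_Suc_eq)
    qed
  qed
qed

context field_subset
begin

text \<open>Gaussian elimination: a vector with nonzero last coordinate clears that coordinate from
  the others, and a relation among the cleared vectors lifts back.\<close>

lemma linear_dependence:
  fixes w u :: "nat \<Rightarrow> 'l"
  assumes "finite J" "card J > n"
    and "\<And>j. j \<in> J \<Longrightarrow> \<exists>c. (\<forall>i<n. c i \<in> K) \<and> w j = (\<Sum>i<n. c i * u i)"
  shows "\<exists>d. (\<forall>j\<in>J. d j \<in> K) \<and> (\<exists>j\<in>J. d j \<noteq> 0) \<and> (\<Sum>j\<in>J. d j * w j) = 0"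
  using assms
proof (induction n arbitrary: J w)
  case 0
  then have "J \<noteq> {}" by auto
  then show ?case using 0 by (intro exI[of _ "\<lambda>_. 1"]) (auto intro!: sum.neutral)
next
  case (Suc n)
  obtain c where c: "\<And>j i. j \<in> J \<Longrightarrow> i < Suc n \<Longrightarrow> c j i \<in> K"
    "\<And>j. j \<in> J \<Longrightarrow> w j = (\<Sum>i<Suc n. c j i * u i)"
    using bchoice[of J "\<lambda>j c. (\<forall>i<Suc n. c i \<in> K) \<and> w j = (\<Sum>i<Suc n. c i * u i)"] Suc.prems(3) by blast
  show ?case
  proof (cases "\<forall>j\<in>J. c j n = 0")
    case True
    then show ?thesis
      using Suc.prems(1,2) c by (intro Suc.IH) (auto intro!: exI[of _ "c j" for j])
  next
    case False
    then obtain j0 where j0: "j0 \<in> J" "c j0 n \<noteq> 0" by blast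
    define r where "r j = c j n / c j0 n" for j
    have r: "r j \<in> K" if "j \<in> J" for j using c(1)[OF that, of n] c(1)[OF j0(1), of n] by (auto simp: r_def)
    have "\<exists>d. (\<forall>j\<in>J - {j0}. d j \<in> K) \<and> (\<exists>j\<in>J - {j0}. d j \<noteq> 0) \<and>
      (\<Sum>j\<in>J - {j0}. d j * (w j - r j * w j0)) = 0"
    proof (rule Suc.IH)
      show "n < card (J - {j0})" using Suc.prems(1,2) j0 by simp
      fix j assume j: "j \<in> J - {j0}"
      have "w j - r j * w j0 = (\<Sum>i<Suc n. (c j i - r j * c j0 i) * u i)"
        using j j0 c(2) by (simp add: sum_subtractf[symmetric] sum_distrib_left algebra_simps)
      also have "\<dots> = (\<Sum>i<n. (c j i - r j * c j0 i) * u i)"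
        using j0 by (simp add: r_def)
      finally show "\<exists>c. (\<forall>i<n. c i \<in> K) \<and> w j - r j * w j0 = (\<Sum>i<n. c i * u i)"
        using j j0 r[of j] by (intro exI[of _ "\<lambda>i. c j i - r j * c j0 i"]) (auto intro!: K_diff K_mult c(1))
    qed (use Suc.prems in auto)
    then obtain d where d: "\<forall>j\<in>J - {j0}. d j \<in> K" "\<exists>j\<in>J - {j0}. d j \<noteq> 0"
      "(\<Sum>j\<in>J - {j0}. d j * (w j - r j * w j0)) = 0" by blast
    \<comment> \<open>The coefficient of the pivot that undoes the elimination.\<close>
    define s where "s = - (\<Sum>j\<in>J - {j0}. d j * r j)"
    have "(\<Sum>j\<in>J. (d(j0 := s)) j * w j) = s * w j0 + (\<Sum>j\<in>J - {j0}. d j * w j)"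
      using Suc.prems(1) j0 by (subst sum.remove[of _ j0]) (auto intro!: sum.cong)
    also have "\<dots> = (\<Sum>j\<in>J - {j0}. d j * (w j - r j * w j0))"
      by (simp add: s_def sum_distrib_right sum_distrib_left sum_subtractf algebra_simps)
    finally have "(\<Sum>j\<in>J. (d(j0 := s)) j * w j) = 0" using d by simp
    moreover have "s \<in> K" unfolding s_def using d(1) r by (intro K_uminus K_sum K_mult) auto
    ultimately show ?thesis using d by (intro exI[of _ "d(j0 := s)"]) auto
  qed
qed

section \<open>Polynomials over the subfield and separating functionals\<close>

definition "PK = {P :: 'l poly. \<forall>i. coeff P i \<in> K}"

lemma PK_0 [simp]: "0 \<in> PK"
  and PK_add: "P \<in> PK \<Longrightarrow> Q \<in> PK \<Longrightarrow> P + Q \<in> PK"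
  and PK_diff: "P \<in> PK \<Longrightarrow> Q \<in> PK \<Longrightarrow> P - Q \<in> PK"
  and PK_smult: "c \<in> K \<Longrightarrow> P \<in> PK \<Longrightarrow> smult c P \<in> PK"
  and PK_monom: "c \<in> K \<Longrightarrow> Polynomial.monom c n \<in> PK"
  and PK_pderiv: "P \<in> PK \<Longrightarrow> pderiv P \<in> PK"
proof -
  show "pderiv P \<in> PK" if "P \<in> PK"
  proof -
    have "of_nat n \<in> K" for n by (induction n) auto
    from K_mult[OF this[of "Suc i" for i]] that show ?thesis by (simp add: PK_def coeff_pderiv del: of_nat_Suc)
  qed
qed (auto simp: PK_def)

lemma PK_mult: "P \<in> PK \<Longrightarrow> Q \<in> PK \<Longrightarrow> P * Q \<in> PK"
  by (auto simp: PK_def coeff_mult)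

text \<open>Division is carried out by hand so that quotient and remainder visibly stay over K: each
  leading term removed has its coefficient in K.\<close>

lemma PK_division:
  assumes G: "G \<in> PK" "G \<noteq> 0" and F: "F \<in> PK"
  shows "\<exists>Q\<in>PK. \<exists>R\<in>PK. F = G * Q + R \<and> (R = 0 \<or> degree R < degree G)"
  using F
proof (induction "degree F" arbitrary: F rule: less_induct)
  case less
  show ?case
  proof (cases "F = 0 \<or> degree F < degree G")
    case True
    then show ?thesis using less by (intro bexI[of _ 0] bexI[of _ F]) auto
  next
    case False
    define M where "M = Polynomial.monom (lead_coeff F / lead_coeff G) (degree F - degree G)"
    have M: "M \<in> PK" unfolding M_def using less.prems G by (intro PK_monom) (auto simp: PK_def)
    have F': "F - G * M \<in> PK" using less.prems G M by (intro PK_diff PK_mult)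
    have "lead_coeff F / lead_coeff G \<noteq> 0" using False G by simp
    then have dM: "degree M = degree F - degree G" "M \<noteq> 0" by (simp_all add: M_def degree_monom_eq)
    have deg: "degree (G * M) = degree F" using G False dM by (simp add: degree_mult_eq)
    have "coeff (G * M) (degree F) = lead_coeff F"
      using lead_coeff_mult[of G M] G dM deg by (simp add: M_def)
    then have c: "coeff (F - G * M) (degree F) = 0" by simp
    have le: "degree (F - G * M) \<le> degree F" using degree_diff_le[of F "degree F" "G * M"] deg by simp
    show ?thesis
    proof (cases "F - G * M = 0")
      case True
      then show ?thesis using M by (intro bexI[of _ M] bexI[of _ 0]) auto
    next
      case False
      have "degree (F - G * M) < degree F"
        using le c False by (metis leading_coeff_0_iff order_le_less)
      from less.hyps[OF this F'] obtain Q R where "Q \<in> PK" "R \<in> PK" "F - G * M = G * Q + R" "R = 0 \<or> degree R < degree G"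
        by blast
      then show ?thesis using M by (intro bexI[of _ "Q + M"] bexI[of _ R]) (auto simp: algebra_simps PK_add)
    qed
  qed
qed

text \<open>A maximal subspace avoiding \<^term>\<open>v\<close> is a hyperplane; its linear functional is normalised at \<^term>\<open>v\<close>.\<close>

lemma separating_functional:
  fixes V :: "'l set"
  assumes V: "0 \<in> V" "\<And>x y. x \<in> V \<Longrightarrow> y \<in> V \<Longrightarrow> x + y \<in> V" "\<And>c x. c \<in> K \<Longrightarrow> x \<in> V \<Longrightarrow> c * x \<in> V"
    and v: "v \<notin> V"
  obtains \<mu> where "\<And>x y. \<mu> (x + y) = \<mu> x + \<mu> y" "\<And>c x. c \<in> K \<Longrightarrow> \<mu> (c * x) = c * \<mu> x"
    "\<And>x. x \<in> V \<Longrightarrow> \<mu> x = (0 :: 'l)" "\<mu> v = 1"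
proof -
  define sub where "sub W \<longleftrightarrow> 0 \<in> W \<and> (\<forall>x\<in>W. \<forall>y\<in>W. x + y \<in> W) \<and> (\<forall>c\<in>K. \<forall>x\<in>W. c * x \<in> W)" for W :: "'l set"
  define \<A> where "\<A> = {W. sub W \<and> V \<subseteq> W \<and> v \<notin> W}"
  have "V \<in> \<A>" using V v by (auto simp: \<A>_def sub_def)
  have "\<exists>W\<in>\<A>. \<forall>X'\<in>\<A>. W \<subseteq> X' \<longrightarrow> X' = W"
  proof (rule subset_Zorn_nonempty)
    show "\<A> \<noteq> {}" using \<open>V \<in> \<A>\<close> by auto
    fix \<C> assume C: "\<C> \<noteq> {}" "subset.chain \<A> \<C>"
    then have CA: "\<C> \<subseteq> \<A>" and lin: "\<And>X' Y. X' \<in> \<C> \<Longrightarrow> Y \<in> \<C> \<Longrightarrow> X' \<subseteq> Y \<or> Y \<subseteq> X'"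
      by (auto simp: subset_chain_def)
    have "x + y \<in> \<Union>\<C>" if "x \<in> \<Union>\<C>" "y \<in> \<Union>\<C>" for x y
    proof -
      from that obtain X' Y where "X' \<in> \<C>" "x \<in> X'" "Y \<in> \<C>" "y \<in> Y" by auto
      with lin[of X' Y] obtain Z where "Z \<in> \<C>" "x \<in> Z" "y \<in> Z" by blast
      moreover from this have "sub Z" using CA by (auto simp: \<A>_def)
      ultimately show ?thesis unfolding sub_def by blast
    qed
    moreover have "c * x \<in> \<Union>\<C>" if "c \<in> K" "x \<in> \<Union>\<C>" for c x
      using that CA by (fastforce simp: \<A>_def sub_def)
    moreover have "0 \<in> \<Union>\<C>" "V \<subseteq> \<Union>\<C>" "v \<notin> \<Union>\<C>"
      using C(1) CA by (auto simp: \<A>_def sub_def)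
    ultimately show "\<Union>\<C> \<in> \<A>" by (simp add: \<A>_def sub_def)
  qed
  then obtain W where W: "W \<in> \<A>" and mx: "\<And>X'. X' \<in> \<A> \<Longrightarrow> W \<subseteq> X' \<Longrightarrow> X' = W" by blast
  have W0: "0 \<in> W" and Wadd: "\<And>x y. x \<in> W \<Longrightarrow> y \<in> W \<Longrightarrow> x + y \<in> W"
    and Wm: "\<And>c x. c \<in> K \<Longrightarrow> x \<in> W \<Longrightarrow> c * x \<in> W" and VW: "V \<subseteq> W" and vW: "v \<notin> W"
    using W by (auto simp: \<A>_def sub_def)
  have Wdiff: "x - y \<in> W" if "x \<in> W" "y \<in> W" for x y
    using Wadd[OF that(1) Wm[of "- 1" y]] that(2) K_uminus[OF K_1] by simp
  have ex: "\<exists>k\<in>K. x - k * v \<in> W" for x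
  proof (cases "x \<in> W")
    case True
    then show ?thesis by (intro bexI[of _ 0]) auto
  next
    case False
    \<comment> \<open>By maximality, adjoining x to W must bring in v; solving that relation for x
      places x in K v + W.\<close>
    define X' where "X' = {w + k * x | w k. w \<in> W \<and> k \<in> K}"
    have "sub X'"
      unfolding sub_def
    proof (intro conjI ballI)
      show "0 \<in> X'" unfolding X'_def using W0 by (auto intro!: exI[of _ 0])
      fix a b assume "a \<in> X'" "b \<in> X'"
      then obtain w k w' k' where "a = w + k * x" "b = w' + k' * x" "w \<in> W" "w' \<in> W" "k \<in> K" "k' \<in> K"
        by (auto simp: X'_def)
      then show "a + b \<in> X'" unfolding X'_def
        by (intro CollectI exI[of _ "w + w'"] exI[of _ "k + k'"]) (auto simp: algebra_simps Wadd)
    next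
      fix c a assume "c \<in> K" "a \<in> X'"
      then obtain w k where "a = w + k * x" "w \<in> W" "k \<in> K" by (auto simp: X'_def)
      then show "c * a \<in> X'" unfolding X'_def using \<open>c \<in> K\<close>
        by (intro CollectI exI[of _ "c * w"] exI[of _ "c * k"]) (auto simp: algebra_simps Wm)
    qed
    moreover have "W \<subseteq> X'"
    proof
      fix w assume "w \<in> W"
      then show "w \<in> X'" unfolding X'_def by (intro CollectI exI[of _ w] exI[of _ 0]) auto
    qed
    moreover have "x \<in> X'" unfolding X'_def using W0 by (intro CollectI exI[of _ 0] exI[of _ 1]) auto
    ultimately have "v \<in> X'" using mx[of X'] VW False by (auto simp: \<A>_def)
    then obtain w k where wk: "v = w + k * x" "w \<in> W" "k \<in> K" by (auto simp: X'_def)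
    then have "k \<noteq> 0" using vW by auto
    then have "x - inverse k * v = - inverse k * w" using wk by (simp add: field_simps)
    also have "\<dots> \<in> W" using wk by (intro Wm) auto
    finally show ?thesis using wk by blast
  qed
  have uniq: "k = k'" if "k \<in> K" "k' \<in> K" "x - k * v \<in> W" "x - k' * v \<in> W" for x k k'
  proof (rule ccontr)
    assume "k \<noteq> k'"
    have "inverse (k' - k) * ((x - k * v) - (x - k' * v)) \<in> W"
      by (rule Wm[OF _ Wdiff[OF that(3,4)]]) (use that in auto)
    moreover have "inverse (k' - k) * ((x - k * v) - (x - k' * v)) = v"
      using \<open>k \<noteq> k'\<close> by (simp add: field_simps)
    ultimately show False using vW by simp
  qed
  define \<mu> where "\<mu> x = (SOME k. k \<in> K \<and> x - k * v \<in> W)" for x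
  have \<mu>: "\<mu> x \<in> K \<and> x - \<mu> x * v \<in> W" for x
    unfolding \<mu>_def by (rule someI_ex) (use ex in blast)
  have \<mu>I: "\<mu> x = k" if "k \<in> K" "x - k * v \<in> W" for x k
    using uniq \<mu> that by blast
  show thesis
  proof (rule that)
    fix x y c
    have "x + y - (\<mu> x + \<mu> y) * v \<in> W"
      using Wadd[of "x - \<mu> x * v" "y - \<mu> y * v"] \<mu> by (simp add: algebra_simps)
    then show "\<mu> (x + y) = \<mu> x + \<mu> y" using \<mu> by (intro \<mu>I) auto
    show "\<mu> (c * x) = c * \<mu> x" if "c \<in> K"
    proof (rule \<mu>I)
      show "c * x - c * \<mu> x * v \<in> W"
        using Wm[OF that, of "x - \<mu> x * v"] \<mu> by (simp add: algebra_simps)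
    qed (use \<mu> that in auto)
    show "\<mu> x = 0" if "x \<in> V" using that VW by (intro \<mu>I) auto
    show "\<mu> v = 1" using W0 by (intro \<mu>I) auto
  qed
qed

end

lemma map_poly_to_ac_add: "map_poly to_ac (P + Q) = map_poly to_ac P + map_poly to_ac Q"
  by (rule poly_eqI) (simp add: coeff_map_poly)

lemma map_poly_to_ac_mult: "map_poly to_ac (P * Q) = map_poly to_ac P * map_poly to_ac Q"
  by (rule poly_eqI) (simp add: coeff_map_poly coeff_mult to_ac_sum)

lemma map_poly_to_ac_pderiv: "map_poly to_ac (pderiv P) = pderiv (map_poly to_ac P)"
  by (rule poly_eqI) (simp add: coeff_map_poly coeff_pderiv)

lemma order_ge_2_imp_common_root:
  fixes P :: "'a::field poly"
  assumes "P \<noteq> 0" "order c P \<noteq> 0" "order c P \<noteq> 1"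
  shows "poly P c = 0" "poly (pderiv P) c = 0"
proof -
  have "[:- c, 1:] ^ 2 dvd P"
    using assms order_1[of c P] power_le_dvd[of "[:- c, 1:]" "order c P" P 2] by simp
  then obtain Q where "P = [:- c, 1:] ^ 2 * Q" by (auto elim: dvdE)
  then have P: "P = [:- c, 1:] * ([:- c, 1:] * Q)" by (simp only: power2_eq_square mult.assoc)
  show "poly P c = 0" unfolding P by simp
  show "poly (pderiv P) c = 0" unfolding P pderiv_mult[of "[:- c, 1:]"] by (simp only: poly_add poly_mult) simp
qed

context constant_term_setup
begin

lemma minimal_polynomial_exists: "\<exists>P. minimal_polynomial K a P"
proof -
  obtain n u where u: "\<And>v. \<exists>c. (\<forall>i<n. c i \<in> K) \<and> v = (\<Sum>i<(n::nat). c i * u i)"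
    using finite_ext by blast
  obtain d where d: "\<forall>j\<in>{..n}. d j \<in> K" "\<exists>j\<in>{..n}. d j \<noteq> 0" "(\<Sum>j\<le>n. d j * a ^ j) = 0"
    using linear_dependence[of "{..n}" n "\<lambda>j. a ^ j" u] u by auto
  define Q where "Q = (\<Sum>j\<le>n. Polynomial.monom (d j) j)"
  have cQ: "coeff Q i = (if i \<le> n then d i else 0)" for i
    by (simp add: Q_def coeff_sum)
  have "Q \<in> PK" using d by (simp add: PK_def cQ)
  moreover have "Q \<noteq> 0" using d(2) cQ by (metis atMost_iff coeff_0)
  moreover have "poly Q a = 0" using d by (simp add: Q_def poly_sum poly_monom)
  ultimately have "\<exists>Q. Q \<in> PK \<and> Q \<noteq> 0 \<and> poly Q a = 0" by blast
  from ex_has_least_nat[of "\<lambda>Q. Q \<in> PK \<and> Q \<noteq> 0 \<and> poly Q a = 0" _ degree] this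
  obtain Q where Q: "Q \<in> PK" "Q \<noteq> 0" "poly Q a = 0"
    "\<And>Q'. Q' \<in> PK \<Longrightarrow> Q' \<noteq> 0 \<Longrightarrow> poly Q' a = 0 \<Longrightarrow> degree Q \<le> degree Q'" by blast
  have "smult (inverse (lead_coeff Q)) Q \<in> PK" using Q(1) by (intro PK_smult) (auto simp: PK_def)
  then have "minimal_polynomial K a (smult (inverse (lead_coeff Q)) Q)"
    using Q by (auto simp: minimal_polynomial_def PK_def)
  then show ?thesis ..
qed

text \<open>A multiple root c in the closure is shared with the derivative. Were the derivative
  nonzero, the polynomial over K of least degree with root c would have smaller degree than P and
  divide it, against the minimality of P at a.\<close>

lemma inseparable_pderiv:
  assumes P: "minimal_polynomial K a P" and ns: "\<not> rsquarefree (map_poly to_ac P)"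
  shows "pderiv P = 0"
proof (rule ccontr)
  assume "pderiv P \<noteq> 0"
  have PK: "P \<in> PK" "lead_coeff P = 1" "poly P a = 0"
    and least: "\<And>Q. Q \<in> PK \<Longrightarrow> Q \<noteq> 0 \<Longrightarrow> poly Q a = 0 \<Longrightarrow> degree P \<le> degree Q"
    using P by (auto simp: minimal_polynomial_def PK_def)
  have P0: "P \<noteq> 0" using PK by auto
  have "map_poly to_ac P \<noteq> 0" using PK by (metis coeff_0 coeff_map_poly to_ac_0 to_ac_1 zero_neq_one)
  then obtain c where c: "order c (map_poly to_ac P) \<noteq> 0" "order c (map_poly to_ac P) \<noteq> 1"
    using ns by (auto simp: rsquarefree_def)
  define rt where "rt Q \<longleftrightarrow> poly (map_poly to_ac Q) c = 0" for Q
  have rP: "rt P" "rt (pderiv P)"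
    using order_ge_2_imp_common_root[OF \<open>map_poly to_ac P \<noteq> 0\<close> c] by (simp_all add: rt_def map_poly_to_ac_pderiv)
  have "\<exists>Q. Q \<in> PK \<and> Q \<noteq> 0 \<and> rt Q" using rP P0 PK by blast
  from ex_has_least_nat[of "\<lambda>Q. Q \<in> PK \<and> Q \<noteq> 0 \<and> rt Q" _ degree] this
  obtain Q where Q: "Q \<in> PK" "Q \<noteq> 0" "rt Q"
    "\<And>Q'. Q' \<in> PK \<Longrightarrow> Q' \<noteq> 0 \<Longrightarrow> rt Q' \<Longrightarrow> degree Q \<le> degree Q'" by blast
  have "degree P \<noteq> 0" using PK P0 by (metis degree_eq_zeroE lead_coeff_pCons(2) pCons_0_0 poly_const_conv zero_neq_one)
  then have "degree (pderiv P) < degree P"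
    using degree_le[of "degree P - 1" "pderiv P"] by (auto simp: coeff_pderiv coeff_eq_0)
  then have dQ: "degree Q < degree P"
    using Q(4)[of "pderiv P"] rP PK_pderiv[OF PK(1)] \<open>pderiv P \<noteq> 0\<close> by simp
  obtain H R where H: "H \<in> PK" "R \<in> PK" "P = Q * H + R" "R = 0 \<or> degree R < degree Q"
    using PK_division[OF Q(1,2) PK(1)] by blast
  have "rt R" using rP(1) Q(3) unfolding H(3) by (simp add: rt_def map_poly_to_ac_add map_poly_to_ac_mult)
  then have "R = 0" using Q(4)[OF H(2)] H(4) by (metis not_le)
  then have PQ: "P = Q * H" using H by simp
  then have H0: "H \<noteq> 0" using P0 by auto
  \<comment> \<open>Minimality at a replaces irreducibility: a is a root of one of the two factors,
    and either has smaller degree than P unless Q is constant, which its root c excludes.\<close>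
  have "poly Q a = 0 \<or> poly H a = 0" using PK(3) PQ by simp
  then show False
  proof
    assume "poly Q a = 0"
    then show False using least[OF Q(1,2)] dQ by simp
  next
    assume "poly H a = 0"
    then have "degree P \<le> degree H" using least[OF H(1) H0] by simp
    moreover have "degree P = degree Q + degree H" using PQ Q(2) H0 by (simp add: degree_mult_eq)
    ultimately have "degree Q = 0" by simp
    then obtain e where "Q = [:e:]" by (rule degree_eq_zeroE)
    then show False using Q(2,3) by (simp add: rt_def map_poly_pCons)
  qed
qed

text \<open>The case of MacLane's criterion that is needed; the functional \<open>\<mu>\<close> carries the part of the
  linear independence of the powers of \<open>a\<close> that is used.\<close>

lemma inseparable_relation:
  assumes "\<not> separable_extension K"
  obtains a :: 'l and \<kappa> and m and \<mu> :: "'l \<Rightarrow> 'l" where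
    "a \<notin> K" "\<And>j. \<kappa> j \<in> K" "(\<Sum>j\<le>m. \<kappa> j * (a ^ j) ^ p) = 0" "\<kappa> m = 1"
    "\<And>x y. \<mu> (x + y) = \<mu> x + \<mu> y" "\<And>c x. c \<in> K \<Longrightarrow> \<mu> (c * x) = c * \<mu> x"
    "\<And>i. i < m \<Longrightarrow> \<mu> (a ^ i) = 0" "\<mu> (a ^ m) = 1"
proof -
  obtain a P where P: "minimal_polynomial K a P" "\<not> rsquarefree (map_poly to_ac P)"
    using assms minimal_polynomial_exists unfolding separable_extension_def by blast
  have PK: "\<And>i. coeff P i \<in> K" "lead_coeff P = 1" "poly P a = 0"
    and least: "\<And>Q. Q \<in> PK \<Longrightarrow> Q \<noteq> 0 \<Longrightarrow> poly Q a = 0 \<Longrightarrow> degree P \<le> degree Q"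
    using P(1) by (auto simp: minimal_polynomial_def PK_def)
  have P0: "P \<noteq> 0" using PK by auto
  have dP: "degree P \<noteq> 0" using PK P0 by (metis degree_eq_zeroE lead_coeff_pCons(2) pCons_0_0 poly_const_conv zero_neq_one)
  \<comment> \<open>A vanishing derivative kills i times the i-th coefficient, and i is nonzero in L
    unless p divides it.\<close>
  have z: "coeff P i = 0" if "\<not> p dvd i" for i
  proof -
    have "i > 0" using that by (auto intro: gr0I)
    then have "of_nat i * coeff P i = 0"
      using inseparable_pderiv[OF P] coeff_pderiv[of P "i - 1"] by simp
    moreover have "of_nat i \<noteq> (0::'l)" using that char by (simp add: of_nat_eq_0_iff_char_dvd)
    ultimately show ?thesis by simp
  qed
  have "p dvd degree P" using z[of "degree P"] PK(2) by auto
  then obtain m where m: "degree P = p * m" by (elim dvdE)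
  have p2: "p \<ge> 2" using p by (rule prime_ge_2_nat)
  have m0: "m > 0" using m dP by (auto intro: gr0I)
  then have mP: "m < degree P" "1 < degree P" using m mult_le_mono1[OF p2, of m] by linarith+
  define \<kappa> where "\<kappa> j = coeff P (p * j)" for j
  have "(\<Sum>i\<le>degree P. coeff P i * a ^ i) = (\<Sum>i\<in>(\<lambda>j. p * j) ` {..m}. coeff P i * a ^ i)"
  proof (rule sum.mono_neutral_right)
    show "\<forall>i\<in>{..degree P} - (\<lambda>j. p * j) ` {..m}. coeff P i * a ^ i = 0"
    proof
      fix i assume i: "i \<in> {..degree P} - (\<lambda>j. p * j) ` {..m}"
      have "\<not> p dvd i"
      proof
        assume "p dvd i"
        then obtain j where "i = p * j" by (elim dvdE)
        moreover from this have "j \<le> m" using i m p_pos by auto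
        ultimately show False using i by auto
      qed
      then show "coeff P i * a ^ i = 0" using z by simp
    qed
  qed (use m in auto)
  also have "\<dots> = (\<Sum>j\<le>m. \<kappa> j * (a ^ j) ^ p)"
    using p_pos by (subst sum.reindex) (auto simp: inj_on_def \<kappa>_def mult.commute simp flip: power_mult)
  finally have rel: "(\<Sum>j\<le>m. \<kappa> j * (a ^ j) ^ p) = 0" using PK(3) by (simp add: poly_altdef)
  have aK: "a \<notin> K"
  proof
    assume "a \<in> K"
    then have "[:- a, 1:] \<in> PK" by (auto simp: PK_def coeff_pCons split: nat.split)
    from least[OF this] show False using mP by simp
  qed
  \<comment> \<open>The K-span of 1, ..., a^(m-1). It misses a^m because m = deg P / p is smaller
    than deg P.\<close>
  define V where "V = {poly Q a | Q. Q \<in> PK \<and> (\<forall>i\<ge>m. coeff Q i = 0)}"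
  have am: "a ^ m \<notin> V"
  proof
    assume "a ^ m \<in> V"
    then obtain Q where Q: "a ^ m = poly Q a" "Q \<in> PK" "\<forall>i\<ge>m. coeff Q i = 0" by (auto simp: V_def)
    define F where "F = Polynomial.monom 1 m - Q"
    have "F \<in> PK" unfolding F_def using Q by (intro PK_diff PK_monom) auto
    moreover have "coeff F m = 1" using Q by (simp add: F_def)
    then have "F \<noteq> 0" by auto
    moreover have "poly F a = 0" using Q by (simp add: F_def poly_monom)
    moreover have "degree F \<le> m" using Q by (intro degree_le) (auto simp: F_def)
    ultimately show False using least[of F] mP by simp
  qed
  have V0: "0 \<in> V" unfolding V_def by (intro CollectI exI[of _ 0]) auto
  have Vadd: "x + y \<in> V" if "x \<in> V" "y \<in> V" for x y
  proof -
    from that obtain Q Q' where "x = poly Q a" "Q \<in> PK" "\<forall>i\<ge>m. coeff Q i = 0" "y = poly Q' a" "Q' \<in> PK" "\<forall>i\<ge>m. coeff Q' i = 0"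
      by (auto simp: V_def)
    then show ?thesis unfolding V_def by (intro CollectI exI[of _ "Q + Q'"]) (auto simp: PK_add)
  qed
  have Vm: "c * x \<in> V" if "c \<in> K" "x \<in> V" for c x
  proof -
    from that obtain Q where "x = poly Q a" "Q \<in> PK" "\<forall>i\<ge>m. coeff Q i = 0" by (auto simp: V_def)
    then show ?thesis unfolding V_def using that by (intro CollectI exI[of _ "smult c Q"]) (auto simp: PK_smult)
  qed
  obtain \<mu> where \<mu>: "\<And>x y. \<mu> (x + y) = \<mu> x + \<mu> y" "\<And>c x. c \<in> K \<Longrightarrow> \<mu> (c * x) = c * \<mu> x"
    "\<And>x. x \<in> V \<Longrightarrow> \<mu> x = (0 :: 'l)" "\<mu> (a ^ m) = 1"
    using separating_functional[OF V0 Vadd Vm am] by blast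
  have "a ^ i \<in> V" if "i < m" for i
    unfolding V_def using that by (intro CollectI exI[of _ "Polynomial.monom 1 i"]) (auto simp: poly_monom PK_monom)
  then show thesis
    using aK PK(1,2) \<mu> rel by (intro that[of a \<kappa> m \<mu>]) (simp_all add: \<kappa>_def flip: m)
qed

lemma base_changed_ring_properties:
  assumes "\<not> separable_extension K"
  shows "noetherian_local_ring RB" "\<not> reduced_ring RB"
    "\<not> F_injective p RB"
proof -
  interpret T: constant_term_base_change K "RB" Bp p TA.tl TA.tr
    by (rule base_change_tensor)
  show "noetherian_local_ring RB" by (rule T.noetherian_local)
  obtain a m \<kappa> and \<mu> :: "'l \<Rightarrow> 'l" where
    a: "a \<notin> K" "\<And>j. \<kappa> j \<in> K" "(\<Sum>j\<le>m. \<kappa> j * (a ^ j) ^ p) = 0" "\<kappa> m = 1"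
    "\<And>x y. \<mu> (x + y) = \<mu> x + \<mu> y" "\<And>c x. c \<in> K \<Longrightarrow> \<mu> (c * x) = c * \<mu> x"
    "\<And>i. i < m \<Longrightarrow> \<mu> (a ^ i) = 0" "\<mu> (a ^ m) = 1"
    by (rule inseparable_relation[OF assms], rule that, assumption+)
  \<comment> \<open>These p-th roots turn the relation among the p-th powers of the a^i into the
    vanishing of the p-th power of z.\<close>
  have "\<exists>b. b ^ p = to_ac (\<kappa> j)" for j
    using nth_root_exists[of p "to_ac (\<kappa> j)"] p_pos by auto
  then obtain \<beta> where \<beta>: "\<And>j. \<beta> j ^ p = to_ac (\<kappa> j)" by metis
  have \<beta>B: "\<beta> j \<in> Bp" for j using \<beta> a(2) by (auto simp: Bp_def)
  \<comment> \<open>The functional \<mu> vanishes on the lower powers of a, so only the last term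
    survives; its root is nonzero because the last coefficient is 1.\<close>
  have "(\<Sum>i\<le>m. to_ac (\<mu> (a ^ i)) * \<beta> i) = \<beta> m"
    using a(7,8) by (subst sum.remove[of _ m]) (auto intro!: sum.neutral)
  moreover have "\<beta> m \<noteq> 0" using \<beta>[of m] a(4) p_pos by (auto simp: zero_power)
  ultimately have nz: "(\<Sum>i\<le>m. to_ac (\<mu> (a ^ i)) * \<beta> i) \<noteq> 0" by simp
  define x where "x i = TA.tl (fps_const (a ^ i) * fps_X) \<otimes>\<^bsub>RB\<^esub> TA.tr (\<beta> i)" for i
  define z where "z = (\<Oplus>\<^bsub>RB\<^esub>i\<in>{..m}. x i)"
  have x: "x i \<in> carrier RB" for i
    unfolding x_def using \<beta>B by (intro T.T.m_closed T.\<rho>_closed T.\<sigma>_closed) auto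
  have xp: "x i [^]\<^bsub>RB\<^esub> p = TA.tl (fps_const (\<kappa> i * (a ^ i) ^ p) * fps_X ^ p)" for i
  proof -
    have "x i [^]\<^bsub>RB\<^esub> p = TA.tl ((fps_const (a ^ i) * fps_X) ^ p) \<otimes>\<^bsub>RB\<^esub> TA.tr (\<beta> i ^ p)"
      unfolding x_def using \<beta>B
      by (simp add: T.T.nat_pow_distrib T.\<rho>_power T.\<sigma>_power T.\<rho>_closed T.\<sigma>_closed)
    also have "TA.tr (\<beta> i ^ p) = TA.tl (fps_const (\<kappa> i))" using \<beta> a(2) T.\<rho>_const by simp
    also have "TA.tl ((fps_const (a ^ i) * fps_X) ^ p) \<otimes>\<^bsub>RB\<^esub> TA.tl (fps_const (\<kappa> i)) =
        TA.tl ((fps_const (a ^ i) * fps_X) ^ p * fps_const (\<kappa> i))"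
      using a(2) by (intro T.\<rho>_mult[symmetric] CT_power CT_const) auto
    also have "(fps_const (a ^ i) * fps_X) ^ p * fps_const (\<kappa> i) = fps_const (\<kappa> i * (a ^ i) ^ p) * fps_X ^ p"
      by (simp add: power_mult_distrib fps_const_power mult_ac flip: fps_const_mult)
    finally show ?thesis .
  qed
  have CTp: "fps_const (\<kappa> i * (a ^ i) ^ p) * fps_X ^ p \<in> CT" for i
    using p_pos by (simp add: CT_def fps_X_power_nth)
  have "(\<Oplus>\<^bsub>RB\<^esub>i\<in>I. x i) [^]\<^bsub>RB\<^esub> p = TA.tl (\<Sum>i\<in>I. fps_const (\<kappa> i * (a ^ i) ^ p) * fps_X ^ p)"
    if "finite I" for I
    using that
  proof (induction I rule: finite_induct)
    case empty
    then show ?case using T.zero_power_q T.\<rho>_0 by simp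
  next
    case (insert i I)
    have "(\<Oplus>\<^bsub>RB\<^esub>i\<in>I. x i) \<in> carrier RB" using x by (intro T.T.finsum_closed) auto
    then show ?case using insert x CTp T.CT_sum[of I "\<lambda>i. fps_const (\<kappa> i * (a ^ i) ^ p) * fps_X ^ p"]
      by (subst T.T.finsum_insert) (auto simp: T.T_power_add xp T.\<rho>_add)
  qed
  from this[of "{..m}"] have "z [^]\<^bsub>RB\<^esub> p = TA.tl (\<Sum>i\<le>m. fps_const (\<kappa> i * (a ^ i) ^ p) * fps_X ^ p)"
    by (simp add: z_def)
  also have "(\<Sum>i\<le>m. fps_const (\<kappa> i * (a ^ i) ^ p) * fps_X ^ p) = fps_const (\<Sum>i\<le>m. \<kappa> i * (a ^ i) ^ p) * fps_X ^ p"
    by (rule fps_ext) (simp add: fps_sum_nth fps_X_power_mult_right_nth)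
  also have "\<dots> = 0" by (simp add: a(3))
  finally have zp: "z [^]\<^bsub>RB\<^esub> p = \<zero>\<^bsub>RB\<^esub>" by (simp add: T.\<rho>_0)
  show "\<not> reduced_ring RB"
    by (rule T.nilpotent_obstructs_F_injectivity(1)[OF a(5,6) \<beta>B nz z_def[unfolded x_def] zp])
  show "\<not> F_injective p RB"
    by (rule T.nilpotent_obstructs_F_injectivity(2)[OF a(5,6) \<beta>B nz z_def[unfolded x_def] zp])
qed

end

theorem proposition4p2:
  fixes K :: "'l::field set" and p :: nat
  assumes "prime p" and "CHAR('l) = p"
    and "subfield K (ring_of_type_algebra :: 'l ring)"
    and "ring.finite_dimension (ring_of_type_algebra :: 'l ring) K UNIV"
    and "range (\<lambda>a::'l. a ^ p) \<inter> K = (\<lambda>a. a ^ p) ` K"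
    and "\<not> separable_extension K"
  shows "(noetherian_local_ring (constant_term_ring K) \<and>
          complete_local (constant_term_ring K) \<and>
          krull_dim (constant_term_ring K) = 1 \<and>
          F_injective p (constant_term_ring K) \<and>
          F_stable p (constant_term_ring K)) \<and>
         (noetherian_local_ring (base_changed_ring p K) \<and>
          \<not> reduced_ring (base_changed_ring p K) \<and>
          \<not> F_injective p (base_changed_ring p K))"
proof -
  interpret constant_term_setup K p
    using assms(1-3,5) finite_dimension_imp_spanned[OF assms(4)]
    by (intro constant_term_setup.intro field_subset.intro constant_term_setup_axioms.intro) simp_all
  \<comment> \<open>F-stability requires K to differ from L, which inseparability provides.\<close>
  obtain a where "a \<notin> K" by (rule inseparable_relation[OF assms(6)])
  then show ?thesis
    using noetherian_local_R complete_R krull_dim_R F_injective_R F_stable_R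
      base_changed_ring_properties[OF assms(6)] by blast
qed

end
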